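(* Let $\Lambda$ be a real $q$-constrained Willmore surface with central sphere congruence $S$, and let $p(\lambda)=\lambda^{-1}v+v_0+\lambda\overline v$ be a Laurent polynomial with $v_0\in\Gamma(S)$ real, $v\in\Gamma(S^\perp)$ and $p(1)\ne0$. Let $\mu\in S^1$ and let $\phi^\mu_q:(\underline{\mathbb{R}}^{n+1,1},d^{\mu,q}_S)\to(\underline{\mathbb{R}}^{n+1,1},d)$ be an isomorphism of bundles with metric and connection. Suppose that either $v_0$ is non-zero or $\overline\mu v+\mu\overline v$ is non-zero. If $p(\lambda)$ is a $q$-conserved quantity of $\Lambda$, then $\phi^\mu_q\,p(\mu\lambda)$ is an $\mathrm{Ad}_{\phi^\mu_q}(q_\mu)$-conserved quantity of the spectral deformation $\phi^\mu_q\Lambda$ of parameter $\mu$ of $\Lambda$, where $q_\mu=\mu^{-2}q^{1,0}+\mu^2q^{0,1}$.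
   Context: $n\ge 3$; $\mathbb{R}^{n+1,1}$ has metric $(\,,\,)$ of signature $(n+1,1)$, extended complex bilinearly to $\mathbb{C}^{n+2}$; $\mathcal{L}$ is the set of non-zero null vectors of $\mathbb{R}^{n+1,1}$; $M$ is an oriented surface; $\underline{\mathbb{R}}^{n+1,1}=M\times\mathbb{R}^{n+1,1}$ with trivial flat connection $d$. The theory is local: restriction to a suitable non-empty open subset of $M$ is always understood. $\wedge^{2}\mathbb{C}^{n+2}\cong o(\mathbb{C}^{n+2})$ by $(v_1\wedge v_2)(w)=(w,v_1)v_2-(w,v_2)v_1$; $[\mu\wedge\eta](X,Y)=[\mu_X,\eta_Y]-[\mu_Y,\eta_X]$ for Lie-algebra-valued $1$-forms; $d^\nabla$ is the exterior derivative on endomorphism-valued forms. A real surface is a null line subbundle $\Lambda\subset\underline{\mathbb{R}}^{n+1,1}$ defining an immersion $M\to\mathbb{P}(\mathcal{L})\cong S^n$ (standing assumption: not contained in any proper subsphere of $S^n$). $M$ carries the conformal structure of the metrics $g_\sigma(X,Y)=(d_X\sigma,d_Y\sigma)$, $\sigma\in\Gamma(\Lambda)$ never-zero; $(1,0)$/$(0,1)$-parts and $*$ (with $*\omega=-\omega\circ J$) refer to it. For $z$ a holomorphic chart, $\Lambda^{(1)}=\langle\sigma,\sigma_z,\sigma_{\bar z}\rangle$ and the central sphere congruence is (complexified) $S=\langle\sigma,\sigma_z,\sigma_{\bar z},\sigma_{z\bar z}\rangle$. $\mathcal{D}:=\pi_S\circ d\circ\pi_S+\pi_{S^\perp}\circ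 d\circ\pi_{S^\perp}$, $\mathcal{N}:=d-\mathcal{D}$. For a real $q\in\Omega^1(\Lambda\wedge\Lambda^{(1)})$, $\Lambda$ is $q$-constrained Willmore if $d^{\mathcal{D}}q=0$ and $d^{\mathcal{D}}*\mathcal{N}=2[q\wedge*\mathcal{N}]$. Set $d^{\lambda,q}_S:=\mathcal{D}+\lambda^{-1}\mathcal{N}^{1,0}+\lambda\mathcal{N}^{0,1}+(\lambda^{-2}-1)q^{1,0}+(\lambda^2-1)q^{0,1}$; for $\lambda\in S^1$ it is real. For $\mu\in S^1$, an isomorphism $\phi^\mu_q$ as in the claim is an isometry with $\phi^\mu_q\circ d^{\mu,q}_S=d\circ\phi^\mu_q$; $\phi^\mu_q\Lambda$ is the spectral deformation of $\Lambda$ of parameter $\mu$ corresponding to $q$; it is a real $\mathrm{Ad}_{\phi^\mu_q}(q_\mu)$-constrained Willmore surface. A $q$-conserved quantity of a $q$-constrained Willmore surface $\Lambda$ is a Laurent polynomial $p(\lambda)=\lambda^{-1}v+v_0+\lambda\overline v$ with $v_0\in\Gamma(S)$ real, $v\in\Gamma(S^\perp)$ (complexified), $p(1)\neq0$, and $d^{\lambda,q}_Sp(\lambda)=0$ for all $\lambda\in\mathbb{C}\backslash\{0\}$. *)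

theory Defs
  imports "HOL-Analysis.Analysis"
begin

section \<open>Linear algebra of \<open>\<real>\<^sup>n\<^sup>+\<^sup>1\<^sup>,\<^sup>1\<close> and its complexification\<close>

text \<open>
  With \<open>CARD('n) = n + 1\<close>, the space \<open>\<real>\<^sup>n\<^sup>+\<^sup>1\<^sup>,\<^sup>1\<close> is \<open>real ^ 'n option\<close>, the index \<^const>\<open>None\<close> being
  the timelike direction; its complexification is \<open>complex ^ 'n option\<close>. At type \<^typ>\<open>complex\<close>
  the form \<open>mink\<close> is the complex bilinear (not Hermitian) extension.
\<close>

definition mink :: "'a::comm_ring_1 ^ 'n::finite option \<Rightarrow> 'a ^ 'n option \<Rightarrow> 'a" where
  "mink v w = (\<Sum>i\<in>UNIV. v $ Some i * w $ Some i) - v $ None * w $ None"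

definition cplx_vec :: "real ^ 'k::finite \<Rightarrow> complex ^ 'k" where
  "cplx_vec v = (\<chi> i. of_real (v $ i))"

definition cnj_vec :: "complex ^ 'k::finite \<Rightarrow> complex ^ 'k" where
  "cnj_vec v = (\<chi> i. cnj (v $ i))"

definition cplx_mat :: "real ^ 'k::finite ^ 'k \<Rightarrow> complex ^ 'k ^ 'k" where
  "cplx_mat A = map_matrix of_real A"

definition cscale :: "complex \<Rightarrow> complex ^ 'k::finite ^ 'k \<Rightarrow> complex ^ 'k ^ 'k" where
  "cscale a A = map_matrix (\<lambda>b. a * b) A"

definition wedge :: "complex ^ 'n::finite option \<Rightarrow> complex ^ 'n option
    \<Rightarrow> complex ^ 'n option ^ 'n option" where
  "wedge v1 v2 = matrix (\<lambda>w. mink w v1 *s v2 - mink w v2 *s v1)"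

definition lie_bracket :: "complex ^ 'k::finite ^ 'k \<Rightarrow> complex ^ 'k ^ 'k \<Rightarrow> complex ^ 'k ^ 'k" where
  "lie_bracket A B = A ** B - B ** A"

definition perp :: "(complex ^ 'n::finite option) set \<Rightarrow> (complex ^ 'n option) set" where
  "perp T = {w. \<forall>s\<in>T. mink s w = 0}"

text \<open>Meaningful when the restriction of \<^const>\<open>mink\<close> to the subspace \<open>T\<close> is non-degenerate.\<close>

definition orth_proj :: "(complex ^ 'n::finite option) set \<Rightarrow> complex ^ 'n option ^ 'n option" where
  "orth_proj T = (THE P. (\<forall>s\<in>T. P *v s = s) \<and> (\<forall>w\<in>perp T. P *v w = 0))"


section \<open>Oriented surfaces\<close>

primrec cont_diff :: "nat \<Rightarrow> complex set \<Rightarrow> (complex \<Rightarrow> 'b::real_normed_vector) \<Rightarrow> bool" where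
  "cont_diff 0 U f = continuous_on U f"
| "cont_diff (Suc k) U f =
     ((\<forall>u\<in>U. f differentiable (at u)) \<and>
      (\<forall>h. cont_diff k U (\<lambda>u. frechet_derivative f (at u) h)))"

definition smooth_on :: "complex set \<Rightarrow> (complex \<Rightarrow> 'b::real_normed_vector) \<Rightarrow> bool" where
  "smooth_on U f \<longleftrightarrow> (\<forall>k. cont_diff k U f)"

text \<open>
  A chart is a pair of its domain and its coordinate map, \<^typ>\<open>complex\<close> serving as the oriented
  plane \<open>\<real>\<^sup>2\<close>. The coordinate map is arbitrary outside the domain.
\<close>

type_synonym 'm chart = "'m set \<times> ('m \<Rightarrow> complex)"

definition chart_inv :: "'m chart \<Rightarrow> complex \<Rightarrow> 'm" where
  "chart_inv c = inv_into (fst c) (snd c)"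

definition is_chart :: "'m::topological_space chart \<Rightarrow> bool" where
  "is_chart c \<longleftrightarrow> open (fst c) \<and> open (snd c ` fst c) \<and>
     homeomorphism (fst c) (snd c ` fst c) (snd c) (chart_inv c)"

definition oriented_transition :: "'m chart \<Rightarrow> 'm chart \<Rightarrow> bool" where
  "oriented_transition c c' \<longleftrightarrow>
     (let U = snd c ` (fst c \<inter> fst c'); t = snd c' \<circ> chart_inv c in
        smooth_on U t \<and>
        (\<forall>u\<in>U. let D = frechet_derivative t (at u) in
                 Re (D 1) * Im (D \<i>) - Im (D 1) * Re (D \<i>) > 0))"

definition oriented_surface :: "'m::{t2_space, second_countable_topology} chart set \<Rightarrow> bool" where
  "oriented_surface A \<longleftrightarrow> connected (UNIV :: 'm set) \<and>
     (\<forall>c\<in>A. is_chart c) \<and> (\<Union>c\<in>A. fst c) = UNIV \<and>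
     (\<forall>c\<in>A. \<forall>c'\<in>A. oriented_transition c c')"

definition max_atlas :: "'m::topological_space chart set \<Rightarrow> 'm chart set" where
  "max_atlas A = {c. is_chart c \<and>
     (\<forall>c'\<in>A. oriented_transition c c' \<and> oriented_transition c' c)}"

definition smooth_map :: "'m chart set \<Rightarrow> 'm set \<Rightarrow> ('m \<Rightarrow> 'b::real_normed_vector) \<Rightarrow> bool" where
  "smooth_map A W f \<longleftrightarrow> (\<forall>c\<in>A. smooth_on (snd c ` (W \<inter> fst c)) (f \<circ> chart_inv c))"

text \<open>
  \<open>dd c h f x\<close> is the derivative at \<open>x\<close> of \<open>f\<close> along the tangent vector whose components in the
  chart \<open>c\<close> are \<open>h\<close>; it is the flat connection \<open>d\<close> when \<open>f\<close> is vector valued.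
\<close>

definition dd :: "'m chart \<Rightarrow> complex \<Rightarrow> ('m \<Rightarrow> 'b::real_normed_vector) \<Rightarrow> 'm \<Rightarrow> 'b" where
  "dd c h f x = frechet_derivative (f \<circ> chart_inv c) (at (snd c x)) h"

definition d_z :: "'m chart \<Rightarrow> ('m \<Rightarrow> complex ^ 'k::finite) \<Rightarrow> 'm \<Rightarrow> complex ^ 'k" where
  "d_z c f x = (1 / 2) *s (dd c 1 f x - \<i> *s dd c \<i> f x)"

definition d_zbar :: "'m chart \<Rightarrow> ('m \<Rightarrow> complex ^ 'k::finite) \<Rightarrow> 'm \<Rightarrow> complex ^ 'k" where
  "d_zbar c f x = (1 / 2) *s (dd c 1 f x + \<i> *s dd c \<i> f x)"


section \<open>Real surfaces in the conformal sphere and their central sphere congruence\<close>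

definition local_lift :: "'m::topological_space chart set \<Rightarrow> ('m \<Rightarrow> (real ^ 'n::finite option) set)
    \<Rightarrow> 'm \<Rightarrow> ('m \<Rightarrow> real ^ 'n option) \<Rightarrow> bool" where
  "local_lift A L x \<sigma> \<longleftrightarrow>
     (\<exists>W. open W \<and> x \<in> W \<and> smooth_map A W \<sigma> \<and> (\<forall>y\<in>W. \<sigma> y \<in> L y \<and> \<sigma> y \<noteq> 0))"

definition null_line_subbundle ::
    "'m::topological_space chart set \<Rightarrow> ('m \<Rightarrow> (real ^ 'n::finite option) set) \<Rightarrow> bool" where
  "null_line_subbundle A L \<longleftrightarrow>
     (\<forall>x. (\<exists>l. l \<noteq> 0 \<and> mink l l = 0 \<and> L x = span {l}) \<and> (\<exists>\<sigma>. local_lift A L x \<sigma>))"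

text \<open>
  The differential of \<open>L : M \<rightarrow> P(\<L>)\<close> is \<open>X \<mapsto> (\<sigma> \<mapsto> d\<^sub>X\<sigma> mod L)\<close>, so that it is injective when
  \<open>d\<^sub>X\<sigma>\<close> leaves \<open>L\<close> for \<open>X \<noteq> 0\<close>.
\<close>

definition immersed ::
    "'m::topological_space chart set \<Rightarrow> ('m \<Rightarrow> (real ^ 'n::finite option) set) \<Rightarrow> bool" where
  "immersed A L \<longleftrightarrow>
     (\<forall>c\<in>A. \<forall>x\<in>fst c. \<forall>\<sigma> h. local_lift A L x \<sigma> \<and> h \<noteq> 0 \<longrightarrow> dd c h \<sigma> x \<notin> L x)"

text \<open>
  Subspheres of \<open>S\<^sup>n = P(\<L>)\<close> are the \<open>P(\<L> \<inter> V)\<close> with \<open>V\<close> a Lorentzian subspace, that is,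
  one containing a timelike vector.
\<close>

definition in_proper_subsphere :: "('m \<Rightarrow> (real ^ 'n::finite option) set) \<Rightarrow> bool" where
  "in_proper_subsphere L \<longleftrightarrow>
     (\<exists>V. subspace V \<and> V \<noteq> UNIV \<and> (\<exists>t\<in>V. mink t t < 0) \<and> (\<forall>x. L x \<subseteq> V))"

text \<open>
  Holomorphic charts of \<open>M\<close> for the orientation and the conformal class of the metrics
  \<open>g\<^sub>\<sigma>(X,Y) = (d\<^sub>X\<sigma>,d\<^sub>Y\<sigma>)\<close>: the oriented conformal charts.
\<close>

definition hol_chart :: "'m::topological_space chart set \<Rightarrow> ('m \<Rightarrow> (real ^ 'n::finite option) set)
    \<Rightarrow> 'm chart \<Rightarrow> bool" where
  "hol_chart A L c \<longleftrightarrow> c \<in> max_atlas A \<and>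
     (\<forall>x\<in>fst c. \<forall>\<sigma>. local_lift A L x \<sigma> \<longrightarrow>
        mink (dd c 1 \<sigma> x) (dd c 1 \<sigma> x) = mink (dd c \<i> \<sigma> x) (dd c \<i> \<sigma> x) \<and>
        mink (dd c 1 \<sigma> x) (dd c \<i> \<sigma> x) = 0)"

text \<open>
  The last clause is the existence of isothermal coordinates, which holds for every conformal
  structure on a surface; it is recorded here so that the holomorphic charts form an atlas.
\<close>

definition real_surface :: "'m::{t2_space, second_countable_topology} chart set
    \<Rightarrow> ('m \<Rightarrow> (real ^ 'n::finite option) set) \<Rightarrow> bool" where
  "real_surface A L \<longleftrightarrow> null_line_subbundle A L \<and> immersed A L \<and> \<not> in_proper_subsphere L \<and>
     (\<forall>x. \<exists>c. hol_chart A L c \<and> x \<in> fst c)"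

text \<open>
  \<open>S = \<langle>\<sigma>, \<sigma>\<^sub>z, \<sigma>\<^sub>z\<^sub>b\<^sub>a\<^sub>r, \<sigma>\<^sub>z\<^sub>z\<^sub>b\<^sub>a\<^sub>r\<rangle>\<close>, complexified; the span depends neither on the lift nor on the
  holomorphic chart, and at each point it is determined by any choice of both.
\<close>

definition central_sphere_congruence ::
    "'m::topological_space chart set \<Rightarrow> ('m \<Rightarrow> (real ^ 'n::finite option) set)
      \<Rightarrow> ('m \<Rightarrow> (complex ^ 'n option) set) \<Rightarrow> bool" where
  "central_sphere_congruence A L S \<longleftrightarrow>
     (\<forall>c x \<sigma>. hol_chart A L c \<and> x \<in> fst c \<and> local_lift A L x \<sigma> \<longrightarrow>
        (let s = cplx_vec \<circ> \<sigma> in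
         S x = vec.span {s x, d_z c s x, d_zbar c s x, d_z c (d_zbar c s) x}))"


section \<open>Endomorphism-valued forms\<close>

text \<open>
  A 1-form is given by its expressions in charts: \<open>\<omega> c x h\<close> is its value at \<open>x\<close> on the tangent
  vector with components \<open>h\<close> in the chart \<open>c\<close>. Only the expressions in the holomorphic charts of
  the surface, which determine the form, are relevant; in these the complex structure \<open>J\<close> is
  multiplication by \<open>\<i>\<close>.
\<close>

type_synonym ('m, 'k) endo_form = "'m chart \<Rightarrow> 'm \<Rightarrow> complex \<Rightarrow> complex ^ 'k ^ 'k"

definition one_form :: "'m::topological_space chart set \<Rightarrow> ('m \<Rightarrow> (real ^ 'n::finite option) set)
    \<Rightarrow> ('m, 'n option) endo_form \<Rightarrow> bool" where
  "one_form A L \<omega> \<longleftrightarrow>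
     (\<forall>c. hol_chart A L c \<longrightarrow>
        (\<forall>x\<in>fst c. linear (\<omega> c x)) \<and> (\<forall>h. smooth_map A (fst c) (\<lambda>x. \<omega> c x h))) \<and>
     (\<forall>c c'. hol_chart A L c \<and> hol_chart A L c' \<longrightarrow>
        (\<forall>x\<in>fst c \<inter> fst c'. \<forall>h. \<omega> c x h = \<omega> c' x (dd c h (snd c') x)))"

definition part10 :: "('m, 'k::finite) endo_form \<Rightarrow> ('m, 'k) endo_form" where
  "part10 \<omega> c x h = cscale (1 / 2) (\<omega> c x h - cscale \<i> (\<omega> c x (\<i> * h)))"

definition part01 :: "('m, 'k::finite) endo_form \<Rightarrow> ('m, 'k) endo_form" where
  "part01 \<omega> c x h = cscale (1 / 2) (\<omega> c x h + cscale \<i> (\<omega> c x (\<i> * h)))"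

definition hodge :: "('m, 'k::finite) endo_form \<Rightarrow> ('m, 'k) endo_form" where
  "hodge \<omega> c x h = - \<omega> c x (\<i> * h)"

definition wedge_bracket :: "('m, 'k::finite) endo_form \<Rightarrow> ('m, 'k) endo_form
    \<Rightarrow> 'm chart \<Rightarrow> 'm \<Rightarrow> complex \<Rightarrow> complex \<Rightarrow> complex ^ 'k ^ 'k" where
  "wedge_bracket \<mu> \<eta> c x h k =
     lie_bracket (\<mu> c x h) (\<eta> c x k) - lie_bracket (\<mu> c x k) (\<eta> c x h)"

definition D_conn :: "('m \<Rightarrow> (complex ^ 'n::finite option) set) \<Rightarrow> 'm chart \<Rightarrow> complex
    \<Rightarrow> ('m \<Rightarrow> complex ^ 'n option) \<Rightarrow> 'm \<Rightarrow> complex ^ 'n option" where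
  "D_conn S c h \<xi> x =
     orth_proj (S x) *v dd c h (\<lambda>y. orth_proj (S y) *v \<xi> y) x +
     orth_proj (perp (S x)) *v dd c h (\<lambda>y. orth_proj (perp (S y)) *v \<xi> y) x"

text \<open>
  \<open>\<N> = d - \<D>\<close> is tensorial, hence determined by its values on constant sections; likewise for
  the derivative of an endomorphism, \<open>(\<D>\<^sub>X B)\<xi> = \<D>\<^sub>X(B\<xi>) - B(\<D>\<^sub>X\<xi>)\<close>.
\<close>

definition N_form :: "('m \<Rightarrow> (complex ^ 'n::finite option) set) \<Rightarrow> ('m, 'n option) endo_form" where
  "N_form S c x h = matrix (\<lambda>w. dd c h (\<lambda>_. w) x - D_conn S c h (\<lambda>_. w) x)"

definition D_endo :: "('m \<Rightarrow> (complex ^ 'n::finite option) set) \<Rightarrow> 'm chart \<Rightarrow> complex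
    \<Rightarrow> ('m \<Rightarrow> complex ^ 'n option ^ 'n option) \<Rightarrow> 'm \<Rightarrow> complex ^ 'n option ^ 'n option" where
  "D_endo S c h B x =
     matrix (\<lambda>w. D_conn S c h (\<lambda>y. B y *v w) x - B x *v D_conn S c h (\<lambda>_. w) x)"

text \<open>
  \<open>d\<^sup>\<D>\<omega>\<close> on the commuting vector fields with constant components \<open>h\<close>, \<open>k\<close>.
\<close>

definition ext_D :: "('m \<Rightarrow> (complex ^ 'n::finite option) set) \<Rightarrow> ('m, 'n option) endo_form
    \<Rightarrow> 'm chart \<Rightarrow> 'm \<Rightarrow> complex \<Rightarrow> complex \<Rightarrow> complex ^ 'n option ^ 'n option" where
  "ext_D S \<omega> c x h k = D_endo S c h (\<lambda>y. \<omega> c y k) x - D_endo S c k (\<lambda>y. \<omega> c y h) x"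


section \<open>Constrained Willmore surfaces and conserved quantities\<close>

definition real_form :: "'m::topological_space chart set \<Rightarrow> ('m \<Rightarrow> (real ^ 'n::finite option) set)
    \<Rightarrow> ('m, 'n option) endo_form \<Rightarrow> bool" where
  "real_form A L \<omega> \<longleftrightarrow>
     (\<forall>c. hol_chart A L c \<longrightarrow> (\<forall>x\<in>fst c. \<forall>h. map_matrix cnj (\<omega> c x h) = \<omega> c x h))"

text \<open>
  Forms with values in (the complexification of) \<open>L \<and> L\<^sup>(\<^sup>1\<^sup>)\<close>; as \<open>L\<close> has rank one, each element of
  this bundle is of the form \<open>\<sigma> \<and> a\<close>.
\<close>

definition in_L_wedge_L1 :: "'m::topological_space chart set \<Rightarrow> ('m \<Rightarrow> (real ^ 'n::finite option) set)
    \<Rightarrow> ('m, 'n option) endo_form \<Rightarrow> bool" where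
  "in_L_wedge_L1 A L \<omega> \<longleftrightarrow>
     (\<forall>c x \<sigma> h. hol_chart A L c \<and> x \<in> fst c \<and> local_lift A L x \<sigma> \<longrightarrow>
        (let s = cplx_vec \<circ> \<sigma> in
         \<exists>a\<in>vec.span {s x, d_z c s x, d_zbar c s x}. \<omega> c x h = wedge (s x) a))"

definition constrained_willmore :: "'m::{t2_space, second_countable_topology} chart set
    \<Rightarrow> ('m \<Rightarrow> (real ^ 'n::finite option) set) \<Rightarrow> ('m \<Rightarrow> (complex ^ 'n option) set)
    \<Rightarrow> ('m, 'n option) endo_form \<Rightarrow> bool" where
  "constrained_willmore A L S q \<longleftrightarrow>
     real_surface A L \<and> central_sphere_congruence A L S \<and>
     one_form A L q \<and> real_form A L q \<and> in_L_wedge_L1 A L q \<and>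
     (\<forall>c. hol_chart A L c \<longrightarrow> (\<forall>x\<in>fst c. \<forall>h k.
        ext_D S q c x h k = 0 \<and>
        ext_D S (hodge (N_form S)) c x h k = 2 *\<^sub>R wedge_bracket q (hodge (N_form S)) c x h k))"

definition d_lambda :: "('m \<Rightarrow> (complex ^ 'n::finite option) set) \<Rightarrow> ('m, 'n option) endo_form
    \<Rightarrow> complex \<Rightarrow> 'm chart \<Rightarrow> complex \<Rightarrow> ('m \<Rightarrow> complex ^ 'n option) \<Rightarrow> 'm \<Rightarrow> complex ^ 'n option" where
  "d_lambda S q lam c h \<xi> x =
     D_conn S c h \<xi> x
     + (1 / lam) *s (part10 (N_form S) c x h *v \<xi> x)
     + lam *s (part01 (N_form S) c x h *v \<xi> x)
     + (1 / lam\<^sup>2 - 1) *s (part10 q c x h *v \<xi> x)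
     + (lam\<^sup>2 - 1) *s (part01 q c x h *v \<xi> x)"

text \<open>
  Laurent polynomials are represented by their values; only \<open>p lam\<close> with \<open>lam \<noteq> 0\<close> matters.
\<close>

definition laurent_section :: "'m chart set \<Rightarrow> ('m \<Rightarrow> (complex ^ 'n::finite option) set)
    \<Rightarrow> ('m \<Rightarrow> complex ^ 'n option) \<Rightarrow> ('m \<Rightarrow> complex ^ 'n option)
    \<Rightarrow> (complex \<Rightarrow> 'm \<Rightarrow> complex ^ 'n option) \<Rightarrow> bool" where
  "laurent_section A S v v0 p \<longleftrightarrow>
     smooth_map A UNIV v0 \<and> (\<forall>x. v0 x \<in> S x) \<and> (\<forall>x. cnj_vec (v0 x) = v0 x) \<and>
     smooth_map A UNIV v \<and> (\<forall>x. v x \<in> perp (S x)) \<and>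
     (\<forall>lam x. lam \<noteq> 0 \<longrightarrow> p lam x = (1 / lam) *s v x + v0 x + lam *s cnj_vec (v x)) \<and>
     (\<exists>x. p 1 x \<noteq> 0)"

definition conserved_quantity :: "'m::{t2_space, second_countable_topology} chart set
    \<Rightarrow> ('m \<Rightarrow> (real ^ 'n::finite option) set) \<Rightarrow> ('m \<Rightarrow> (complex ^ 'n option) set)
    \<Rightarrow> ('m, 'n option) endo_form \<Rightarrow> (complex \<Rightarrow> 'm \<Rightarrow> complex ^ 'n option) \<Rightarrow> bool" where
  "conserved_quantity A L S q p \<longleftrightarrow>
     constrained_willmore A L S q \<and> (\<exists>v v0. laurent_section A S v v0 p) \<and>
     (\<forall>lam c. lam \<noteq> 0 \<and> hol_chart A L c \<longrightarrow>
        (\<forall>x\<in>fst c. \<forall>h. d_lambda S q lam c h (p lam) x = 0))"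

text \<open>Isomorphisms \<open>(\<real>\<^sup>n\<^sup>+\<^sup>1\<^sup>,\<^sup>1, d\<^sub>S\<^sup>\<mu>\<^sup>,\<^sup>q) \<rightarrow> (\<real>\<^sup>n\<^sup>+\<^sup>1\<^sup>,\<^sup>1, d)\<close> of bundles with metric and connection, for \<open>\<bar>\<mu>\<bar> = 1\<close>.\<close>

definition spectral_iso :: "'m::topological_space chart set
    \<Rightarrow> ('m \<Rightarrow> (real ^ 'n::finite option) set) \<Rightarrow> ('m \<Rightarrow> (complex ^ 'n option) set)
    \<Rightarrow> ('m, 'n option) endo_form \<Rightarrow> complex \<Rightarrow> ('m \<Rightarrow> real ^ 'n option ^ 'n option) \<Rightarrow> bool" where
  "spectral_iso A L S q \<mu> \<phi> \<longleftrightarrow>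
     smooth_map A UNIV \<phi> \<and> (\<forall>x. invertible (\<phi> x)) \<and>
     (\<forall>x v w. mink (\<phi> x *v v) (\<phi> x *v w) = mink v w) \<and>
     (\<forall>\<xi> :: 'm \<Rightarrow> real ^ 'n option. smooth_map A UNIV \<xi> \<longrightarrow>
        (\<forall>c. hol_chart A L c \<longrightarrow> (\<forall>x\<in>fst c. \<forall>h.
           cplx_mat (\<phi> x) *v d_lambda S q \<mu> c h (cplx_vec \<circ> \<xi>) x =
           cplx_vec (dd c h (\<lambda>y. \<phi> y *v \<xi> y) x))))"

definition Ad_form :: "('m \<Rightarrow> real ^ 'k::finite ^ 'k) \<Rightarrow> ('m, 'k) endo_form
    \<Rightarrow> ('m, 'k) endo_form" where
  "Ad_form \<phi> \<omega> c x h = cplx_mat (\<phi> x) ** \<omega> c x h ** matrix_inv (cplx_mat (\<phi> x))"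

definition q_spectral :: "complex \<Rightarrow> ('m, 'k::finite) endo_form \<Rightarrow> ('m, 'k) endo_form" where
  "q_spectral \<mu> q c x h =
     cscale (1 / \<mu>\<^sup>2) (part10 q c x h) + cscale (\<mu>\<^sup>2) (part01 q c x h)"

definition spectral_deformation :: "('m \<Rightarrow> real ^ 'k::finite ^ 'k) \<Rightarrow> ('m \<Rightarrow> (real ^ 'k) set)
    \<Rightarrow> 'm \<Rightarrow> (real ^ 'k) set" where
  "spectral_deformation \<phi> L x = (\<lambda>w. \<phi> x *v w) ` L x"

definition spectral_sphere :: "('m \<Rightarrow> real ^ 'k::finite ^ 'k) \<Rightarrow> ('m \<Rightarrow> (complex ^ 'k) set)
    \<Rightarrow> 'm \<Rightarrow> (complex ^ 'k) set" where
  "spectral_sphere \<phi> S x = (\<lambda>w. cplx_mat (\<phi> x) *v w) ` S x"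

end

theory Submission
  imports Defs
begin

text \<open>
  Let \<open>P\<close> be the orthogonal projection onto \<open>S\<close>. It is smooth, as the frame \<open>\<sigma>, \<sigma>\<^sub>z, \<sigma>\<^sub>z\<^sub>b\<^sub>a\<^sub>r, \<sigma>\<^sub>z\<^sub>z\<^sub>b\<^sub>a\<^sub>r\<close>
  has an explicit Gram matrix, and \<open>\<N> = [dP, P]\<close>, so that the symmetry of second derivatives gives the
  Codazzi equation \<open>d\<^sup>\<D>\<N> = 0\<close>. The connection of parameter \<open>\<mu>\<close> is \<open>d + K + E\<close> with \<open>K = \<N>\<^sub>\<mu> - \<N>\<close>
  exchanging \<open>S\<close> and its complement and \<open>E = q\<^sub>\<mu> - q\<close> preserving them, whence \<open>d\<phi> = \<phi>(K + E)\<close>.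
  The splitting by \<open>\<phi>S\<close> therefore has \<open>\<N>' = \<phi>\<N>\<^sub>\<mu>\<phi>\<^sup>-\<^sup>1\<close> and \<open>\<D>' = \<phi>(\<D> + E)\<phi>\<^sup>-\<^sup>1\<close>, and the family
  of connections of the deformed surface at \<open>\<lambda>\<close> is the conjugate of the original one at \<open>\<mu>\<lambda>\<close>.

  The first derivatives of \<open>\<phi>\<sigma>\<close> are those of \<open>\<sigma>\<close> moved by \<open>\<phi>\<close>, because \<open>K + E\<close> annihilates \<open>\<sigma>\<close>; so
  the conformal structure is unchanged and \<open>\<phi>S\<close> is the central sphere congruence of \<open>\<phi>\<Lambda>\<close>.
  The equation \<open>d\<^sup>\<D>\<^sup>'q' = 0\<close> needs \<open>d\<^sup>\<D>*q = 0\<close>, which for forms with values in \<open>\<Lambda> \<and> \<Lambda>\<^sup>(\<^sup>1\<^sup>)\<close> follows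
  from \<open>d\<^sup>\<D>q = 0\<close>. A Lorentzian subspace containing \<open>\<phi>\<Lambda>\<close> would have a constant orthogonal vector,
  whose pullback is again constant and orthogonal to \<open>\<Lambda>\<close>.
\<close>


section \<open>Smooth maps on plane domains\<close>

text \<open>On the unit circle the weighted sum of the two types of a form is a real combination of
  the form and its star: N_\<mu> = Re \<mu> N + Im \<mu> *N and q_\<mu> = Re(\<mu>^2) q +
  Im(\<mu>^2) *q. Each deformed equation therefore needs two original ones. For *N_\<mu> these are
  the Willmore equation and Codazzi; for q_\<mu> they are closedness of q and a coclosedness that
  must be derived from the position of q in \<Lambda> \<and> \<Lambda>^(1). The diagonal part E acts
  through brackets. It commutes with q_\<mu>, because \<Lambda> \<and> \<Lambda>^(1) is abelian; its
  bracket with *N_\<mu> supplies exactly what the Willmore equation for q_\<mu> demands. The formula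
  for P depends on a lift and a holomorphic chart, which exist only locally, so the calculus is done
  on a neighbourhood inside one chart. Since \<phi> leaves the conformal structure alone, one chart
  serves both surfaces. The alternative on v_0 and v says that p(\<mu>) has a non-zero component in
  S or in its complement somewhere, which is the condition p'(1) \<noteq> 0 for the new Laurent
  polynomial.\<close>

lemma cont_diff_cong:
  assumes "open U" "\<And>u. u \<in> U \<Longrightarrow> f u = g u" "cont_diff k U f"
  shows "cont_diff k U g"
  using assms(2,3)
proof (induction k arbitrary: f g)
  case 0
  then show ?case by (simp cong: continuous_on_cong)
next
  case (Suc k)
  have 1: "g differentiable (at u)" if "u \<in> U" for u
  proof -
    from Suc.prems that have "f differentiable (at u)" by simp
    then obtain D where "(f has_derivative D) (at u)" by (auto simp: differentiable_def)
    from has_derivative_transform_within_open[OF this assms(1) that, of g] Suc.prems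
    show ?thesis by (auto simp: differentiable_def)
  qed
  have 2: "frechet_derivative f (at u) = frechet_derivative g (at u)" if "u \<in> U" for u
    by (rule frechet_derivative_transform_within_open[OF _ assms(1) that])
       (use Suc.prems that in auto)
  have "cont_diff k U (\<lambda>u. frechet_derivative g (at u) h)" for h
    by (rule Suc.IH[of "\<lambda>u. frechet_derivative f (at u) h"]) (use 2 Suc.prems in auto)
  with 1 show ?case by simp
qed

lemma cont_diff_subset: "cont_diff k U f \<Longrightarrow> V \<subseteq> U \<Longrightarrow> cont_diff k V f"
  by (induction k arbitrary: f) (auto intro: continuous_on_subset)

lemma cont_diff_local:
  assumes "\<And>u. u \<in> U \<Longrightarrow> \<exists>V. open V \<and> u \<in> V \<and> cont_diff k V f"
  shows "cont_diff k U f"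
  using assms
proof (induction k arbitrary: f)
  case 0
  have "continuous (at u) f" if "u \<in> U" for u
    using 0[OF that] by (auto simp: continuous_on_eq_continuous_at)
  then show ?case by (simp add: continuous_at_imp_continuous_on)
next
  case (Suc k)
  have "\<exists>V. open V \<and> u \<in> V \<and> cont_diff k V (\<lambda>u. frechet_derivative f (at u) h)"
    if "u \<in> U" for u h
    using Suc.prems[OF that] by auto
  then have "cont_diff k U (\<lambda>u. frechet_derivative f (at u) h)" for h by (rule Suc.IH)
  moreover have "f differentiable (at u)" if "u \<in> U" for u
    using Suc.prems[OF that] by auto
  ultimately show ?case by simp
qed

lemma cont_diff_differentiable: "cont_diff (Suc k) U f \<Longrightarrow> u \<in> U \<Longrightarrow> f differentiable (at u)"
  by simp

lemma cont_diff_SucD: "cont_diff (Suc k) U f \<Longrightarrow> cont_diff k U f"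
proof (induction k arbitrary: f)
  case 0
  then show ?case
    by (auto intro!: continuous_at_imp_continuous_on differentiable_imp_continuous_within)
next
  case (Suc k)
  from Suc.prems have "cont_diff (Suc k) U (\<lambda>u. frechet_derivative f (at u) h)" for h
    by simp
  from Suc.IH[OF this] Suc.prems show ?case by simp
qed

lemma cont_diff_const: "cont_diff k U (\<lambda>_. c)"
  by (induction k arbitrary: c) auto

lemma frechet_derivative_bilinear:
  assumes "bounded_bilinear B" "f differentiable (at u)" "g differentiable (at u)"
  shows "frechet_derivative (\<lambda>u. B (f u) (g u)) (at u) h =
    B (frechet_derivative f (at u) h) (g u) + B (f u) (frechet_derivative g (at u) h)"
    and "(\<lambda>u. B (f u) (g u)) differentiable (at u)"
proof -
  have "((\<lambda>u. B (f u) (g u)) has_derivative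
     (\<lambda>h. B (f u) (frechet_derivative g (at u) h) + B (frechet_derivative f (at u) h) (g u))) (at u)"
    using bounded_bilinear.FDERIV[OF assms(1), of f _ u UNIV g] assms(2,3)
    by (simp add: frechet_derivative_works)
  from frechet_derivative_at[OF this] this
  show "frechet_derivative (\<lambda>u. B (f u) (g u)) (at u) h =
    B (frechet_derivative f (at u) h) (g u) + B (f u) (frechet_derivative g (at u) h)"
    "(\<lambda>u. B (f u) (g u)) differentiable (at u)"
    by (auto simp: differentiable_def fun_eq_iff add.commute dest: sym)
qed

lemma frechet_derivative_bounded_linear:
  assumes "bounded_linear T" "f differentiable (at u)"
  shows "frechet_derivative (\<lambda>u. T (f u)) (at u) h = T (frechet_derivative f (at u) h)"
    and "(\<lambda>u. T (f u)) differentiable (at u)"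
proof -
  have "((\<lambda>u. T (f u)) has_derivative (\<lambda>h. T (frechet_derivative f (at u) h))) (at u)"
    using bounded_linear.has_derivative[OF assms(1)] assms(2) by (simp add: frechet_derivative_works)
  from frechet_derivative_at[OF this] this
  show "frechet_derivative (\<lambda>u. T (f u)) (at u) h = T (frechet_derivative f (at u) h)"
    "(\<lambda>u. T (f u)) differentiable (at u)"
    by (auto simp: differentiable_def fun_eq_iff dest: sym)
qed

lemma frechet_derivative_add:
  assumes "f differentiable (at u)" "g differentiable (at u)"
  shows "frechet_derivative (\<lambda>u. f u + g u) (at u) h =
    frechet_derivative f (at u) h + frechet_derivative g (at u) h"
proof -
  have "((\<lambda>u. f u + g u) has_derivative
    (\<lambda>h. frechet_derivative f (at u) h + frechet_derivative g (at u) h)) (at u)"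
    using assms by (auto intro!: has_derivative_add simp: frechet_derivative_works)
  from frechet_derivative_at[OF this] show ?thesis by (metis)
qed

lemma cont_diff_add:
  assumes "open U" "cont_diff k U f" "cont_diff k U g"
  shows "cont_diff k U (\<lambda>u. f u + g u)"
  using assms(2,3)
proof (induction k arbitrary: f g)
  case (Suc k)
  have "cont_diff k U (\<lambda>u. frechet_derivative (\<lambda>u. f u + g u) (at u) h)" for h
    by (rule cont_diff_cong[OF assms(1) _ Suc.IH[of "\<lambda>u. frechet_derivative f (at u) h"
       "\<lambda>u. frechet_derivative g (at u) h"]])
       (use Suc.prems in \<open>auto simp: frechet_derivative_add\<close>)
  with Suc.prems show ?case by auto
qed (auto intro: continuous_intros)

lemma cont_diff_bounded_linear:
  assumes "open U" "bounded_linear T" "cont_diff k U f"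
  shows "cont_diff k U (\<lambda>u. T (f u))"
  using assms(3)
proof (induction k arbitrary: f)
  case 0
  then show ?case by (auto intro: bounded_linear.continuous_on[OF assms(2)])
next
  case (Suc k)
  have "cont_diff k U (\<lambda>u. frechet_derivative (\<lambda>u. T (f u)) (at u) h)" for h
    by (rule cont_diff_cong[OF assms(1) _ Suc.IH[of "\<lambda>u. frechet_derivative f (at u) h"]])
       (use Suc.prems in \<open>auto simp: frechet_derivative_bounded_linear[OF assms(2)]\<close>)
  with Suc.prems show ?case by (auto simp: frechet_derivative_bounded_linear[OF assms(2)])
qed

lemma cont_diff_bilinear:
  assumes "open U" "bounded_bilinear B" "cont_diff k U f" "cont_diff k U g"
  shows "cont_diff k U (\<lambda>u. B (f u) (g u))"
  using assms(3,4)
proof (induction k arbitrary: f g)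
  case 0
  then show ?case by (auto intro: bounded_bilinear.continuous_on[OF assms(2)])
next
  case (Suc k)
  have "cont_diff k U (\<lambda>u. B (frechet_derivative f (at u) h) (g u) + B (f u) (frechet_derivative g (at u) h))" for h
    by (rule cont_diff_add[OF assms(1)]; rule Suc.IH)
       (use Suc.prems cont_diff_SucD[of k U f] cont_diff_SucD[of k U g] in auto)
  then have "cont_diff k U (\<lambda>u. frechet_derivative (\<lambda>u. B (f u) (g u)) (at u) h)" for h
    by (rule cont_diff_cong[OF assms(1), rotated])
       (use Suc.prems in \<open>auto simp: frechet_derivative_bilinear(1)[OF assms(2)]\<close>)
  with Suc.prems show ?case by (auto simp: frechet_derivative_bilinear(2)[OF assms(2)])
qed

text \<open>The derivative of 1/f contains 1/f again, needed at one order less; hence the induction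
  is on the order with \<open>f\<close> fixed.\<close>

lemma cont_diff_inverse:
  fixes f :: "complex \<Rightarrow> complex"
  assumes "open U" "cont_diff k U f" "\<And>u. u \<in> U \<Longrightarrow> f u \<noteq> 0"
  shows "cont_diff k U (\<lambda>u. inverse (f u))"
  using assms(2,3)
proof (induction k)
  case 0
  then show ?case by (auto intro: continuous_intros)
next
  case (Suc k)
  have *: "((\<lambda>u. inverse (f u)) has_derivative
      (\<lambda>h. - (inverse (f u) * frechet_derivative f (at u) h * inverse (f u)))) (at u)" if "u \<in> U" for u
    by (rule Deriv.has_derivative_inverse) (use Suc.prems that in \<open>auto simp: frechet_derivative_works[symmetric]\<close>)
  have d: "(\<lambda>u. inverse (f u)) differentiable (at u)" if "u \<in> U" for u
    using *[OF that] by (auto simp: differentiable_def)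
  have c: "cont_diff k U (\<lambda>u. inverse (f u))" using Suc cont_diff_SucD by blast
  have "cont_diff k U (\<lambda>u. - (inverse (f u) * frechet_derivative f (at u) h * inverse (f u)))" for h
    by (rule cont_diff_bounded_linear[OF assms(1) bounded_linear_minus[OF bounded_linear_ident]];
        (rule cont_diff_bilinear[OF assms(1) bounded_bilinear_mult])+)
       (use c Suc.prems in auto)
  then have "cont_diff k U (\<lambda>u. frechet_derivative (\<lambda>u. inverse (f u)) (at u) h)" for h
    by (rule cont_diff_cong[OF assms(1), rotated]) (rule fun_cong[OF frechet_derivative_at[OF *]])
  with d show ?case by simp
qed

lemma frechet_derivative_complex:
  assumes "f differentiable (at u)"
  shows "frechet_derivative f (at u) h =
    Re h *\<^sub>R frechet_derivative f (at u) 1 + Im h *\<^sub>R frechet_derivative f (at u) \<i>"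
proof -
  interpret linear "frechet_derivative f (at u)"
    using assms by (rule linear_frechet_derivative)
  have "h = Re h *\<^sub>R 1 + Im h *\<^sub>R \<i>" by (simp add: complex_eq_iff)
  then have "frechet_derivative f (at u) h = frechet_derivative f (at u) (Re h *\<^sub>R 1 + Im h *\<^sub>R \<i>)"
    by simp
  then show ?thesis by (simp only: add scale)
qed

lemma cont_diff_compose:
  fixes g :: "complex \<Rightarrow> complex"
  assumes "open U" "cont_diff k V f" "cont_diff k U g" "g ` U \<subseteq> V"
  shows "cont_diff k U (f \<circ> g)"
  using assms(2-4)
proof (induction k arbitrary: f)
  case 0
  then show ?case
    using continuous_on_compose[of U g f] by (auto intro: continuous_on_subset)
next
  case (Suc k)
  have dg: "g differentiable (at u)" and df: "f differentiable (at (g u))" if "u \<in> U" for u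
    using Suc.prems that by auto
  have IH: "cont_diff k U ((\<lambda>v. frechet_derivative f (at v) e) \<circ> g)" for e
    by (rule Suc.IH) (use Suc.prems cont_diff_SucD[of k U g] in auto)
  have c: "cont_diff k U (\<lambda>u. frechet_derivative g (at u) h)" for h
    using Suc.prems by simp
  \<comment> \<open>In the chain rule the inner derivative is the argument of a linear map that
    varies with the point. Expanding it in the real basis 1, \<i> leaves sums of products, which the
    previous rules cover.\<close>
  have "cont_diff k U (\<lambda>u. Re (frechet_derivative g (at u) h) *\<^sub>R frechet_derivative f (at (g u)) 1
      + Im (frechet_derivative g (at u) h) *\<^sub>R frechet_derivative f (at (g u)) \<i>)" for h
    by (intro cont_diff_add[OF assms(1)] cont_diff_bilinear[OF assms(1) bounded_bilinear_scaleR]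
          cont_diff_bounded_linear[OF assms(1) bounded_linear_Re]
          cont_diff_bounded_linear[OF assms(1) bounded_linear_Im] c IH[unfolded comp_def])
  then have "cont_diff k U (\<lambda>u. frechet_derivative (f \<circ> g) (at u) h)" for h
    by (rule cont_diff_cong[OF assms(1), rotated])
       (auto simp: frechet_derivative_compose dg df frechet_derivative_complex[OF df, symmetric])
  moreover have "f \<circ> g differentiable at u" if "u \<in> U" for u
    using dg df that by (intro differentiable_chain_at)
  ultimately show ?case unfolding cont_diff.simps by blast
qed

lemma smooth_on_cong: "smooth_on U f \<Longrightarrow> open U \<Longrightarrow> (\<And>u. u \<in> U \<Longrightarrow> f u = g u) \<Longrightarrow> smooth_on U g"
  unfolding smooth_on_def using cont_diff_cong by blast

lemma smooth_on_differentiable: "smooth_on U f \<Longrightarrow> u \<in> U \<Longrightarrow> f differentiable (at u)"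
  unfolding smooth_on_def by (metis cont_diff_differentiable)

lemma smooth_on_frechet_derivative:
  "smooth_on U f \<Longrightarrow> smooth_on U (\<lambda>u. frechet_derivative f (at u) h)"
  unfolding smooth_on_def by (metis cont_diff.simps(2))

text \<open>Two mean value theorems, one per direction, applied to a second difference. The
  difference is symmetric in \<open>h\<close> and \<open>k\<close> while the right-hand side is not,
  and this makes the mixed derivatives comparable.\<close>

lemma second_difference_mvt:
  fixes f :: "complex \<Rightarrow> real"
  assumes "\<And>v. v \<in> ball u r \<Longrightarrow> f differentiable (at v)"
    and "\<And>v. v \<in> ball u r \<Longrightarrow> (\<lambda>v. frechet_derivative f (at v) h) differentiable (at v)"
    and t: "0 < t" "t * (norm h + norm k) < r"
  shows "\<exists>v\<in>ball u r. f (u + t *\<^sub>R h + t *\<^sub>R k) - f (u + t *\<^sub>R h) - f (u + t *\<^sub>R k) + f u =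
      t\<^sup>2 * frechet_derivative (\<lambda>v. frechet_derivative f (at v) h) (at v) k
    \<and> dist u v \<le> t * (norm h + norm k)"
proof -
  have near: "dist u (u + a *\<^sub>R h + b *\<^sub>R k) \<le> t * (norm h + norm k)"
    if "0 \<le> a" "a \<le> t" "0 \<le> b" "b \<le> t" for a b
  proof -
    have "dist u (u + a *\<^sub>R h + b *\<^sub>R k) = norm (a *\<^sub>R h + b *\<^sub>R k)"
      by (metis add.assoc dist_norm norm_minus_commute add_diff_cancel_left')
    also have "\<dots> \<le> a * norm h + b * norm k"
      using norm_triangle_ineq[of "a *\<^sub>R h" "b *\<^sub>R k"] that by simp
    also have "\<dots> \<le> t * (norm h + norm k)"
      using that by (simp add: distrib_left add_mono mult_right_mono)
    finally show ?thesis .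
  qed
  then have inb: "u + a *\<^sub>R h + b *\<^sub>R k \<in> ball u r"
    if "0 \<le> a" "a \<le> t" "0 \<le> b" "b \<le> t" for a b
    using that t by (force simp: mem_ball)
  \<comment> \<open>The difference along \<open>k\<close>, as a function of the displacement along
    \<open>h\<close>; its increment over [0, t] is the second difference.\<close>
  let ?p = "\<lambda>s. f (u + s *\<^sub>R h + t *\<^sub>R k) - f (u + s *\<^sub>R h)"
  have dp: "(?p has_real_derivative (frechet_derivative f (at (u + s *\<^sub>R h + t *\<^sub>R k)) h -
      frechet_derivative f (at (u + s *\<^sub>R h)) h)) (at s)" if "0 \<le> s" "s \<le> t" for s
  proof -
    have "((\<lambda>s. f (u + s *\<^sub>R h + b *\<^sub>R k)) has_derivative
         (\<lambda>x. frechet_derivative f (at (u + s *\<^sub>R h + b *\<^sub>R k)) (x *\<^sub>R h))) (at s)"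
      if "0 \<le> b" "b \<le> t" for b
    proof -
      have 1: "((\<lambda>s. u + s *\<^sub>R h + b *\<^sub>R k) has_derivative (\<lambda>x. x *\<^sub>R h)) (at s)"
        by (auto intro!: derivative_eq_intros)
      have "f differentiable (at (u + s *\<^sub>R h + b *\<^sub>R k))"
        using assms(1) inb that \<open>0 \<le> s\<close> \<open>s \<le> t\<close> by blast
      with diff_chain_at[OF 1] show ?thesis
        by (simp add: frechet_derivative_works comp_def)
    qed
    from this[of t] this[of 0] t(1)
    have "(?p has_derivative (\<lambda>x. frechet_derivative f (at (u + s *\<^sub>R h + t *\<^sub>R k)) (x *\<^sub>R h) -
      frechet_derivative f (at (u + s *\<^sub>R h)) (x *\<^sub>R h))) (at s)"
      by (intro has_derivative_diff) auto
    moreover have "frechet_derivative f (at v) (x *\<^sub>R h) = x * frechet_derivative f (at v) h"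
      if "v \<in> ball u r" for v x
      using linear_frechet_derivative[OF assms(1)[OF that]] by (simp add: linear_cmul)
    ultimately show ?thesis
      using inb[of s t] inb[of s 0] that t(1)
      by (simp add: has_field_derivative_def right_diff_distrib[symmetric] mult_commute_abs)
  qed
  obtain s where s: "0 < s" "s < t" and
    es: "?p t - ?p 0 = (t - 0) * (frechet_derivative f (at (u + s *\<^sub>R h + t *\<^sub>R k)) h -
      frechet_derivative f (at (u + s *\<^sub>R h)) h)"
    using MVT2[OF t(1), of ?p, OF dp] by metis
  let ?g = "\<lambda>v. frechet_derivative f (at v) h"
  have dq: "((\<lambda>b. ?g (u + s *\<^sub>R h + b *\<^sub>R k)) has_real_derivative
      frechet_derivative ?g (at (u + s *\<^sub>R h + b *\<^sub>R k)) k) (at b)" if "0 \<le> b" "b \<le> t" for b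
  proof -
    have 1: "((\<lambda>b. u + s *\<^sub>R h + b *\<^sub>R k) has_derivative (\<lambda>x. x *\<^sub>R k)) (at b)"
      by (auto intro!: derivative_eq_intros)
    have 2: "?g differentiable (at (u + s *\<^sub>R h + b *\<^sub>R k))"
      using assms(2) inb that s by (meson less_imp_le)
    with diff_chain_at[OF 1]
    have "((\<lambda>b. ?g (u + s *\<^sub>R h + b *\<^sub>R k)) has_derivative
         (\<lambda>x. frechet_derivative ?g (at (u + s *\<^sub>R h + b *\<^sub>R k)) (x *\<^sub>R k))) (at b)"
        by (simp add: frechet_derivative_works comp_def)
    then show ?thesis
      using linear_frechet_derivative[OF 2]
      by (simp add: linear_cmul has_field_derivative_def mult_commute_abs)
  qed
  obtain b where b: "0 < b" "b < t" and
    eb: "?g (u + s *\<^sub>R h + t *\<^sub>R k) - ?g (u + s *\<^sub>R h + 0 *\<^sub>R k) =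
      (t - 0) * frechet_derivative ?g (at (u + s *\<^sub>R h + b *\<^sub>R k)) k"
    using MVT2[OF t(1), of "\<lambda>b. ?g (u + s *\<^sub>R h + b *\<^sub>R k)", OF dq] by metis
  show ?thesis
    using inb[of s b] near[of s b] s b es eb
    by (intro bexI[of _ "u + s *\<^sub>R h + b *\<^sub>R k"]) (auto simp: power2_eq_square)
qed

lemma second_derivative_symmetric_real:
  fixes f :: "complex \<Rightarrow> real"
  assumes "open U" "u \<in> U" "cont_diff 2 U f"
  shows "frechet_derivative (\<lambda>v. frechet_derivative f (at v) h) (at u) k =
         frechet_derivative (\<lambda>v. frechet_derivative f (at v) k) (at u) h" (is "?A u = ?B u")
proof (rule ccontr)
  assume ne: "?A u \<noteq> ?B u"
  \<comment> \<open>Half the gap: each mixed derivative varies by less than \<open>e\<close> near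
    \<open>u\<close>, so a common value at two nearby points cannot bridge
    \<open>2 * e\<close>.\<close>
  define e where "e = \<bar>?A u - ?B u\<bar> / 2"
  have e: "e > 0" using ne by (simp add: e_def)
  have c: "continuous_on U ?A" "continuous_on U ?B"
    using assms(3) by (auto simp: numeral_2_eq_2)
  obtain r1 where r1: "r1 > 0" "ball u r1 \<subseteq> U"
    using assms(1,2) openE by blast
  have "continuous (at u) ?A" "continuous (at u) ?B"
    using c assms(1,2) by (auto simp: continuous_on_eq_continuous_at)
  then obtain r2 r3 where r2: "r2 > 0" "\<And>v. dist v u < r2 \<Longrightarrow> dist (?A v) (?A u) < e"
    and r3: "r3 > 0" "\<And>v. dist v u < r3 \<Longrightarrow> dist (?B v) (?B u) < e"
    using e unfolding continuous_at_eps_delta by metis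
  define r where "r = min r1 (min r2 r3)"
  have r: "r > 0" using r1 r2 r3 by (simp add: r_def)
  \<comment> \<open>The parallelogram stays within \<open>r / 2\<close> of \<open>u\<close>; the
    added 1 covers the case where \<open>h\<close> and \<open>k\<close> both vanish.\<close>
  define t where "t = r / (norm h + norm k + 1) / 2"
  have n: "norm h + norm k + 1 > 0" by (smt (verit) norm_ge_zero)
  have t: "0 < t" using r n by (simp add: t_def)
  have "t * (norm h + norm k) \<le> t * (norm h + norm k + 1)" using t by simp
  also have "\<dots> = r / 2" using n unfolding t_def by (metis divide_divide_eq_left' less_irrefl nonzero_mult_div_cancel_left times_divide_eq_left mult.commute)
  finally have t2: "t * (norm h + norm k) < r" using r by simp
  have sub: "ball u r \<subseteq> U" using r1 r_def by auto
  have d: "f differentiable (at v)" "(\<lambda>v. frechet_derivative f (at v) a) differentiable (at v)"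
    if "v \<in> ball u r" for v a
    using assms(3) sub that by (auto simp: numeral_2_eq_2)
  obtain v where v: "v \<in> ball u r" "f (u + t *\<^sub>R h + t *\<^sub>R k) - f (u + t *\<^sub>R h) - f (u + t *\<^sub>R k) + f u = t\<^sup>2 * ?A v"
    using second_difference_mvt[OF d(1) d(2) t t2] by metis
  obtain w where w: "w \<in> ball u r" "f (u + t *\<^sub>R k + t *\<^sub>R h) - f (u + t *\<^sub>R k) - f (u + t *\<^sub>R h) + f u = t\<^sup>2 * ?B w"
    using second_difference_mvt[where h=k and k=h, OF d(1) d(2) t] t2 unfolding add.commute[of "norm k"] by metis
  have "u + t *\<^sub>R k + t *\<^sub>R h = u + t *\<^sub>R h + t *\<^sub>R k" by simp
  from v(2) w(2)[unfolded this] have "t\<^sup>2 * ?A v = t\<^sup>2 * ?B w" by linarith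
  then have "?A v = ?B w" using t by simp
  moreover have "dist (?A v) (?A u) < e" "dist (?B w) (?B u) < e"
    using v(1) w(1) r2(2)[of v] r3(2)[of w] by (simp_all add: r_def dist_commute[of u])
  moreover have "\<bar>a - b\<bar> \<le> \<bar>x - a\<bar> + \<bar>x - b\<bar>" for a b x :: real by arith
  from this[of "?A u" "?B u" "?A v"]
  have "2 * e \<le> dist (?A v) (?A u) + dist (?A v) (?B u)" by (simp add: e_def dist_real_def)
  ultimately show False by (metis add_strict_mono mult_2 not_le)
qed

lemma second_derivative_symmetric:
  fixes f :: "complex \<Rightarrow> 'b::euclidean_space"
  assumes "open U" "u \<in> U" "smooth_on U f"
  shows "frechet_derivative (\<lambda>v. frechet_derivative f (at v) h) (at u) k =
         frechet_derivative (\<lambda>v. frechet_derivative f (at v) k) (at u) h"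
proof (rule euclidean_eqI)
  fix b :: 'b
  let ?f = "\<lambda>v. f v \<bullet> b"
  have bl: "bounded_linear (\<lambda>x::'b. x \<bullet> b)" by (rule bounded_linear_inner_left)
  have 1: "frechet_derivative ?f (at v) h = frechet_derivative f (at v) h \<bullet> b" if "v \<in> U" for v h
    by (rule frechet_derivative_bounded_linear[OF bl]) (use assms that smooth_on_differentiable in auto)
  have 2: "frechet_derivative (\<lambda>v. frechet_derivative ?f (at v) h) (at u) k =
       frechet_derivative (\<lambda>v. frechet_derivative f (at v) h) (at u) k \<bullet> b" for h k
  proof -
    have d: "(\<lambda>v. frechet_derivative f (at v) h) differentiable (at u)"
      using assms smooth_on_frechet_derivative smooth_on_differentiable by blast
    have "frechet_derivative (\<lambda>v. frechet_derivative f (at v) h \<bullet> b) (at u) =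
        frechet_derivative (\<lambda>v. frechet_derivative ?f (at v) h) (at u)"
      by (rule frechet_derivative_transform_within_open[OF _ assms(1,2)])
         (use 1 frechet_derivative_bounded_linear(2)[OF bl d] in auto)
    then show ?thesis using frechet_derivative_bounded_linear(1)[OF bl d] by metis
  qed
  have "cont_diff 2 U ?f"
    using assms unfolding smooth_on_def by (blast intro: cont_diff_bounded_linear[OF _ bl])
  from second_derivative_symmetric_real[OF assms(1,2) this] 2
  show "frechet_derivative (\<lambda>v. frechet_derivative f (at v) h) (at u) k \<bullet> b =
         frechet_derivative (\<lambda>v. frechet_derivative f (at v) k) (at u) h \<bullet> b" by metis
qed


section \<open>Calculus in charts\<close>

lemma chart_inv_snd: "is_chart c \<Longrightarrow> x \<in> fst c \<Longrightarrow> chart_inv c (snd c x) = x"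
  by (auto simp: is_chart_def homeomorphism_def)

lemma open_chart_image:
  assumes "is_chart c" "open W"
  shows "open (snd c ` (W \<inter> fst c))"
proof -
  have "openin (top_of_set (snd c ` fst c)) (snd c ` (W \<inter> fst c))"
    using assms homeomorphism_imp_open_map[of "fst c" "snd c ` fst c" "snd c" "chart_inv c" "W \<inter> fst c"]
    by (auto simp: is_chart_def openin_open Int_commute)
  then show ?thesis
    using assms by (meson is_chart_def openin_open_trans)
qed

text \<open>Smoothness read in one chart that need not belong to the atlas: holomorphic charts lie
  in the maximal atlas only, whereas \<open>smooth_map\<close> tests the charts of
  \<open>A\<close>.\<close>

definition csmooth :: "'m chart \<Rightarrow> 'm set \<Rightarrow> ('m \<Rightarrow> 'b::real_normed_vector) \<Rightarrow> bool" where
  "csmooth c W f \<longleftrightarrow> smooth_on (snd c ` (W \<inter> fst c)) (f \<circ> chart_inv c)"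

lemma smooth_map_csmooth: "smooth_map A W f \<longleftrightarrow> (\<forall>c\<in>A. csmooth c W f)"
  by (simp add: smooth_map_def csmooth_def)

lemma csmooth_subset: "csmooth c W f \<Longrightarrow> V \<inter> fst c \<subseteq> W \<Longrightarrow> csmooth c V f"
  unfolding csmooth_def smooth_on_def by (meson cont_diff_subset image_mono Int_greatest Int_lower2)

lemma csmooth_cong:
  assumes "is_chart c" "open W" "csmooth c W f" "\<And>x. x \<in> W \<Longrightarrow> x \<in> fst c \<Longrightarrow> f x = g x"
  shows "csmooth c W g"
  unfolding csmooth_def
  by (rule smooth_on_cong[OF assms(3)[unfolded csmooth_def] open_chart_image[OF assms(1,2)]])
     (use assms chart_inv_snd[OF assms(1)] in auto)

lemma csmooth_local:
  assumes "is_chart c" "\<And>x. x \<in> W \<Longrightarrow> x \<in> fst c \<Longrightarrow> \<exists>V. open V \<and> x \<in> V \<and> csmooth c V f"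
  shows "csmooth c W f"
  unfolding csmooth_def smooth_on_def
proof (intro allI cont_diff_local)
  fix k u assume "u \<in> snd c ` (W \<inter> fst c)"
  then obtain x where x: "x \<in> W" "x \<in> fst c" "u = snd c x" by auto
  then obtain V where V: "open V" "x \<in> V" "csmooth c V f" using assms(2) by blast
  show "\<exists>V. open V \<and> u \<in> V \<and> cont_diff k V (f \<circ> chart_inv c)"
    using V x open_chart_image[OF assms(1) V(1)]
    by (intro exI[of _ "snd c ` (V \<inter> fst c)"]) (auto simp: csmooth_def smooth_on_def)
qed

lemma csmooth_const: "csmooth c W (\<lambda>_. k)"
  by (simp add: csmooth_def smooth_on_def comp_def cont_diff_const)

lemma csmooth_add:
  assumes "is_chart c" "open W" "csmooth c W f" "csmooth c W g"
  shows "csmooth c W (\<lambda>x. f x + g x)"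
  using assms open_chart_image[OF assms(1,2)]
  by (auto simp: csmooth_def smooth_on_def comp_def intro: cont_diff_add)

lemma csmooth_bounded_linear:
  assumes "bounded_linear T" "is_chart c" "open W" "csmooth c W f"
  shows "csmooth c W (\<lambda>x. T (f x))"
  using assms open_chart_image[OF assms(2,3)]
  by (auto simp: csmooth_def smooth_on_def comp_def intro: cont_diff_bounded_linear)

lemma csmooth_bilinear:
  assumes "bounded_bilinear B" "is_chart c" "open W" "csmooth c W f" "csmooth c W g"
  shows "csmooth c W (\<lambda>x. B (f x) (g x))"
  using assms open_chart_image[OF assms(2,3)]
  by (auto simp: csmooth_def smooth_on_def comp_def intro: cont_diff_bilinear)

lemma csmooth_minus:
  assumes "is_chart c" "open W" "csmooth c W f"
  shows "csmooth c W (\<lambda>x. - f x)"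
  by (rule csmooth_bounded_linear[OF bounded_linear_minus[OF bounded_linear_ident] assms])

lemma csmooth_diff:
  assumes "is_chart c" "open W" "csmooth c W f" "csmooth c W g"
  shows "csmooth c W (\<lambda>x. f x - g x)"
  using csmooth_add[OF assms(1-3) csmooth_minus[OF assms(1,2,4)]] by simp

lemma csmooth_inverse:
  fixes f :: "'m::topological_space \<Rightarrow> complex"
  assumes "is_chart c" "open W" "csmooth c W f" "\<And>x. x \<in> W \<Longrightarrow> x \<in> fst c \<Longrightarrow> f x \<noteq> 0"
  shows "csmooth c W (\<lambda>x. inverse (f x))"
  using assms(3,4) open_chart_image[OF assms(1,2)] chart_inv_snd[OF assms(1)]
  by (auto simp: csmooth_def smooth_on_def comp_def intro!: cont_diff_inverse)

lemma csmooth_dd: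
  assumes "is_chart c" "open W" "csmooth c W f"
  shows "csmooth c W (\<lambda>x. dd c h f x)"
  unfolding csmooth_def
  by (rule smooth_on_cong[OF smooth_on_frechet_derivative[OF assms(3)[unfolded csmooth_def]]
        open_chart_image[OF assms(1,2)]])
     (use assms(1) in \<open>auto simp: dd_def chart_inv_snd\<close>)

lemma csmooth_differentiable:
  "csmooth c W f \<Longrightarrow> x \<in> W \<Longrightarrow> x \<in> fst c \<Longrightarrow> (f \<circ> chart_inv c) differentiable (at (snd c x))"
  unfolding csmooth_def by (rule smooth_on_differentiable) auto

lemma dd_const [simp]: "dd c h (\<lambda>_. k) x = 0"
  by (simp add: dd_def comp_def)

lemma dd_cong:
  assumes "is_chart c" "open W" "x \<in> W" "x \<in> fst c" "csmooth c W f"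
    and "\<And>x. x \<in> W \<Longrightarrow> x \<in> fst c \<Longrightarrow> f x = g x"
  shows "dd c h f x = dd c h g x"
proof -
  have "frechet_derivative (f \<circ> chart_inv c) (at (snd c x)) = frechet_derivative (g \<circ> chart_inv c) (at (snd c x))"
    by (rule frechet_derivative_transform_within_open[OF csmooth_differentiable[OF assms(5,3,4)]
          open_chart_image[OF assms(1,2)]])
       (use assms(1,3,4,6) in \<open>auto simp: chart_inv_snd\<close>)
  then show ?thesis by (simp add: dd_def)
qed

lemma dd_linear: "csmooth c W f \<Longrightarrow> x \<in> W \<Longrightarrow> x \<in> fst c \<Longrightarrow> linear (\<lambda>h. dd c h f x)"
  unfolding dd_def by (rule linear_frechet_derivative[OF csmooth_differentiable])

lemma dd_add:
  assumes "csmooth c W f" "csmooth c W g" "x \<in> W" "x \<in> fst c"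
  shows "dd c h (\<lambda>x. f x + g x) x = dd c h f x + dd c h g x"
  using frechet_derivative_add[OF csmooth_differentiable[OF assms(1,3,4)] csmooth_differentiable[OF assms(2-4)]]
  by (simp add: dd_def comp_def)

lemma dd_bounded_linear:
  assumes "bounded_linear T" "csmooth c W f" "x \<in> W" "x \<in> fst c"
  shows "dd c h (\<lambda>x. T (f x)) x = T (dd c h f x)"
  using frechet_derivative_bounded_linear(1)[OF assms(1) csmooth_differentiable[OF assms(2-4)]]
  by (simp add: dd_def comp_def)

lemma dd_bilinear:
  assumes "bounded_bilinear B" "is_chart c" "csmooth c W f" "csmooth c W g" "x \<in> W" "x \<in> fst c"
  shows "dd c h (\<lambda>x. B (f x) (g x)) x = B (dd c h f x) (g x) + B (f x) (dd c h g x)"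
  using frechet_derivative_bilinear(1)[OF assms(1) csmooth_differentiable[OF assms(3,5,6)] csmooth_differentiable[OF assms(4,5,6)]]
  by (simp add: dd_def comp_def chart_inv_snd assms)

lemma dd_minus:
  assumes "csmooth c W f" "x \<in> W" "x \<in> fst c"
  shows "dd c h (\<lambda>x. - f x) x = - dd c h f x"
  by (rule dd_bounded_linear[OF bounded_linear_minus[OF bounded_linear_ident] assms])

lemma dd_diff:
  assumes "is_chart c" "open W" "csmooth c W f" "csmooth c W g" "x \<in> W" "x \<in> fst c"
  shows "dd c h (\<lambda>x. f x - g x) x = dd c h f x - dd c h g x"
  using dd_add[OF assms(3) csmooth_minus[OF assms(1,2,4)] assms(5,6)] dd_minus[OF assms(4-6)] by simp

lemma dd_commute:
  fixes f :: "'m::topological_space \<Rightarrow> 'b::euclidean_space"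
  assumes "is_chart c" "open W" "csmooth c W f" "x \<in> W" "x \<in> fst c"
  shows "dd c h (dd c k f) x = dd c k (dd c h f) x"
proof -
  let ?U = "snd c ` (W \<inter> fst c)" and ?f = "f \<circ> chart_inv c"
  have s: "smooth_on ?U ?f" using assms(3) by (simp add: csmooth_def)
  have "frechet_derivative (dd c k f \<circ> chart_inv c) (at (snd c x)) =
      frechet_derivative (\<lambda>u. frechet_derivative ?f (at u) k) (at (snd c x))" for k
    by (rule sym, rule frechet_derivative_transform_within_open[OF _ open_chart_image[OF assms(1,2)]])
       (use assms in \<open>auto simp: dd_def chart_inv_snd intro!: smooth_on_differentiable[OF smooth_on_frechet_derivative[OF s]]\<close>)
  then have "dd c h (dd c k f) x = frechet_derivative (\<lambda>u. frechet_derivative ?f (at u) k) (at (snd c x)) h" for h k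
    by (metis dd_def)
  then show ?thesis
    using second_derivative_symmetric[OF open_chart_image[OF assms(1,2)] _ s] assms(4,5) by auto
qed

lemma csmooth_transfer:
  assumes "is_chart c" "is_chart c'" "open W" "W \<subseteq> fst c'" "csmooth c W (snd c')" "csmooth c' W f"
  shows "csmooth c W f"
  unfolding csmooth_def
proof (rule smooth_on_cong[OF _ open_chart_image[OF assms(1,3)]])
  show "smooth_on (snd c ` (W \<inter> fst c)) ((f \<circ> chart_inv c') \<circ> (snd c' \<circ> chart_inv c))"
    unfolding smooth_on_def
  proof (intro allI cont_diff_compose[OF open_chart_image[OF assms(1,3)]])
    fix k
    show "cont_diff k (snd c' ` (W \<inter> fst c')) (f \<circ> chart_inv c')"
      "cont_diff k (snd c ` (W \<inter> fst c)) (snd c' \<circ> chart_inv c)"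
      using assms(5,6) by (auto simp: csmooth_def smooth_on_def)
    show "(snd c' \<circ> chart_inv c) ` snd c ` (W \<inter> fst c) \<subseteq> snd c' ` (W \<inter> fst c')"
      using assms by (auto simp: chart_inv_snd)
  qed
  fix u assume "u \<in> snd c ` (W \<inter> fst c)"
  then show "(f \<circ> chart_inv c' \<circ> (snd c' \<circ> chart_inv c)) u = (f \<circ> chart_inv c) u"
    using assms by (auto simp: chart_inv_snd)
qed

lemma dd_chain:
  assumes "is_chart c" "is_chart c'" "open W" "csmooth c W (snd c')" "csmooth c' W f"
    and x: "x \<in> W" "x \<in> fst c" "x \<in> fst c'"
  shows "dd c h f x = dd c' (dd c h (snd c') x) f x"
proof -
  let ?W = "W \<inter> fst c'"
  let ?g = "snd c' \<circ> chart_inv c" and ?f = "f \<circ> chart_inv c'"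
  have o: "open ?W" using assms by (auto simp: is_chart_def)
  have d1: "?g differentiable (at (snd c x))" by (rule csmooth_differentiable[OF assms(4) x(1,2)])
  have gx: "?g (snd c x) = snd c' x" using assms by (simp add: chart_inv_snd)
  have d2: "?f differentiable (at (?g (snd c x)))"
    unfolding gx by (rule csmooth_differentiable[OF assms(5) x(1,3)])
  have "frechet_derivative (?f \<circ> ?g) (at (snd c x)) = frechet_derivative (f \<circ> chart_inv c) (at (snd c x))"
    by (rule frechet_derivative_transform_within_open[OF differentiable_chain_at[OF d1 d2]
         open_chart_image[OF assms(1) o]])
       (use x assms in \<open>auto simp: chart_inv_snd\<close>)
  then show ?thesis
    unfolding dd_def frechet_derivative_compose[OF d1 d2] using gx by (metis comp_def)
qed

subsection \<open>Charts of the oriented atlas\<close>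

lemma max_atlas_is_chart: "c \<in> max_atlas A \<Longrightarrow> is_chart c"
  by (simp add: max_atlas_def)

lemma atlas_subset_max_atlas: "oriented_surface A \<Longrightarrow> a \<in> A \<Longrightarrow> a \<in> max_atlas A"
  by (auto simp: oriented_surface_def max_atlas_def)

lemma atlas_cover: "oriented_surface A \<Longrightarrow> \<exists>a\<in>A. x \<in> fst a"
  unfolding oriented_surface_def by blast

lemma max_atlas_csmooth_coord:
  "c \<in> max_atlas A \<Longrightarrow> a \<in> A \<Longrightarrow> csmooth c (fst a) (snd a)"
  by (auto simp: max_atlas_def oriented_transition_def csmooth_def Let_def Int_commute)

lemma max_atlas_smooth_coord:
  "c \<in> max_atlas A \<Longrightarrow> smooth_map A (fst c) (snd c)"
  by (auto simp: max_atlas_def oriented_transition_def smooth_map_def Let_def Int_commute)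

lemma smooth_map_csmooth_max_atlas:
  assumes "oriented_surface A" "c \<in> max_atlas A" "open W" "smooth_map A W f"
  shows "csmooth c W f"
proof (rule csmooth_local)
  show c: "is_chart c" using assms max_atlas_is_chart by blast
  fix x assume x: "x \<in> W" "x \<in> fst c"
  obtain a where a: "a \<in> A" "x \<in> fst a" using atlas_cover[OF assms(1)] by blast
  have ac: "is_chart a" using a assms(1) atlas_subset_max_atlas max_atlas_is_chart by blast
  let ?V = "W \<inter> fst a"
  have o: "open ?V" using assms(3) ac by (auto simp: is_chart_def)
  have "csmooth c ?V f"
  proof (rule csmooth_transfer[OF c ac o])
    show "csmooth c ?V (snd a)"
      by (rule csmooth_subset[OF max_atlas_csmooth_coord[OF assms(2) a(1)]]) auto
    show "csmooth a ?V f"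
      by (rule csmooth_subset[of a W]) (use assms(4) a in \<open>auto simp: smooth_map_csmooth\<close>)
  qed auto
  with o x a show "\<exists>V. open V \<and> x \<in> V \<and> csmooth c V f" by blast
qed

lemma max_atlas_coord_csmooth:
  assumes "oriented_surface A" "c \<in> max_atlas A" "c' \<in> max_atlas A"
  shows "csmooth c (fst c') (snd c')"
  by (rule smooth_map_csmooth_max_atlas[OF assms(1,2) _ max_atlas_smooth_coord[OF assms(3)]])
     (use max_atlas_is_chart[OF assms(3)] in \<open>simp add: is_chart_def\<close>)

lemma dd_chain_max_atlas:
  assumes "oriented_surface A" "c \<in> max_atlas A" "c' \<in> max_atlas A" "open W" "smooth_map A W f"
    and "x \<in> W" "x \<in> fst c" "x \<in> fst c'"
  shows "dd c h f x = dd c' (dd c h (snd c') x) f x"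
proof (rule dd_chain)
  show "is_chart c" "is_chart c'" using assms max_atlas_is_chart by blast+
  then show "open (W \<inter> fst c')" using assms by (auto simp: is_chart_def)
  show "csmooth c (W \<inter> fst c') (snd c')"
    by (rule csmooth_subset[OF max_atlas_coord_csmooth[OF assms(1-3)]]) auto
  show "csmooth c' (W \<inter> fst c') f"
    by (rule csmooth_subset[OF smooth_map_csmooth_max_atlas[OF assms(1,3,4,5)]]) auto
qed (use assms in auto)

section \<open>Orientation of the transition maps in the maximal atlas\<close>

definition jac :: "(complex \<Rightarrow> complex) \<Rightarrow> real" where
  "jac D = Re (D 1) * Im (D \<i>) - Im (D 1) * Re (D \<i>)"

lemma linear_complex_expand:
  assumes "linear (D :: complex \<Rightarrow> 'b::real_vector)"
  shows "D h = Re h *\<^sub>R D 1 + Im h *\<^sub>R D \<i>"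
proof -
  have "h = Re h *\<^sub>R 1 + Im h *\<^sub>R \<i>" by (simp add: complex_eq_iff)
  then have "D h = D (Re h *\<^sub>R 1 + Im h *\<^sub>R \<i>)" by simp
  then show ?thesis using assms by (simp only: linear_add linear_cmul)
qed

lemma jac_compose:
  assumes "linear E"
  shows "jac (\<lambda>h. E (D h)) = jac E * jac D"
  using linear_complex_expand[OF assms, of "D 1"] linear_complex_expand[OF assms, of "D \<i>"]
  by (simp add: jac_def algebra_simps)

text \<open>Membership in \<open>max_atlas\<close> compares a chart only with those of
  \<open>A\<close>, so the transition is factored through a chart of \<open>A\<close> and the
  determinants multiply.\<close>

lemma max_atlas_jac_pos:
  assumes "oriented_surface A" "c \<in> max_atlas A" "c' \<in> max_atlas A" "x \<in> fst c" "x \<in> fst c'"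
  shows "jac (\<lambda>h. dd c h (snd c') x) > 0"
proof -
  obtain a where a: "a \<in> A" "x \<in> fst a" using atlas_cover[OF assms(1)] by blast
  have am: "a \<in> max_atlas A" using a assms(1) atlas_subset_max_atlas by blast
  have c': "open (fst c')" using max_atlas_is_chart[OF assms(3)] by (simp add: is_chart_def)
  have eq: "(\<lambda>h. dd c h (snd c') x) = (\<lambda>h. dd a (dd c h (snd a) x) (snd c') x)"
    using dd_chain_max_atlas[OF assms(1,2) am c' max_atlas_smooth_coord[OF assms(3)] assms(5,4) a(2)] by blast
  have l: "linear (\<lambda>h. dd a h (snd c') x)"
    using dd_linear[OF max_atlas_coord_csmooth[OF assms(1) am assms(3)]] a assms by blast
  have "jac (\<lambda>h. dd c h (snd a) x) > 0" "jac (\<lambda>h. dd a h (snd c') x) > 0"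
    using assms a unfolding jac_def max_atlas_def oriented_transition_def dd_def comp_def Let_def by auto
  then have "jac (\<lambda>h. dd a h (snd c') x) * jac (\<lambda>h. dd c h (snd a) x) > 0"
    by (rule mult_pos_pos[rotated])
  then show ?thesis
    using jac_compose[OF l, of "\<lambda>h. dd c h (snd a) x"] eq by metis
qed


section \<open>The indefinite form and its complexification\<close>

text \<open>In finite dimension algebraic bilinearity already gives the boundedness that the
  differentiation rules require.\<close>

lemma bounded_bilinearI:
  fixes h :: "'a::euclidean_space \<Rightarrow> 'b::euclidean_space \<Rightarrow> 'c::real_normed_vector"
  assumes "\<And>a b c. h (a + b) c = h a c + h b c" "\<And>a b c. h a (b + c) = h a b + h a c"
    and "\<And>r a b. h (r *\<^sub>R a) b = r *\<^sub>R h a b" "\<And>r a b. h a (r *\<^sub>R b) = r *\<^sub>R h a b"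
  shows "bounded_bilinear h"
  unfolding bilinear_conv_bounded_bilinear[symmetric] bilinear_def
  using assms by (auto intro!: linearI)

lemma bounded_bilinear_matrix_mult:
  "bounded_bilinear ((**) :: 'a::{real_algebra_1,euclidean_space}^'n::finite^'m::finite \<Rightarrow> 'a^'p::finite^'n \<Rightarrow> 'a^'p^'m)"
  by (rule bounded_bilinearI)
     (simp_all add: vec_eq_iff matrix_matrix_mult_def sum.distrib distrib_left distrib_right scaleR_sum_right)

lemma bounded_bilinear_matrix_vector_mult:
  "bounded_bilinear ((*v) :: 'a::{real_algebra_1,euclidean_space}^'n::finite^'m::finite \<Rightarrow> 'a^'n \<Rightarrow> 'a^'m)"
  by (rule bounded_bilinearI)
     (simp_all add: vec_eq_iff matrix_vector_mult_def sum.distrib distrib_left distrib_right scaleR_sum_right)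

lemma bounded_bilinear_vector_scalar_mult:
  "bounded_bilinear ((*s) :: 'a::{real_algebra_1,euclidean_space} \<Rightarrow> 'a^'n::finite \<Rightarrow> 'a^'n)"
  by (rule bounded_bilinearI) (simp_all add: vec_eq_iff distrib_left distrib_right)

lemma mink_add_left: "mink (a + b) c = mink a c + mink b c"
  and mink_add_right: "mink c (a + b) = mink c a + mink c b"
  and mink_scale_left: "mink (k *s a) b = k * mink a b"
  and mink_scale_right: "mink a (k *s b) = k * mink a b"
  and mink_commute: "mink a b = mink b a"
  by (simp_all add: mink_def sum.distrib algebra_simps sum_distrib_left)

lemma mink_zero [simp]: "mink 0 b = 0" "mink a 0 = 0"
  by (simp_all add: mink_def)

lemma mink_diff_left: "mink (a - b) c = mink a c - mink b c"
  and mink_diff_right: "mink c (a - b) = mink c a - mink c b"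
  and mink_minus_left: "mink (- a) c = - mink a c"
  and mink_minus_right: "mink c (- a) = - mink c a"
  by (simp_all add: mink_def sum_subtractf sum_negf algebra_simps)

lemmas mink_simps = mink_add_left mink_add_right mink_scale_left mink_scale_right
  mink_diff_left mink_diff_right mink_minus_left mink_minus_right

lemma bounded_bilinear_mink:
  "bounded_bilinear (mink :: 'a::{real_algebra_1,comm_ring_1,euclidean_space}^'n::finite option \<Rightarrow> 'a^'n option \<Rightarrow> 'a)"
  by (rule bounded_bilinearI)
     (simp_all add: mink_simps, simp_all add: mink_def scaleR_sum_right scaleR_diff_right)

lemma mink_axis:
  "mink w (axis (Some i) 1) = w $ Some i" "mink w (axis None 1) = - w $ None"
  by (simp_all add: mink_def axis_def if_distrib[of "(*) _"] sum.delta cong: if_cong)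

lemma mink_nondegenerate:
  assumes "\<And>v. mink w v = 0"
  shows "w = 0"
proof -
  have "w $ i = 0" for i
    using assms[of "axis i 1"] by (cases i) (auto simp: mink_axis)
  then show ?thesis by (simp add: vec_eq_iff)
qed

subsection \<open>Complexification\<close>

lemma bounded_linear_cplx_vec: "bounded_linear cplx_vec"
  unfolding linear_conv_bounded_linear[symmetric]
  by (rule linearI) (simp_all add: cplx_vec_def vec_eq_iff complex_eq_iff)

lemma bounded_linear_cplx_mat: "bounded_linear cplx_mat"
  unfolding linear_conv_bounded_linear[symmetric]
  by (rule linearI) (simp_all add: cplx_mat_def vec_eq_iff complex_eq_iff)

lemma bounded_linear_cnj_vec: "bounded_linear cnj_vec"
  unfolding linear_conv_bounded_linear[symmetric]
  by (rule linearI) (simp_all add: cnj_vec_def vec_eq_iff complex_eq_iff)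

lemma mink_cplx_vec: "mink (cplx_vec a) (cplx_vec b) = of_real (mink a b)"
  by (simp add: mink_def cplx_vec_def)

lemma mink_cnj_vec: "mink (cnj_vec a) (cnj_vec b) = cnj (mink a b)"
  by (simp add: mink_def cnj_vec_def)

lemma cnj_vec_simps [simp]:
  "cnj_vec (cnj_vec a) = a" "cnj_vec (a + b) = cnj_vec a + cnj_vec b" "cnj_vec (a - b) = cnj_vec a - cnj_vec b"
  "cnj_vec (k *s a) = cnj k *s cnj_vec a" "cnj_vec (cplx_vec w) = cplx_vec w" "cnj_vec 0 = 0"
  by (simp_all add: cnj_vec_def cplx_vec_def vec_eq_iff)

lemma cplx_mat_vec: "cplx_mat A *v cplx_vec w = cplx_vec (A *v w)"
  by (simp add: cplx_mat_def cplx_vec_def matrix_vector_mult_def vec_eq_iff)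

lemma cplx_mat_mult: "cplx_mat (A ** B) = cplx_mat A ** cplx_mat B"
  by (simp add: cplx_mat_def matrix_matrix_mult_def vec_eq_iff)

lemma cplx_mat_one: "cplx_mat (mat 1) = mat 1"
  by (simp add: cplx_mat_def mat_def vec_eq_iff)

lemma cnj_cplx_mat [simp]: "map_matrix cnj (cplx_mat A) = cplx_mat A"
  by (simp add: cplx_mat_def vec_eq_iff)

lemma map_matrix_cnj_mult: "map_matrix cnj (A ** B) = map_matrix cnj A ** map_matrix cnj B"
  by (simp add: matrix_matrix_mult_def vec_eq_iff)

lemma cnj_mat_vec: "cnj_vec (A *v w) = map_matrix cnj A *v cnj_vec w"
  by (simp add: cnj_vec_def matrix_vector_mult_def vec_eq_iff)

lemma cplx_vec_eq_iff [simp]: "cplx_vec a = cplx_vec b \<longleftrightarrow> a = b"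
  by (simp add: cplx_vec_def vec_eq_iff)

lemma cplx_vec_0 [simp]: "cplx_vec 0 = 0"
  by (simp add: cplx_vec_def vec_eq_iff)

lemma cplx_mat_eqI:
  assumes "\<And>w. A *v cplx_vec w = B *v cplx_vec w"
  shows "A = B"
proof -
  have "A $ i $ j = B $ i $ j" for i j
  proof -
    have "cplx_vec (axis j 1) = axis j 1" by (simp add: cplx_vec_def axis_def vec_eq_iff)
    with assms[of "axis j 1"] have "A *v axis j 1 = B *v axis j 1" by simp
    then show ?thesis by (simp add: matrix_vector_mult_basis column_def vec_eq_iff matrix_vector_mult_def axis_def if_distrib[of "(*) _"] cong: if_cong)
  qed
  then show ?thesis by (simp add: vec_eq_iff)
qed

subsection \<open>Matrix algebra\<close>

lemma cscale_nth [simp]: "cscale a A $ i $ j = a * A $ i $ j"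
  by (simp add: cscale_def)

lemma cscale_mult_left: "cscale a A ** B = cscale a (A ** B)"
  and cscale_mult_right: "A ** cscale a B = cscale a (A ** B)"
  by (simp_all add: vec_eq_iff matrix_matrix_mult_def sum_distrib_left mult_ac)

lemma cscale_vec: "cscale a A *v w = a *s (A *v w)"
  by (simp add: vec_eq_iff matrix_vector_mult_def sum_distrib_left mult_ac)

lemma bounded_linear_cscale: "bounded_linear (cscale a)"
  unfolding linear_conv_bounded_linear[symmetric]
  by (rule linearI) (simp_all add: vec_eq_iff algebra_simps)

lemma matrix_minus_left: "(- A) ** B = - (A ** B)"
  and matrix_minus_right: "A ** (- B) = - (A ** B)" for A :: "'a::comm_ring_1^'n::finite^'m::finite"
  by (simp_all add: vec_eq_iff matrix_matrix_mult_def sum_negf)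

lemma matrix_diff_left: "(A - B) ** C = A ** C - B ** C"
  and matrix_diff_right: "C' ** (A - B) = C' ** A - C' ** B" for A :: "'a::comm_ring_1^'n::finite^'m::finite"
  by (simp_all add: vec_eq_iff matrix_matrix_mult_def sum_subtractf algebra_simps)

lemma matrix_scaleR_left: "(r *\<^sub>R A) ** B = r *\<^sub>R (A ** B)"
  and matrix_scaleR_right: "A ** (r *\<^sub>R B) = r *\<^sub>R (A ** B)" for A :: "'a::{real_algebra_1,comm_ring_1}^'n::finite^'m::finite"
  by (simp_all add: vec_eq_iff matrix_matrix_mult_def scaleR_sum_right)

lemma matrix_add_left: "(A + B) ** C = A ** C + B ** C" for A :: "'a::comm_ring_1^'n::finite^'m::finite"
  by (simp add: vec_eq_iff matrix_matrix_mult_def sum.distrib algebra_simps)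

lemma matrix_zero_mult [simp]: "0 ** A = 0" "B ** 0 = 0" for A :: "'a::comm_ring_1^'n::finite^'m::finite"
  by (simp_all add: vec_eq_iff matrix_matrix_mult_def)

lemmas matrix_ring_simps = matrix_add_left matrix_add_ldistrib matrix_diff_left matrix_diff_right
  matrix_minus_left matrix_minus_right matrix_scaleR_left matrix_scaleR_right matrix_mul_assoc
  cscale_mult_left cscale_mult_right

lemma matrix_vec_minus_left: "(- A) *v w = - (A *v w)" for A :: "'a::comm_ring_1^'n::finite^'m::finite"
  by (simp add: vec_eq_iff matrix_vector_mult_def sum_negf)

lemma matrix_vec_minus_right: "A *v (- w) = - (A *v w)" for A :: "'a::comm_ring_1^'n::finite^'m::finite"
  by (simp add: vec_eq_iff matrix_vector_mult_def sum_negf)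

lemma matrix_vec_scale: "A *v (k *s w) = k *s (A *v w)" for A :: "'a::comm_ring_1^'n::finite^'m::finite"
  by (simp add: vec_eq_iff matrix_vector_mult_def sum_distrib_left mult_ac)

lemma matrix_vec_scaleR: "(r *\<^sub>R A) *v w = r *\<^sub>R (A *v w)" for A :: "'a::{real_algebra_1,comm_ring_1}^'n::finite^'m::finite"
  by (simp add: vec_eq_iff matrix_vector_mult_def scaleR_sum_right)

lemma matrix_eqI: "(\<And>w. A *v w = B *v w) \<Longrightarrow> A = B" for A :: "'a::field^'n::finite^'m::finite"
  by (simp add: matrix_eq)

definition skew :: "complex ^ 'n::finite option ^ 'n option \<Rightarrow> bool" where
  "skew A \<longleftrightarrow> (\<forall>v w. mink (A *v v) w = - mink v (A *v w))"

definition isometric :: "'a::comm_ring_1 ^ 'n::finite option ^ 'n option \<Rightarrow> bool" where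
  "isometric F \<longleftrightarrow> (\<forall>v w. mink (F *v v) (F *v w) = mink v w)"

lemma wedge_vec: "wedge a b *v w = mink w a *s b - mink w b *s a"
  unfolding wedge_def
  by (rule matrix_works)
     (unfold_locales, auto simp: mink_simps vec_eq_iff algebra_simps)

lemma skew_wedge: "skew (wedge a b)"
  by (simp add: skew_def wedge_vec mink_simps mink_commute)

lemma wedge_scale_right: "wedge a (k *s b) = cscale k (wedge a b)"
  by (rule matrix_eqI) (simp add: wedge_vec cscale_vec mink_simps vec_eq_iff algebra_simps)

lemma wedge_add_right: "wedge a (b + b') = wedge a b + wedge a b'"
  by (rule matrix_eqI) (simp add: wedge_vec mink_simps vec_eq_iff algebra_simps)

text \<open>An isometry crosses the form as its inverse, (G w, u) = (w, F u), so conjugation acts on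
  both factors of the wedge.\<close>

lemma wedge_conj:
  assumes "isometric F" "F ** G = mat 1"
  shows "F ** wedge a b ** G = wedge (F *v a) (F *v b)"
proof (rule matrix_eqI)
  fix w
  have "w = F *v (G *v w)" by (simp add: matrix_vector_mul_assoc assms)
  then have *: "mink (G *v w) u = mink w (F *v u)" for u
    using assms(1) unfolding isometric_def by metis
  have "(F ** wedge a b ** G) *v w = F *v (wedge a b *v (G *v w))"
    by (simp add: matrix_vector_mul_assoc matrix_mul_assoc)
  also have "\<dots> = wedge (F *v a) (F *v b) *v w"
    by (simp add: wedge_vec * matrix_vector_mult_diff_distrib matrix_vec_scale)
  finally show "(F ** wedge a b ** G) *v w = wedge (F *v a) (F *v b) *v w" .
qed

text \<open>The indefinite form is preserved by \<open>F\<close> if and only if \<open>F\<^sup>T G F = G\<close>; hence \<open>F\<^sup>-\<^sup>1 = G F\<^sup>T G\<close>, which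
  is polynomial in \<open>F\<close>.\<close>

definition gram :: "'a::comm_ring_1 ^ 'n::finite option ^ 'n option" where
  "gram = (\<chi> i j. if i = j then (if i = None then -1 else 1) else 0)"

lemma UNIV_option_sum: "(\<Sum>i\<in>UNIV. f i) = f None + (\<Sum>i\<in>UNIV. f (Some i))" for f :: "'n::finite option \<Rightarrow> 'a::comm_monoid_add"
proof -
  have "(\<Sum>i\<in>UNIV. f (Some i)) = sum f (range Some)"
    by (subst sum.reindex) (auto simp: comp_def)
  then show ?thesis by (simp add: UNIV_option_conv sum.insert)
qed

lemma gram_vec: "(gram *v w) $ i = (if i = None then - w $ i else w $ i)"
proof -
  have "(gram *v w) $ i = (\<Sum>j\<in>UNIV. if i = j then (if i = None then -1 else 1) * w $ j else 0)"
    unfolding gram_def matrix_vector_mult_def vec_lambda_beta by (rule sum.cong) auto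
  then show ?thesis by simp
qed

lemma gram_gram: "gram ** gram = (mat 1 :: 'a::field^'n::finite option^'n option)"
  by (rule matrix_eqI) (auto simp: matrix_vector_mul_assoc[symmetric] vec_eq_iff gram_vec)

lemma mink_gram: "mink v w = (\<Sum>i\<in>UNIV. v $ i * (gram *v w) $ i)"
  by (simp add: mink_def UNIV_option_sum gram_vec)

lemma isometric_inverse:
  fixes F :: "'a::field^'n::finite option^'n option"
  assumes "isometric F"
  shows "(gram ** transpose F ** gram) ** F = mat 1" "F ** (gram ** transpose F ** gram) = mat 1"
    "matrix_inv F = gram ** transpose F ** gram"
proof -
  note mg = mink_gram
  have "transpose F ** gram ** F = gram"
  proof (rule matrix_eqI)
    fix w
    have "(\<Sum>i\<in>UNIV. v $ i * ((transpose F ** gram ** F) *v w) $ i) = (\<Sum>i\<in>UNIV. v $ i * (gram *v w) $ i)" for v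
    proof -
      have "(\<Sum>i\<in>UNIV. v $ i * ((transpose F ** gram ** F) *v w) $ i) =
          (\<Sum>i\<in>UNIV. v $ i * (transpose F *v (gram *v (F *v w))) $ i)"
        by (simp add: matrix_vector_mul_assoc matrix_mul_assoc)
      also have "\<dots> = (\<Sum>i\<in>UNIV. \<Sum>j\<in>UNIV. v $ i * (F $ j $ i * (gram *v (F *v w)) $ j))"
        by (simp add: matrix_vector_mult_def transpose_def sum_distrib_left)
      also have "\<dots> = (\<Sum>j\<in>UNIV. (F *v v) $ j * (gram *v (F *v w)) $ j)"
        by (subst sum.swap) (simp add: matrix_vector_mult_def sum_distrib_right mult_ac)
      also have "\<dots> = mink v w" using assms by (simp add: mg[symmetric] isometric_def)
      finally show ?thesis by (simp add: mg)
    qed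
    note e = this
    have "((transpose F ** gram ** F) *v w) $ k = (gram *v w) $ k" for k
      using e[of "axis k 1"] by (simp add: axis_def if_distrib[of "\<lambda>x. x * _"] sum.delta cong: if_cong)
    then show "(transpose F ** gram ** F) *v w = gram *v w" by (simp add: vec_eq_iff)
  qed
  then have "gram ** (transpose F ** gram ** F) = mat 1" by (simp add: gram_gram)
  then show 1: "(gram ** transpose F ** gram) ** F = mat 1" by (simp add: matrix_mul_assoc)
  then show 2: "F ** (gram ** transpose F ** gram) = mat 1" by (simp add: matrix_left_right_inverse)
  have "invertible F" using 1 2 unfolding invertible_def by blast
  then have "matrix_inv F ** F = mat 1" unfolding invertible_def matrix_inv_def by (rule someI2_ex) blast
  then show "matrix_inv F = gram ** transpose F ** gram"
    using matrix_mul_assoc[of "matrix_inv F" F "gram ** transpose F ** gram"] 2 by simp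
qed

lemma isometric_cplx_mat:
  fixes F :: "real^'n::finite option^'n option"
  assumes "isometric F"
  shows "isometric (cplx_mat F)"
proof -
  have d: "\<exists>a b. v = cplx_vec a + \<i> *s cplx_vec b" for v :: "complex^'n option"
    by (rule exI[of _ "\<chi> i. Re (v $ i)"], rule exI[of _ "\<chi> i. Im (v $ i)"])
       (simp add: vec_eq_iff cplx_vec_def complex_eq_iff)
  have "mink (cplx_mat F *v v) (cplx_mat F *v w) = mink v w" for v w
    using d[of v] d[of w] assms
    by (auto simp: isometric_def mink_simps matrix_vector_right_distrib matrix_vec_scale cplx_mat_vec mink_cplx_vec)
  then show ?thesis by (simp add: isometric_def)
qed

subsection \<open>Orthogonal projections\<close>

text \<open>Self-adjointness makes \<open>w - P w\<close> orthogonal to \<open>T\<close>. The space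
  is then the sum of \<open>T\<close> and \<open>perp T\<close>, and the description inside
  \<open>orth_proj\<close> has exactly one solution.\<close>

definition is_proj :: "(complex ^ 'n::finite option) set \<Rightarrow> complex ^ 'n option ^ 'n option \<Rightarrow> bool" where
  "is_proj T P \<longleftrightarrow> (\<forall>w. P *v w \<in> T) \<and> (\<forall>s\<in>T. P *v s = s) \<and>
     (\<forall>v w. mink (P *v v) w = mink v (P *v w))"

lemma is_proj_perp_iff:
  assumes "is_proj T P"
  shows "w \<in> perp T \<longleftrightarrow> P *v w = 0"
proof
  assume "w \<in> perp T"
  then have "mink (P *v w) v = 0" for v
    using assms unfolding is_proj_def perp_def by (metis (mono_tags, lifting) mem_Collect_eq mink_commute)
  then show "P *v w = 0" by (rule mink_nondegenerate)
next
  assume "P *v w = 0"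
  then have "mink s w = 0" if "s \<in> T" for s
    using assms that unfolding is_proj_def by (metis mink_zero(2))
  then show "w \<in> perp T" by (simp add: perp_def)
qed

lemma is_proj_mem_iff: "is_proj T P \<Longrightarrow> s \<in> T \<longleftrightarrow> P *v s = s"
  unfolding is_proj_def by metis

lemma is_proj_idem: "is_proj T P \<Longrightarrow> P ** P = P"
  by (rule matrix_eqI) (simp add: is_proj_def matrix_vector_mul_assoc[symmetric])

lemma orth_proj_eq:
  assumes "is_proj T P"
  shows "orth_proj T = P"
  unfolding orth_proj_def
proof (rule the_equality)
  show "(\<forall>s\<in>T. P *v s = s) \<and> (\<forall>w\<in>perp T. P *v w = 0)"
    using assms is_proj_perp_iff[OF assms] by (auto simp: is_proj_def)
  fix Q assume Q: "(\<forall>s\<in>T. Q *v s = s) \<and> (\<forall>w\<in>perp T. Q *v w = 0)"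
  show "Q = P"
  proof (rule matrix_eqI)
    fix w
    have "P *v (w - P *v w) = 0"
      using is_proj_idem[OF assms] by (simp add: matrix_vector_mult_diff_distrib matrix_vector_mul_assoc)
    then have "Q *v (w - P *v w) = 0" using Q is_proj_perp_iff[OF assms] by blast
    moreover have "Q *v (P *v w) = P *v w" using Q assms by (simp add: is_proj_def)
    ultimately show "Q *v w = P *v w" by (simp add: matrix_vector_mult_diff_distrib)
  qed
qed

lemma is_proj_perp:
  assumes "is_proj T P"
  shows "is_proj (perp T) (mat 1 - P)"
  unfolding is_proj_def
proof (intro conjI allI ballI)
  show "(mat 1 - P) *v w \<in> perp T" for w
    using is_proj_idem[OF assms]
    by (simp add: is_proj_perp_iff[OF assms] matrix_vector_mult_diff_rdistrib
        matrix_vector_mult_diff_distrib matrix_vector_mul_assoc)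
  show "(mat 1 - P) *v s = s" if "s \<in> perp T" for s
    using that by (simp add: is_proj_perp_iff[OF assms] matrix_vector_mult_diff_rdistrib)
  have "mink (P *v v) w = mink v (P *v w)" for v w
    using assms unfolding is_proj_def by blast
  then show "mink ((mat 1 - P) *v v) w = mink v ((mat 1 - P) *v w)" for v w
    by (simp add: matrix_vector_mult_diff_rdistrib mink_simps)
qed

lemma orth_proj_perp: "is_proj T P \<Longrightarrow> orth_proj (perp T) = mat 1 - P"
  by (rule orth_proj_eq[OF is_proj_perp])

lemma is_proj_conj:
  assumes "is_proj T P" "isometric F" "F ** G = mat 1"
  shows "is_proj ((\<lambda>w. F *v w) ` T) (F ** P ** G)"
proof -
  have GF: "G ** F = mat 1" using assms(3) by (simp add: matrix_left_right_inverse)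
  have *: "mink (F *v u) w = mink u (G *v w)" for u w
    using assms(2,3) unfolding isometric_def by (metis matrix_vector_mul_assoc matrix_vector_mul_lid)
  have v: "(F ** P ** G) *v w = F *v (P *v (G *v w))" for w
    by (simp add: matrix_vector_mul_assoc matrix_mul_assoc)
  have g: "G *v (F *v w) = w" for w by (simp add: matrix_vector_mul_assoc GF)
  show ?thesis
    unfolding is_proj_def v
  proof (intro conjI allI ballI)
    show "F *v (P *v (G *v w)) \<in> (\<lambda>w. F *v w) ` T" for w
      using assms(1) unfolding is_proj_def by blast
    show "F *v (P *v (G *v s)) = s" if "s \<in> (\<lambda>w. F *v w) ` T" for s
      using assms(1) that g unfolding is_proj_def by auto
    show "mink (F *v (P *v (G *v v))) w = mink v (F *v (P *v (G *v w)))" for v w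
    proof -
      have "mink (P *v (G *v v)) (G *v w) = mink (G *v v) (P *v (G *v w))"
        using assms(1) unfolding is_proj_def by blast
      then show ?thesis using * by (metis mink_commute)
    qed
  qed
qed


section \<open>Splittings of the trivial bundle\<close>

context ring
begin

text \<open>Here \<open>a\<close> plays a derivative of \<open>p\<close>, the second hypothesis
  being p p = p differentiated. Multiplied by \<open>p\<close> on both sides it gives p a p = 2 p a
  p.\<close>

lemma proj_deriv_sandwich:
  assumes "p * p = p" "a = a * p + p * a"
  shows "p * a * p = 0" "p * (a * p) = 0"
proof -
  have "p * a * p = p * (a * p + p * a) * p" using assms(2) by simp
  also have "\<dots> = p * a * (p * p) + (p * p) * a * p" by (simp add: algebra_simps)
  finally show "p * a * p = 0" by (simp add: assms(1))
  then show "p * (a * p) = 0" by (simp add: mult_assoc)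
qed

text \<open>For the reflection r = 2 p - 1 one has r r = 1 and [a, p] = a r, and r anticommutes with
  derivatives of \<open>p\<close>; so [a, p] [b, p] = a r b r = - a b. The ring has no unit, hence
  the expanded computation.\<close>

lemma proj_deriv_bracket:
  assumes p: "p * p = p" and a: "a = a * p + p * a" and b: "b = b * p + p * b"
  shows "(a * p - p * a) * (b * p - p * b) - (b * p - p * b) * (a * p - p * a) = b * a - a * b"
proof -
  have "(a * p - p * a) * (b * p - p * b) = - (a * b)"
    if "a = a * p + p * a" "b = b * p + p * b" for a b
  proof -
    have pa: "p * a = a - a * p" using that(1) by (metis add_diff_cancel_left')
    have pb: "p * b = b - b * p" using that(2) by (metis add_diff_cancel_left')
    have "(a * p - p * a) * (b * p - p * b) = (a * p + a * p - a) * (b * p + b * p - b)"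
      by (simp add: pa pb algebra_simps)
    also have "\<dots> = (a * p + a * p - a) * (b * p - p * b)"
      by (simp add: pb algebra_simps)
    also have "\<dots> = a * (p * b * p) + a * (p * b * p) - a * (p * p) * b - a * (p * p) * b - a * b * p + a * (p * b)"
      by (simp add: algebra_simps)
    also have "\<dots> = - (a * (p * b + b * p))"
      using proj_deriv_sandwich[OF p that(2)] by (simp add: p algebra_simps)
    also have "\<dots> = - (a * b)"
      by (simp add: pb)
    finally show ?thesis .
  qed
  from this[OF a b] this[OF b a] show ?thesis by simp
qed

text \<open>Bracketing twice with \<open>p\<close> projects onto the off-diagonal part: it fixes
  \<open>k\<close> and kills \<open>e\<close>, which commutes with \<open>p\<close>.\<close>

lemma offdiag_double_bracket:
  assumes p: "p * p = p" and k: "k = k * p + p * k" and e: "e * p = p * e"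
  shows "((k + e) * p - p * (k + e)) * p - p * ((k + e) * p - p * (k + e)) = k"
proof -
  have "((k + e) * p - p * (k + e)) * p - p * ((k + e) * p - p * (k + e)) =
    k * (p * p) + (p * p) * k - (p * k * p + p * k * p) + (e * p) * p - p * (e * p) - p * (e * p) + (p * p) * e"
    by (simp add: algebra_simps)
  also have "\<dots> = k * p + p * k"
    using proj_deriv_sandwich[OF p k] by (simp add: p e algebra_simps) (simp add: mult_assoc[symmetric] p add_ac)
  finally show ?thesis using k by simp
qed

lemma bracket_proj_offdiag:
  assumes p: "p * p = p"
  shows "a * p - p * a = (a * p - p * a) * p + p * (a * p - p * a)"
  by (simp add: algebra_simps p) (simp add: mult_assoc[symmetric] p)

end

interpretation mat_ring: ring where times = "(**) :: complex^'n::finite^'n \<Rightarrow> _" and plus = "(+)"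
    and zero = 0 and minus = "(-)" and uminus = uminus
  by unfold_locales (simp_all add: matrix_mul_assoc matrix_add_left matrix_add_ldistrib)

lemma bounded_bilinear_lie_bracket: "bounded_bilinear (lie_bracket :: complex^'n::finite^'n \<Rightarrow> _)"
  by (rule bounded_bilinearI) (simp_all add: lie_bracket_def matrix_ring_simps algebra_simps)

text \<open>This isolates what the connection calculus uses of a bundle: a smooth orthogonal
  projection near a point. It serves both for the central sphere congruence and for its image under
  the deformation.\<close>

locale splitting =
  fixes c :: "'m::topological_space chart" and W :: "'m set"
    and S :: "'m \<Rightarrow> (complex ^ 'n::finite option) set" and P :: "'m \<Rightarrow> complex ^ 'n option ^ 'n option"
  assumes chart: "is_chart c" and openW: "open W" and W_sub: "W \<subseteq> fst c"
    and P_smooth: "csmooth c W P" and P_proj: "\<And>y. y \<in> W \<Longrightarrow> is_proj (S y) (P y)"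
begin

lemma in_chart: "x \<in> W \<Longrightarrow> x \<in> fst c"
  using W_sub by blast

lemmas smooth_mult = csmooth_bilinear[OF bounded_bilinear_matrix_mult chart openW]
lemmas smooth_mult_vec = csmooth_bilinear[OF bounded_bilinear_matrix_vector_mult chart openW]
lemmas smooth_bracket = csmooth_bilinear[OF bounded_bilinear_lie_bracket chart openW]
lemmas smooth_add = csmooth_add[OF chart openW]
lemmas smooth_diff = csmooth_diff[OF chart openW]
lemmas smooth_minus = csmooth_minus[OF chart openW]
lemmas smooth_dd = csmooth_dd[OF chart openW]
lemmas smooth_cscale = csmooth_bounded_linear[OF bounded_linear_cscale chart openW]
lemmas smooth_scaleR = csmooth_bounded_linear[OF bounded_linear_scaleR_right chart openW]

lemmas smooth_intros = smooth_mult smooth_mult_vec smooth_bracket smooth_add smooth_diff smooth_minus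
  smooth_dd smooth_cscale smooth_scaleR csmooth_const P_smooth

lemmas d_mult = dd_bilinear[OF bounded_bilinear_matrix_mult chart _ _ _ in_chart]
lemmas d_mult_vec = dd_bilinear[OF bounded_bilinear_matrix_vector_mult chart _ _ _ in_chart]
lemmas d_bracket = dd_bilinear[OF bounded_bilinear_lie_bracket chart _ _ _ in_chart]
lemmas d_add = dd_add[OF _ _ _ in_chart]
lemmas d_diff = dd_diff[OF chart openW _ _ _ in_chart]
lemmas d_minus = dd_minus[OF _ _ in_chart]
lemmas d_cscale = dd_bounded_linear[OF bounded_linear_cscale _ _ in_chart]
lemmas d_scaleR = dd_bounded_linear[OF bounded_linear_scaleR_right _ _ in_chart]
lemmas d_cong = dd_cong[OF chart openW _ in_chart]
lemmas d_linear = dd_linear[OF _ _ in_chart]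

lemma P_idem: "x \<in> W \<Longrightarrow> P x ** P x = P x"
  using is_proj_idem P_proj by blast

lemma dP: "x \<in> W \<Longrightarrow> dd c h P x = dd c h P x ** P x + P x ** dd c h P x"
  using d_mult[OF P_smooth P_smooth, of x h] d_cong[OF _ _ smooth_mult[OF P_smooth P_smooth], of x P h] P_idem
  by simp

text \<open>Leibniz for both projections; by dP = dP P + P dP the terms in dP collapse to a single
  bracket, which is thereby identified with N.\<close>

lemma D_conn_expand:
  assumes "csmooth c W \<xi>" "x \<in> W"
  shows "D_conn S c h \<xi> x = dd c h \<xi> x - lie_bracket (dd c h P x) (P x) *v \<xi> x"
proof -
  have 1: "dd c h (\<lambda>y. orth_proj (S y) *v \<xi> y) x = dd c h P x *v \<xi> x + P x *v dd c h \<xi> x"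
    unfolding d_mult_vec[OF P_smooth assms(1,2) assms(2), symmetric]
    by (rule d_cong[OF assms(2,2) smooth_mult_vec[OF P_smooth assms(1)], symmetric])
       (simp add: orth_proj_eq[OF P_proj])
  have "dd c h (\<lambda>y. orth_proj (perp (S y)) *v \<xi> y) x = dd c h (\<lambda>y. \<xi> y - P y *v \<xi> y) x"
    by (rule d_cong[OF assms(2,2) smooth_diff[OF assms(1) smooth_mult_vec[OF P_smooth assms(1)]], symmetric])
       (simp add: orth_proj_perp[OF P_proj] matrix_vector_mult_diff_rdistrib)
  also have "\<dots> = dd c h \<xi> x - (dd c h P x *v \<xi> x + P x *v dd c h \<xi> x)"
    by (simp add: d_diff[OF assms(1) smooth_mult_vec[OF P_smooth assms(1)] assms(2,2)]
        d_mult_vec[OF P_smooth assms(1,2) assms(2)])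
  finally have 2: "dd c h (\<lambda>y. orth_proj (perp (S y)) *v \<xi> y) x =
      dd c h \<xi> x - (dd c h P x *v \<xi> x + P x *v dd c h \<xi> x)" .
  have e: "dd c h P x ** P x = dd c h P x - P x ** dd c h P x"
    using dP[OF assms(2), of h] by (metis add_diff_cancel_right')
  have br: "lie_bracket (dd c h P x) (P x) *v \<xi> x =
      dd c h P x *v \<xi> x - P x *v (dd c h P x *v \<xi> x) - P x *v (dd c h P x *v \<xi> x)"
    unfolding lie_bracket_def e by (simp only: matrix_vector_mult_diff_rdistrib matrix_vector_mul_assoc)
  have PP: "P x *v (P x *v w) = P x *v w" for w
    by (simp add: matrix_vector_mul_assoc P_idem[OF assms(2)])
  have "D_conn S c h \<xi> x = P x *v (dd c h P x *v \<xi> x + P x *v dd c h \<xi> x) +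
     (mat 1 - P x) *v (dd c h \<xi> x - (dd c h P x *v \<xi> x + P x *v dd c h \<xi> x))"
    unfolding D_conn_def 1 2 orth_proj_eq[OF P_proj[OF assms(2)]] orth_proj_perp[OF P_proj[OF assms(2)]] ..
  then show ?thesis
    unfolding br
    by (simp add: matrix_vector_mult_diff_rdistrib matrix_vector_mult_diff_distrib matrix_vector_right_distrib PP)
qed

lemma N_form_eq:
  assumes "x \<in> W"
  shows "N_form S c x h = lie_bracket (dd c h P x) (P x)"
  unfolding N_form_def D_conn_expand[OF csmooth_const assms] by simp

lemma D_conn_eq:
  assumes "csmooth c W \<xi>" "x \<in> W"
  shows "D_conn S c h \<xi> x = dd c h \<xi> x - N_form S c x h *v \<xi> x"
  by (simp add: D_conn_expand assms N_form_eq)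

lemma D_endo_eq:
  assumes "csmooth c W B" "x \<in> W"
  shows "D_endo S c h B x = dd c h B x - lie_bracket (N_form S c x h) (B x)"
proof -
  have "D_conn S c h (\<lambda>y. B y *v w) x - B x *v D_conn S c h (\<lambda>_. w) x =
    (dd c h B x - lie_bracket (N_form S c x h) (B x)) *v w" for w
    unfolding D_conn_eq[OF smooth_mult_vec[OF assms(1) csmooth_const] assms(2)] D_conn_eq[OF csmooth_const assms(2)]
      d_mult_vec[OF assms(1) csmooth_const assms(2,2)]
    by (simp add: lie_bracket_def matrix_vector_mult_diff_rdistrib matrix_vec_minus_right matrix_vector_mul_assoc)
  then show ?thesis unfolding D_endo_def by simp
qed

text \<open>\<open>D_endo\<close> is defined through constant sections; since D and d differ by a
  zero-order term, the Leibniz rule extends to every smooth section.\<close>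

lemma D_endo_vec:
  assumes "csmooth c W B" "csmooth c W \<xi>" "x \<in> W"
  shows "D_endo S c h B x *v \<xi> x = D_conn S c h (\<lambda>y. B y *v \<xi> y) x - B x *v D_conn S c h \<xi> x"
  unfolding D_conn_eq[OF smooth_mult_vec[OF assms(1,2)] assms(3)] D_conn_eq[OF assms(2,3)]
    D_endo_eq[OF assms(1,3)] d_mult_vec[OF assms assms(3)]
  by (simp add: lie_bracket_def matrix_vector_mult_diff_rdistrib matrix_vector_mult_diff_distrib matrix_vector_mul_assoc)

lemma D_endo_linear_combination:
  assumes "csmooth c W B" "csmooth c W B'" "x \<in> W"
  shows "D_endo S c h (\<lambda>y. r *\<^sub>R B y + r' *\<^sub>R B' y) x = r *\<^sub>R D_endo S c h B x + r' *\<^sub>R D_endo S c h B' x"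
  unfolding D_endo_eq[OF smooth_add[OF smooth_scaleR[OF assms(1)] smooth_scaleR[OF assms(2)]] assms(3)]
    D_endo_eq[OF assms(1,3)] D_endo_eq[OF assms(2,3)]
    d_add[OF smooth_scaleR[OF assms(1)] smooth_scaleR[OF assms(2)] assms(3,3)]
    d_scaleR[OF assms(1,3,3)] d_scaleR[OF assms(2,3,3)]
  by (simp add: lie_bracket_def matrix_ring_simps algebra_simps)

lemma D_endo_cong:
  assumes "csmooth c W B" "\<And>y. y \<in> W \<Longrightarrow> B y = B' y" "x \<in> W"
  shows "D_endo S c h B x = D_endo S c h B' x"
proof -
  have B': "csmooth c W B'"
    by (rule csmooth_cong[OF chart openW assms(1)]) (use assms(2) in auto)
  then show ?thesis
    unfolding D_endo_eq[OF assms(1,3)] D_endo_eq[OF B' assms(3)]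
    using d_cong[OF assms(3,3,1), of B' h] assms(2,3) by simp
qed

lemma N_form_smooth: "csmooth c W (\<lambda>y. N_form S c y h)"
  by (rule csmooth_cong[OF chart openW smooth_bracket[OF smooth_dd[OF P_smooth] P_smooth]])
     (simp add: N_form_eq)

lemma N_form_linear:
  assumes "x \<in> W"
  shows "linear (N_form S c x)"
proof -
  interpret l: linear "\<lambda>h. dd c h P x" by (rule d_linear[OF P_smooth assms assms])
  show ?thesis
    by (rule linearI) (simp_all add: N_form_eq[OF assms] l.add l.scale lie_bracket_def matrix_ring_simps algebra_simps)
qed

lemma D_endo_linear:
  assumes "csmooth c W B" "x \<in> W"
  shows "linear (\<lambda>h. D_endo S c h B x)"
proof -
  interpret l: linear "\<lambda>h. dd c h B x" by (rule d_linear[OF assms assms(2)])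
  interpret n: linear "N_form S c x" by (rule N_form_linear[OF assms(2)])
  show ?thesis
    by (rule linearI)
       (simp_all add: D_endo_eq[OF assms] l.add l.scale n.add n.scale lie_bracket_def matrix_ring_simps algebra_simps)
qed

lemma N_form_offdiag:
  assumes "x \<in> W"
  shows "N_form S c x h = N_form S c x h ** P x + P x ** N_form S c x h"
  unfolding N_form_eq[OF assms] lie_bracket_def
  by (rule mat_ring.bracket_proj_offdiag[OF P_idem[OF assms]])

text \<open>The second derivatives of P cancel by symmetry. The products of first derivatives leave
  2 [d_k P, d_h P], which the two brackets [N, N] coming from \<open>D_endo\<close> remove.\<close>

lemma codazzi:
  assumes "x \<in> W"
  shows "ext_D S (N_form S) c x h k = 0"
proof -
  have s: "csmooth c W (\<lambda>y. dd c k P y)" for k by (rule smooth_dd[OF P_smooth])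
  have d: "dd c h (\<lambda>y. N_form S c y k) x =
      lie_bracket (dd c h (dd c k P) x) (P x) + lie_bracket (dd c k P x) (dd c h P x)" for h k
  proof -
    have "dd c h (\<lambda>y. N_form S c y k) x = dd c h (\<lambda>y. lie_bracket (dd c k P y) (P y)) x"
      by (rule d_cong[OF assms assms N_form_smooth]) (simp add: N_form_eq)
    then show ?thesis using d_bracket[OF s P_smooth assms assms] by metis
  qed
  have c: "dd c h (dd c k P) x = dd c k (dd c h P) x"
    by (rule dd_commute[OF chart openW P_smooth assms in_chart[OF assms]])
  have b: "lie_bracket (N_form S c x h) (N_form S c x k) = lie_bracket (dd c k P x) (dd c h P x)" for h k
    unfolding N_form_eq[OF assms] unfolding lie_bracket_def
    by (rule mat_ring.proj_deriv_bracket[OF P_idem[OF assms] dP[OF assms] dP[OF assms]])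
  show ?thesis
    unfolding ext_D_def D_endo_eq[OF N_form_smooth assms] d c b
    by (simp add: lie_bracket_def algebra_simps)
qed

end


section \<open>Gauge transformation of a splitting\<close>

lemma conj_mult:
  fixes F G X Y :: "complex^'n::finite^'n"
  assumes "G ** F = mat 1"
  shows "(F ** X ** G) ** (F ** Y ** G) = F ** (X ** Y) ** G"
proof -
  have "(F ** X ** G) ** (F ** Y ** G) = F ** X ** (G ** F) ** Y ** G"
    by (simp add: matrix_mul_assoc)
  then show ?thesis using assms by (simp add: matrix_mul_assoc)
qed

lemma conj_bracket:
  fixes F G X Y :: "complex^'n::finite^'n"
  assumes "G ** F = mat 1"
  shows "lie_bracket (F ** X ** G) (F ** Y ** G) = F ** lie_bracket X Y ** G"
  unfolding lie_bracket_def conj_mult[OF assms] by (simp add: matrix_ring_simps)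

lemma conj_vec:
  fixes F G X :: "complex^'n::finite^'n"
  assumes "G ** F = mat 1"
  shows "(F ** X ** G) *v (F *v w) = F *v (X *v w)"
proof -
  have "(F ** X ** G) *v (F *v w) = (F ** X ** (G ** F)) *v w"
    by (simp add: matrix_vector_mul_assoc matrix_mul_assoc)
  then show ?thesis by (simp add: assms matrix_vector_mul_assoc)
qed

text \<open>\<open>F\<close> is an isometric gauge with inverse \<open>G\<close>, and K + E is its
  logarithmic derivative, split into the part that exchanges S with its complement and the part that
  preserves both. The spectral parameter does not enter yet.\<close>

locale deformation = splitting c W S P
  for c :: "'m::topological_space chart" and W and S :: "'m \<Rightarrow> (complex ^ 'n::finite option) set" and P +
  fixes F G :: "'m \<Rightarrow> complex ^ 'n option ^ 'n option" and K E :: "'m \<Rightarrow> complex \<Rightarrow> complex ^ 'n option ^ 'n option"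
  assumes F_smooth: "csmooth c W F" and G_smooth: "csmooth c W G"
    and F_isometric: "\<And>y. y \<in> W \<Longrightarrow> isometric (F y)"
    and FG: "\<And>y. y \<in> W \<Longrightarrow> F y ** G y = mat 1"
    and dF: "\<And>x h. x \<in> W \<Longrightarrow> dd c h F x = F x ** (K x h + E x h)"
    and K_offdiag: "\<And>x h. x \<in> W \<Longrightarrow> K x h = K x h ** P x + P x ** K x h"
    and E_diag: "\<And>x h. x \<in> W \<Longrightarrow> E x h ** P x = P x ** E x h"
begin

lemma GF: "y \<in> W \<Longrightarrow> G y ** F y = mat 1"
  using FG by (simp add: matrix_left_right_inverse)

abbreviation "S' \<equiv> (\<lambda>y. (\<lambda>w. F y *v w) ` S y)"

sublocale deformed: splitting c W S' "\<lambda>y. F y ** P y ** G y"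
proof
  show "csmooth c W (\<lambda>y. F y ** P y ** G y)"
    by (intro smooth_mult F_smooth G_smooth P_smooth)
qed (use chart openW W_sub is_proj_conj[OF P_proj F_isometric FG] in auto)

lemma dG:
  assumes "x \<in> W"
  shows "dd c h G x = - ((K x h + E x h) ** G x)"
proof -
  have "dd c h G x ** F x + G x ** dd c h F x = dd c h (\<lambda>_. mat 1) x"
    unfolding d_mult[OF G_smooth F_smooth assms assms, symmetric]
    by (rule d_cong[OF assms assms smooth_mult[OF G_smooth F_smooth]]) (simp add: GF)
  then have "dd c h G x ** F x = - (G x ** dd c h F x)" by (simp add: eq_neg_iff_add_eq_0)
  then have "dd c h G x ** (F x ** G x) = - (G x ** F x ** (K x h + E x h) ** G x)"
    by (simp add: dF[OF assms] matrix_mul_assoc matrix_minus_left)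
  then show ?thesis using FG[OF assms] GF[OF assms] by simp
qed

lemma d_conj:
  assumes "csmooth c W X" "x \<in> W"
  shows "dd c h (\<lambda>y. F y ** X y ** G y) x =
    F x ** (dd c h X x + lie_bracket (K x h + E x h) (X x)) ** G x"
  unfolding d_mult[OF smooth_mult[OF F_smooth assms(1)] G_smooth assms(2,2)]
    d_mult[OF F_smooth assms assms(2)] dF[OF assms(2)] dG[OF assms(2)]
  by (simp only: lie_bracket_def matrix_ring_simps) (simp add: algebra_simps)

text \<open>Conjugation replaces dP by dP + [K + E, P]; one more bracket with P returns K and
  discards E.\<close>

lemma N_form_deformed:
  assumes "x \<in> W"
  shows "N_form S' c x h = F x ** (N_form S c x h + K x h) ** G x"
proof -
  have "lie_bracket (lie_bracket (K x h + E x h) (P x)) (P x) = K x h"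
    unfolding lie_bracket_def
    by (rule mat_ring.offdiag_double_bracket[OF P_idem[OF assms] K_offdiag[OF assms] E_diag[OF assms]])
  then have "lie_bracket (dd c h P x + lie_bracket (K x h + E x h) (P x)) (P x) = N_form S c x h + K x h"
    unfolding N_form_eq[OF assms] by (simp only: lie_bracket_def matrix_ring_simps) (simp add: algebra_simps)
  then show ?thesis
    unfolding deformed.N_form_eq[OF assms] d_conj[OF P_smooth assms] conj_bracket[OF GF[OF assms]]
    by simp
qed

text \<open>Differentiating F produces K + E, and the deformed N absorbs K.\<close>

lemma D_conn_deformed:
  assumes "csmooth c W \<xi>" "x \<in> W"
  shows "D_conn S' c h (\<lambda>y. F y *v \<xi> y) x = F x *v (D_conn S c h \<xi> x + E x h *v \<xi> x)"
  unfolding deformed.D_conn_eq[OF smooth_mult_vec[OF F_smooth assms(1)] assms(2)] D_conn_eq[OF assms]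
    N_form_deformed[OF assms(2)] conj_vec[OF GF[OF assms(2)]] d_mult_vec[OF F_smooth assms assms(2)] dF[OF assms(2)]
  by (simp add: matrix_vector_mul_assoc[symmetric] matrix_vector_mult_diff_distrib matrix_vector_right_distrib
      matrix_vector_mult_add_rdistrib)

lemma D_endo_deformed:
  assumes "csmooth c W X" "x \<in> W"
  shows "D_endo S' c h (\<lambda>y. F y ** X y ** G y) x =
    F x ** (D_endo S c h X x + lie_bracket (E x h) (X x)) ** G x"
  unfolding deformed.D_endo_eq[OF smooth_mult[OF smooth_mult[OF F_smooth assms(1)] G_smooth] assms(2)]
    D_endo_eq[OF assms] N_form_deformed[OF assms(2)] conj_bracket[OF GF[OF assms(2)]] d_conj[OF assms]
  by (simp only: lie_bracket_def matrix_ring_simps) (simp add: algebra_simps)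

end

section \<open>The spectral parameter on the unit circle\<close>

lemma spectral_coefficients:
  assumes "cmod \<mu> = 1"
  shows "1 / \<mu> = of_real (Re \<mu>) - \<i> * of_real (Im \<mu>)" "\<mu> = of_real (Re \<mu>) + \<i> * of_real (Im \<mu>)"
proof -
  have "cnj \<mu> * \<mu> = 1" using assms by (simp add: complex_norm_square[symmetric] mult.commute)
  then have "1 / \<mu> = cnj \<mu>" by (metis nonzero_eq_divide_eq mult_zero_right zero_neq_one)
  then show "1 / \<mu> = of_real (Re \<mu>) - \<i> * of_real (Im \<mu>)" by (simp add: complex_eq_iff)
qed (simp add: complex_eq_iff)

text \<open>As 1 / \<mu> is the conjugate of \<mu>, the imaginary units cancel. The result is Re
  \<mu> \<omega> + Im \<mu> *\<omega>, with constant real coefficients, so it can be differentiated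
  and conjugated termwise.\<close>

lemma spectral_combination:
  assumes "cmod \<mu> = 1"
  shows "cscale (1 / \<mu>) (part10 \<omega> c x h) + cscale \<mu> (part01 \<omega> c x h) =
    Re \<mu> *\<^sub>R \<omega> c x h - Im \<mu> *\<^sub>R \<omega> c x (\<i> * h)"
proof -
  have "(of_real r - \<i> * of_real m) * (1 / 2 * (a - \<i> * b)) + (of_real r + \<i> * of_real m) * (1 / 2 * (a + \<i> * b)) =
     r *\<^sub>R a - m *\<^sub>R b" for a b :: complex and r m
    by (simp add: complex_eq_iff field_simps)
  from this[of "Re \<mu>" "Im \<mu>", folded spectral_coefficients[OF assms]]
  show ?thesis by (simp add: part10_def part01_def vec_eq_iff)
qed

lemma q_spectral_combination:
  assumes "cmod \<mu> = 1"
  shows "q_spectral \<mu> q c x h = Re (\<mu>\<^sup>2) *\<^sub>R q c x h - Im (\<mu>\<^sup>2) *\<^sub>R q c x (\<i> * h)"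
  unfolding q_spectral_def by (rule spectral_combination) (simp add: norm_power assms)

lemma part_sum: "part10 \<omega> c x h + part01 \<omega> c x h = \<omega> c x h"
  by (simp add: part10_def part01_def vec_eq_iff field_simps)

text \<open>Only through this rotation invariance does the parameter drop out of the constrained Willmore
  equation, since \<open>q\<^sub>\<mu> + q\<close> is twice the real part of \<open>\<mu>\<close> times a rotation of \<open>q\<close>.\<close>

lemma wedge_bracket_rotate:
  fixes q N :: "complex \<Rightarrow> complex^'n::finite^'n" and a b :: real
  assumes "linear q" "linear N" "a\<^sup>2 + b\<^sup>2 = 1"
  shows "lie_bracket (a *\<^sub>R q h - b *\<^sub>R q (\<i> * h)) (- (a *\<^sub>R N (\<i> * k)) - b *\<^sub>R N k)
       - lie_bracket (a *\<^sub>R q k - b *\<^sub>R q (\<i> * k)) (- (a *\<^sub>R N (\<i> * h)) - b *\<^sub>R N h)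
    = lie_bracket (q h) (- N (\<i> * k)) - lie_bracket (q k) (- N (\<i> * h))"
proof -
  interpret br: bounded_bilinear "lie_bracket :: complex^'n^'n \<Rightarrow> _" by (rule bounded_bilinear_lie_bracket)
  \<comment> \<open>In the real basis 1, \<i> the claim becomes a polynomial identity in
    \<open>a\<close> and \<open>b\<close> modulo a^2 + b^2 = 1.\<close>
  define q1 qi N1 Ni where defs: "q1 = q 1" "qi = q \<i>" "N1 = N 1" "Ni = N \<i>"
  have q: "q z = Re z *\<^sub>R q1 + Im z *\<^sub>R qi" and N: "N z = Re z *\<^sub>R N1 + Im z *\<^sub>R Ni" for z
    unfolding defs by (rule linear_complex_expand[OF assms(1)], rule linear_complex_expand[OF assms(2)])
  have a: "a * a = 1 - b * b" using assms(3) by (simp add: power2_eq_square)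
  show ?thesis
    unfolding q N
    by (simp add: br.add_left br.add_right br.diff_left br.diff_right br.minus_left br.minus_right
        br.scaleR_left br.scaleR_right, simp add: vec_eq_iff, intro allI, unfold scaleR_conv_of_real,
        insert arg_cong[OF a, of complex_of_real], simp, algebra)
qed

lemma hodge_eq: "hodge \<omega> c x h = - \<omega> c x (\<i> * h)"
  by (simp add: hodge_def)

text \<open>The two types are the eigenparts, for \<i> and -\<i>, of composition with multiplication
  by \<i>. Multiplying by \<open>A\<close> and \<open>B\<close> is complex linear, so each weight
  stays with its type.\<close>

lemma part_conj:
  fixes A B :: "complex^'k::finite^'k"
  assumes lin: "linear (\<omega> c x)"
    and \<omega>': "\<And>h. \<omega>' c x h = A ** (cscale u (part10 \<omega> c x h) + cscale v (part01 \<omega> c x h)) ** B"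
  shows "part10 \<omega>' c x h = cscale u (A ** part10 \<omega> c x h ** B)"
    and "part01 \<omega>' c x h = cscale v (A ** part01 \<omega> c x h ** B)"
proof -
  have neg: "\<omega> c x (\<i> * (\<i> * h)) = - \<omega> c x h"
    using linear_neg[OF lin, of h] by (simp add: mult.assoc[symmetric])
  have i: "part10 \<omega> c x (\<i> * h) = cscale \<i> (part10 \<omega> c x h)"
    "part01 \<omega> c x (\<i> * h) = cscale (- \<i>) (part01 \<omega> c x h)"
    unfolding part10_def part01_def neg by (simp_all add: vec_eq_iff algebra_simps)
  define a where "a = A ** part10 \<omega> c x h ** B"
  define b where "b = A ** part01 \<omega> c x h ** B"
  have 1: "\<omega>' c x h = cscale u a + cscale v b"
    unfolding \<omega>' a_def b_def by (simp add: matrix_ring_simps)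
  have 2: "\<omega>' c x (\<i> * h) = cscale u (cscale \<i> a) + cscale v (cscale (- \<i>) b)"
    unfolding \<omega>' i a_def b_def by (simp add: matrix_ring_simps)
  have "part10 \<omega>' c x h = cscale u a"
    unfolding part10_def 1 2 by (simp add: vec_eq_iff field_simps)
  then show "part10 \<omega>' c x h = cscale u (A ** part10 \<omega> c x h ** B)" by (simp add: a_def)
  have "part01 \<omega>' c x h = cscale v b"
    unfolding part01_def 1 2 by (simp add: vec_eq_iff field_simps)
  then show "part01 \<omega>' c x h = cscale v (A ** part01 \<omega> c x h ** B)" by (simp add: b_def)
qed

locale spectral = deformation c W S P F G K E
  for c :: "'m::topological_space chart" and W and S :: "'m \<Rightarrow> (complex ^ 'n::finite option) set"
    and P F G K E +
  fixes q :: "('m, 'n option) endo_form" and \<mu> :: complex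
  assumes mu: "cmod \<mu> = 1"
    and q_smooth: "\<And>h. csmooth c W (\<lambda>y. q c y h)"
    and q_linear: "\<And>x. x \<in> W \<Longrightarrow> linear (q c x)"
    and q_comm: "\<And>x h k. x \<in> W \<Longrightarrow> lie_bracket (q c x h) (q c x k) = 0"
    and K_eq: "\<And>x h. x \<in> W \<Longrightarrow> N_form S c x h + K x h =
      cscale (1 / \<mu>) (part10 (N_form S) c x h) + cscale \<mu> (part01 (N_form S) c x h)"
    and E_eq: "\<And>x h. x \<in> W \<Longrightarrow> E x h = q_spectral \<mu> q c x h - q c x h"
begin

definition q' :: "('m, 'n option) endo_form" where
  "q' b x h = F x ** q_spectral \<mu> q b x h ** G x"

lemma mu_circle: "(Re \<mu>)\<^sup>2 + (Im \<mu>)\<^sup>2 = 1"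
  using mu by (simp add: cmod_def)

lemma N_form_spectral:
  assumes "x \<in> W"
  shows "N_form S' c x h = F x ** (Re \<mu> *\<^sub>R N_form S c x h - Im \<mu> *\<^sub>R N_form S c x (\<i> * h)) ** G x"
  unfolding N_form_deformed[OF assms] K_eq[OF assms] spectral_combination[OF mu] ..

lemma q_spectral_comm:
  assumes "x \<in> W"
  shows "lie_bracket (E x h) (q_spectral \<mu> q c x k) = 0"
proof -
  interpret br: bounded_bilinear "lie_bracket :: complex^'n option^'n option \<Rightarrow> _" by (rule bounded_bilinear_lie_bracket)
  show ?thesis
    unfolding E_eq[OF assms] q_spectral_combination[OF mu]
    by (simp add: br.add_left br.add_right br.diff_left br.diff_right br.scaleR_left br.scaleR_right q_comm[OF assms])
qed

text \<open>Since E commutes with q_\<mu>, only the conjugate of d^D q_\<mu> is left, a constant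
  combination of d^D q and d^D *q.\<close>

lemma ext_D_deformed_q:
  assumes "x \<in> W" "ext_D S q c x h k = 0" "ext_D S (hodge q) c x h k = 0"
  shows "ext_D S' q' c x h k = 0"
proof -
  let ?C = "Re (\<mu>\<^sup>2)" and ?S = "Im (\<mu>\<^sup>2)"
  have eq: "q_spectral \<mu> q c y k = ?C *\<^sub>R q c y k + ?S *\<^sub>R hodge q c y k" for y k
    by (simp add: q_spectral_combination[OF mu] hodge_eq)
  have hs: "csmooth c W (\<lambda>y. hodge q c y h)" for h
    unfolding hodge_eq by (intro smooth_minus q_smooth)
  have s: "csmooth c W (\<lambda>y. q_spectral \<mu> q c y k)" for k
    unfolding eq by (intro smooth_intros q_smooth hs)
  have "D_endo S' c h (\<lambda>y. q' c y k) x =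
      F x ** (?C *\<^sub>R D_endo S c h (\<lambda>y. q c y k) x + ?S *\<^sub>R D_endo S c h (\<lambda>y. hodge q c y k) x) ** G x" for h k
    unfolding q'_def D_endo_deformed[OF s assms(1)] q_spectral_comm[OF assms(1)]
    unfolding eq D_endo_linear_combination[OF q_smooth hs assms(1)] by simp
  note e = this
  have "ext_D S' q' c x h k = F x ** (?C *\<^sub>R ext_D S q c x h k + ?S *\<^sub>R ext_D S (hodge q) c x h k) ** G x"
    unfolding ext_D_def e by (simp add: matrix_ring_simps scaleR_diff_right)
  then show ?thesis using assms(2,3) by simp
qed

lemma ext_D_deformed_N:
  assumes "x \<in> W"
    and willmore: "ext_D S (hodge (N_form S)) c x h k = 2 *\<^sub>R wedge_bracket q (hodge (N_form S)) c x h k"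
  shows "ext_D S' (hodge (N_form S')) c x h k = 2 *\<^sub>R wedge_bracket q' (hodge (N_form S')) c x h k"
proof -
  interpret br: bounded_bilinear "lie_bracket :: complex^'n option^'n option \<Rightarrow> _" by (rule bounded_bilinear_lie_bracket)
  let ?a = "Re \<mu>" and ?b = "Im \<mu>"
  let ?N = "N_form S"
  have ii: "\<i> * (\<i> * k) = - k" for k by (simp add: mult.assoc[symmetric])
  have neg: "?N c y (- k) = - ?N c y k" if "y \<in> W" for y k
    using linear_neg[OF N_form_linear[OF that]] .
  \<comment> \<open>\<open>X\<close> is *N_\<mu> before conjugation: the star of Re \<mu> N + Im
    \<mu> *N, as the star squares to -1 on 1-forms.\<close>
  define X where "X k y = ?a *\<^sub>R hodge ?N c y k + (- ?b) *\<^sub>R ?N c y k" for k y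
  have hN: "hodge (N_form S') c y k = F y ** X k y ** G y" if "y \<in> W" for y k
    unfolding hodge_eq N_form_spectral[OF that] X_def ii neg[OF that]
    by (simp only: matrix_ring_simps) simp
  have hs: "csmooth c W (\<lambda>y. hodge ?N c y h)" for h
    unfolding hodge_eq by (intro smooth_minus N_form_smooth)
  have Xs: "csmooth c W (X k)" for k
    unfolding X_def by (intro smooth_intros N_form_smooth hs)
  have D: "D_endo S' c h (\<lambda>y. hodge (N_form S') c y k) x =
     F x ** (?a *\<^sub>R D_endo S c h (\<lambda>y. hodge ?N c y k) x - ?b *\<^sub>R D_endo S c h (\<lambda>y. ?N c y k) x
       + lie_bracket (E x h) (X k x)) ** G x" for h k
  proof -
    have "D_endo S' c h (\<lambda>y. hodge (N_form S') c y k) x = D_endo S' c h (\<lambda>y. F y ** X k y ** G y) x"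
      by (rule deformed.D_endo_cong[OF _ _ assms(1), symmetric])
         (use hN in \<open>auto intro!: smooth_mult F_smooth G_smooth Xs\<close>)
    also have "\<dots> = F x ** (D_endo S c h (X k) x + lie_bracket (E x h) (X k x)) ** G x"
      by (rule D_endo_deformed[OF Xs assms(1)])
    finally show ?thesis
      unfolding X_def D_endo_linear_combination[OF hs N_form_smooth assms(1)] by simp
  qed
  have "ext_D S' (hodge (N_form S')) c x h k = F x ** (?a *\<^sub>R ext_D S (hodge ?N) c x h k - ?b *\<^sub>R ext_D S ?N c x h k
       + (lie_bracket (E x h) (X k x) - lie_bracket (E x k) (X h x))) ** G x"
    unfolding ext_D_def D by (simp only: matrix_ring_simps scaleR_diff_right) (simp add: algebra_simps)
  also have "\<dots> = F x ** ((2 * ?a) *\<^sub>R wedge_bracket q (hodge ?N) c x h k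
       + (lie_bracket (E x h) (X k x) - lie_bracket (E x k) (X h x))) ** G x"
    unfolding codazzi[OF assms(1)] willmore by (simp add: mult.commute)
  \<comment> \<open>Moving E = q_\<mu> - q to the other side, the claim is that the bracket of
    q_\<mu> + q with *N_\<mu> equals 2 Re \<mu> times that of q with *N.\<close>
  also have "(2 * ?a) *\<^sub>R wedge_bracket q (hodge ?N) c x h k
       + (lie_bracket (E x h) (X k x) - lie_bracket (E x k) (X h x)) =
     2 *\<^sub>R (lie_bracket (q_spectral \<mu> q c x h) (X k x) - lie_bracket (q_spectral \<mu> q c x k) (X h x))"
  proof -
    \<comment> \<open>The rotation \<mu>^-1 q^(1,0) + \<mu> q^(0,1). It arises because \<mu>^-2 + 1
      = 2 Re \<mu> \<mu>^-1, and likewise for the conjugate.\<close>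
    define Q where "Q h = ?a *\<^sub>R q c x h - ?b *\<^sub>R q c x (\<i> * h)" for h
    have Qs: "q_spectral \<mu> q c x h + q c x h = (2 * ?a) *\<^sub>R Q h" for h
    proof -
      have "1 + Re (\<mu>\<^sup>2) = 2 * ?a * ?a" "Im (\<mu>\<^sup>2) = 2 * ?a * ?b"
        using mu_circle by (simp_all add: power2_eq_square)
      then have "(1 + Re (\<mu>\<^sup>2)) *\<^sub>R q c x h - Im (\<mu>\<^sup>2) *\<^sub>R q c x (\<i> * h) = (2 * ?a) *\<^sub>R Q h"
        by (simp add: Q_def scaleR_diff_right)
      then show ?thesis unfolding q_spectral_combination[OF mu] by (simp add: algebra_simps)
    qed
    have Xe: "X k x = - (?a *\<^sub>R ?N c x (\<i> * k)) - ?b *\<^sub>R ?N c x k" for k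
      by (simp add: X_def hodge_eq)
    have w: "wedge_bracket q (hodge ?N) c x h k = lie_bracket (Q h) (X k x) - lie_bracket (Q k) (X h x)"
      unfolding wedge_bracket_def hodge_eq Xe Q_def
      by (rule wedge_bracket_rotate[OF q_linear N_form_linear mu_circle, symmetric]) (use assms in auto)
    have "(2 * ?a) *\<^sub>R wedge_bracket q (hodge ?N) c x h k =
       lie_bracket (q_spectral \<mu> q c x h + q c x h) (X k x) - lie_bracket (q_spectral \<mu> q c x k + q c x k) (X h x)"
      unfolding w Qs by (simp add: br.scaleR_left scaleR_diff_right)
    then show ?thesis
      by (simp add: E_eq[OF assms(1)] br.add_left br.diff_left scaleR_2 algebra_simps)
  qed
  also have "F x ** \<dots> ** G x = 2 *\<^sub>R wedge_bracket q' (hodge (N_form S')) c x h k"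
    unfolding wedge_bracket_def q'_def hN[OF assms(1)] conj_bracket[OF GF[OF assms(1)]]
    by (simp add: matrix_ring_simps)
  finally show ?thesis .
qed

text \<open>The coefficients of q telescope: \<mu>^-2 (\<lambda>^-2 - 1) from \<open>q'\<close> and
  \<mu>^-2 - 1 from \<open>E\<close> add up to (\<mu> \<lambda>)^-2 - 1, and similarly for type
  (0,1).\<close>

lemma d_lambda_deformed:
  assumes "csmooth c W \<xi>" "x \<in> W"
  shows "d_lambda S' q' lam c h (\<lambda>y. F y *v \<xi> y) x = F x *v d_lambda S q (\<mu> * lam) c h \<xi> x"
proof -
  have N': "N_form S' c x h = F x ** (cscale (1 / \<mu>) (part10 (N_form S) c x h) + cscale \<mu> (part01 (N_form S) c x h)) ** G x" for h
    unfolding N_form_deformed[OF assms(2)] K_eq[OF assms(2)] ..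
  have q': "q' c x h = F x ** (cscale (1 / \<mu>\<^sup>2) (part10 q c x h) + cscale (\<mu>\<^sup>2) (part01 q c x h)) ** G x" for h
    unfolding q'_def q_spectral_def ..
  have E: "E x h = cscale (1 / \<mu>\<^sup>2 - 1) (part10 q c x h) + cscale (\<mu>\<^sup>2 - 1) (part01 q c x h)"
    unfolding E_eq[OF assms(2)] q_spectral_def
    using part_sum[of q c x h] by (simp add: vec_eq_iff algebra_simps)
  note parts = part_conj[where \<omega>' = "N_form S'", OF N_form_linear[OF assms(2)] N'] part_conj[where \<omega>' = q', OF q_linear[OF assms(2)] q']
  show ?thesis
    unfolding d_lambda_def D_conn_deformed[OF assms(1,2)] parts cscale_vec conj_vec[OF GF[OF assms(2)]] E
      matrix_vector_mult_add_rdistrib matrix_vector_right_distrib matrix_vec_scale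
    by (simp add: vec_eq_iff divide_inverse power_mult_distrib algebra_simps)
qed

end


section \<open>The frame of the central sphere congruence\<close>

text \<open>Subtracting the multiple of \<open>u\<close> that cancels the timelike coordinate leaves
  a null vector of a definite subspace, hence zero. This is the Lorentzian fact behind the
  nondegeneracy of the induced metric.\<close>

lemma null_orthogonal_collinear:
  fixes u v :: "real ^ 'n::finite option"
  assumes "mink u u = 0" "u \<noteq> 0" "mink v v = 0" "mink u v = 0"
  shows "\<exists>k. v = k *\<^sub>R u"
proof -
  have pos: "w = 0" if "mink w w = 0" "w $ None = 0" for w :: "real ^ 'n option"
  proof -
    have "(\<Sum>i\<in>UNIV. w $ Some i * w $ Some i) = 0" using that by (simp add: mink_def)
    then have "w $ Some i = 0" for i
      by (subst (asm) sum_nonneg_eq_0_iff) auto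
    then have "w $ i = 0" for i using that by (cases i) auto
    then show ?thesis by (simp add: vec_eq_iff)
  qed
  have n: "u $ None \<noteq> 0" using pos assms by blast
  define k where "k = v $ None / u $ None"
  have "mink (v - k *s u) (v - k *s u) = 0"
    using assms by (simp add: mink_simps mink_commute[of v u])
  moreover have "(v - k *s u) $ None = 0" using n by (simp add: k_def)
  ultimately have "v - k *s u = 0" using pos by blast
  then show ?thesis by (auto simp: scalar_mult_eq_scaleR)
qed

definition outer :: "complex ^ 'n::finite option \<Rightarrow> complex ^ 'n option \<Rightarrow> complex ^ 'n option ^ 'n option" where
  "outer a b = matrix (\<lambda>w. mink w a *s b)"

lemma outer_vec: "outer a b *v w = mink w a *s b"
  unfolding outer_def
  by (rule matrix_works) (unfold_locales, auto simp: mink_simps vec_eq_iff algebra_simps)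

lemma bounded_bilinear_outer: "bounded_bilinear (outer :: complex ^ 'n::finite option \<Rightarrow> _)"
proof -
  interpret m: bounded_bilinear "mink :: complex ^ 'n option \<Rightarrow> _" by (rule bounded_bilinear_mink)
  show ?thesis
    by (rule bounded_bilinearI; rule matrix_eqI)
       (simp_all add: outer_vec matrix_vector_mult_add_rdistrib matrix_vec_scaleR m.scaleR_right mink_simps,
        simp_all add: vec_eq_iff algebra_simps)
qed

lemma bounded_bilinear_cscale: "bounded_bilinear (cscale :: complex \<Rightarrow> complex^'k::finite^'k \<Rightarrow> _)"
  by (rule bounded_bilinearI) (simp_all add: vec_eq_iff algebra_simps)

text \<open>
  The fourth frame vector corrected so that the Gram matrix of \<open>s, z, b, t\<close> becomes antidiagonal,
  up to the order of the vectors.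
\<close>

definition polar :: "complex ^ 'n::finite option \<Rightarrow> complex ^ 'n option \<Rightarrow> complex ^ 'n option
    \<Rightarrow> complex ^ 'n option \<Rightarrow> complex ^ 'n option" where
  "polar s z b e =
     (let j = inverse (mink z b);
          t = e - ((j * mink e z) *s b + (j * mink e b) *s z)
      in t + (j * (mink t t / 2)) *s s)"

text \<open>The dual-basis expansion for z, b, s, t, whose only non-zero products are (z, b) = g and
  (s, t) = -g; hence the common factor 1/g and the signs.\<close>

definition frame_proj :: "complex ^ 'n::finite option \<Rightarrow> complex ^ 'n option \<Rightarrow> complex ^ 'n option
    \<Rightarrow> complex ^ 'n option \<Rightarrow> complex ^ 'n option ^ 'n option" where
  "frame_proj s z b e = cscale (inverse (mink z b))
     (outer b z + outer z b - outer (polar s z b e) s - outer s (polar s z b e))"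

text \<open>The relations of \<sigma>, \<sigma>_z, \<sigma>_zbar, \<sigma>_zzbar: nullity of the
  lift, conformality of the chart and, for \<open>se\<close>, the derivative of (\<sigma>,
  \<sigma>_zbar) = 0. The other products of \<open>e\<close> are unknown, which is what
  \<open>polar\<close> corrects.\<close>

locale frame =
  fixes s z b e :: "complex ^ 'n::finite option"
  assumes ss: "mink s s = 0" and sz: "mink s z = 0" and sb: "mink s b = 0"
    and zz: "mink z z = 0" and bb: "mink b b = 0" and zb: "mink z b \<noteq> 0"
    and se: "mink s e = - mink z b"
begin

abbreviation "g \<equiv> mink z b"
abbreviation "t \<equiv> polar s z b e"

lemma gram_table:
  "mink s s = 0" "mink s z = 0" "mink z s = 0" "mink s b = 0" "mink b s = 0" "mink z z = 0" "mink b b = 0"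
  "mink b z = g" "mink s e = - g" "mink e s = - g"
  using ss sz sb zz bb se by (simp_all add: mink_commute)

lemma t_expand: "\<exists>p q r. t = e + p *s b + q *s z + r *s s"
proof -
  have "e - (p *s b + q *s z) + r *s s = e + (- p) *s b + (- q) *s z + r *s s" for p q r
    by (simp add: vec_eq_iff)
  then show ?thesis unfolding polar_def Let_def by blast
qed

lemma polar_table:
  "mink t z = 0" "mink z t = 0" "mink t b = 0" "mink b t = 0" "mink t s = - g" "mink s t = - g" "mink t t = 0"
proof -
  have "t = (e - ((inverse g * mink e z) *s b + (inverse g * mink e b) *s z)) +
     (inverse g * (mink (e - ((inverse g * mink e z) *s b + (inverse g * mink e b) *s z))
       (e - ((inverse g * mink e z) *s b + (inverse g * mink e b) *s z)) / 2)) *s s"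
    by (simp add: polar_def Let_def)
  moreover define t0 where "t0 = e - ((inverse g * mink e z) *s b + (inverse g * mink e b) *s z)"
  ultimately have t: "t = t0 + (inverse g * (mink t0 t0 / 2)) *s s" by simp
  have 0: "mink t0 z = 0" "mink t0 b = 0" "mink t0 s = - g"
    unfolding t0_def using zb by (simp_all add: mink_simps gram_table)
  then show "mink t z = 0" "mink t b = 0" "mink t s = - g"
    unfolding t by (simp_all add: mink_simps gram_table)
  then show "mink z t = 0" "mink b t = 0" "mink s t = - g" by (simp_all add: mink_commute)
  have "mink s t0 = - g" using 0(3) by (simp add: mink_commute)
  with 0 show "mink t t = 0"
    unfolding t using zb by (simp add: mink_simps gram_table field_simps)
qed

abbreviation "Pr \<equiv> frame_proj s z b e"

lemma Pr_vec: "Pr *v w = inverse g *s (mink w b *s z + mink w z *s b - mink w t *s s - mink w s *s t)"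
  by (simp add: frame_proj_def cscale_vec outer_vec matrix_vector_mult_diff_rdistrib matrix_vector_mult_add_rdistrib)

lemma Pr_frame: "Pr *v s = s" "Pr *v z = z" "Pr *v b = b" "Pr *v e = e"
proof -
  show 1: "Pr *v s = s" "Pr *v z = z" "Pr *v b = b"
    unfolding Pr_vec using zb by (simp_all add: gram_table polar_table vec_eq_iff)
  have t: "Pr *v t = t"
    unfolding Pr_vec using zb by (simp add: polar_table gram_table vec_eq_iff)
  obtain p q r where "t = e + p *s b + q *s z + r *s s" using t_expand by blast
  then have e: "e = t - p *s b - q *s z - r *s s" by simp
  show "Pr *v e = e"
    by (subst (1 2) e) (simp only: matrix_vector_mult_diff_distrib matrix_vec_scale 1 t)
qed

lemma Pr_sym: "mink (Pr *v v) w = mink v (Pr *v w)"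
  unfolding Pr_vec by (simp add: mink_simps mink_commute algebra_simps)

lemma Pr_is_proj: "is_proj (vec.span {s, z, b, e}) Pr"
  unfolding is_proj_def
proof (intro conjI allI ballI)
  let ?T = "vec.span {s, z, b, e}"
  have gens: "s \<in> ?T" "z \<in> ?T" "b \<in> ?T" "e \<in> ?T" by (auto intro: vec.span_base)
  obtain p q r where "t = e + p *s b + q *s z + r *s s" using t_expand by blast
  then have "t \<in> ?T" using gens by (simp add: vec.span_add vec.span_scale)
  then show "Pr *v w \<in> ?T" for w
    unfolding Pr_vec using gens by (intro vec.span_scale vec.span_diff vec.span_add)
  show "Pr *v u = u" if "u \<in> ?T" for u
    using that
  proof (induction rule: vec.span_induct_alt)
    case base
    show ?case by simp
  next
    case (step k x y)
    then show ?case using Pr_frame by (auto simp: matrix_vector_right_distrib matrix_vec_scale)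
  qed
qed (rule Pr_sym)

end

section \<open>The frame along a lift in a holomorphic chart\<close>

locale chart_patch =
  fixes c :: "'m::topological_space chart" and W :: "'m set"
  assumes chart: "is_chart c" and openW: "open W" and W_sub: "W \<subseteq> fst c"
begin

lemma in_chart: "x \<in> W \<Longrightarrow> x \<in> fst c"
  using W_sub by blast

lemmas smooth_mink = csmooth_bilinear[OF bounded_bilinear_mink chart openW]
lemmas smooth_scale = csmooth_bilinear[OF bounded_bilinear_vector_scalar_mult chart openW]
lemmas smooth_outer = csmooth_bilinear[OF bounded_bilinear_outer chart openW]
lemmas smooth_cscale2 = csmooth_bilinear[OF bounded_bilinear_cscale chart openW]
lemmas smooth_times = csmooth_bilinear[OF bounded_bilinear_mult chart openW]

lemma bounded_linear_scale: "bounded_linear ((*s) (k::complex) :: complex^'k::finite \<Rightarrow> _)"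
  by (rule bounded_bilinear.bounded_linear_right[OF bounded_bilinear_vector_scalar_mult])

lemma d_z_smooth:
  fixes f :: "'m \<Rightarrow> complex ^ 'k::finite"
  assumes "csmooth c W f"
  shows "csmooth c W (d_z c f)" "csmooth c W (d_zbar c f)"
proof -
  have d: "csmooth c W (\<lambda>x. dd c h f x)" for h by (rule csmooth_dd[OF chart openW assms])
  show "csmooth c W (d_z c f)" "csmooth c W (d_zbar c f)"
    unfolding d_z_def[abs_def] d_zbar_def[abs_def]
    by (intro csmooth_bounded_linear[OF bounded_linear_scale chart openW] csmooth_add[OF chart openW]
          csmooth_diff[OF chart openW] d)+
qed

lemma dd_scale:
  fixes f :: "'m \<Rightarrow> complex ^ 'k::finite"
  assumes "csmooth c W f" "x \<in> W"
  shows "dd c h (\<lambda>y. k *s f y) x = k *s dd c h f x"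
  by (rule dd_bounded_linear[OF bounded_linear_scale assms in_chart[OF assms(2)]])

lemma d_z_commute:
  fixes f :: "'m \<Rightarrow> complex ^ 'k::finite"
  assumes "csmooth c W f" "x \<in> W"
  shows "d_z c (d_zbar c f) x = d_zbar c (d_z c f) x"
proof -
  have d: "csmooth c W (dd c h f)" for h by (rule csmooth_dd[OF chart openW assms(1)])
  have d': "csmooth c W (\<lambda>y. k *s dd c h f y)" for h k
    by (rule csmooth_bounded_linear[OF bounded_linear_scale chart openW d])
  have 1: "dd c h (d_zbar c f) x = (1 / 2) *s (dd c h (dd c 1 f) x + \<i> *s dd c h (dd c \<i> f) x)" for h
    unfolding d_zbar_def[abs_def]
      dd_scale[OF csmooth_add[OF chart openW d d'] assms(2)] dd_add[OF d d' assms(2) in_chart[OF assms(2)]]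
      dd_scale[OF d assms(2)] ..
  have 2: "dd c h (d_z c f) x = (1 / 2) *s (dd c h (dd c 1 f) x - \<i> *s dd c h (dd c \<i> f) x)" for h
    unfolding d_z_def[abs_def]
      dd_scale[OF csmooth_diff[OF chart openW d d'] assms(2)]
      dd_diff[OF chart openW d d' assms(2) in_chart[OF assms(2)]] dd_scale[OF d assms(2)] ..
  have c: "dd c 1 (dd c \<i> f) x = dd c \<i> (dd c 1 f) x"
    by (rule dd_commute[OF chart openW assms in_chart[OF assms(2)]])
  show ?thesis
    unfolding d_z_def[of c "d_zbar c f"] d_zbar_def[of c "d_z c f"] 1 2 c
    by (simp add: vec_eq_iff algebra_simps)
qed

lemma d_z_mink_const:
  fixes f g :: "'m \<Rightarrow> complex ^ 'n::finite option"
  assumes "csmooth c W f" "csmooth c W g" "x \<in> W" "\<And>y. y \<in> W \<Longrightarrow> mink (f y) (g y) = k"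
  shows "mink (d_z c f x) (g x) = - mink (f x) (d_z c g x)"
    "mink (d_zbar c f x) (g x) = - mink (f x) (d_zbar c g x)"
proof -
  have "mink (dd c h f x) (g x) + mink (f x) (dd c h g x) = 0" for h
  proof -
    have "dd c h (\<lambda>y. mink (f y) (g y)) x = dd c h (\<lambda>_. k) x"
      by (rule dd_cong[OF chart openW assms(3) in_chart[OF assms(3)] smooth_mink[OF assms(1,2)]])
         (rule assms(4))
    then show ?thesis
      using dd_bilinear[OF bounded_bilinear_mink chart assms(1,2,3) in_chart[OF assms(3)], of h] by simp
  qed
  then have "mink (dd c h f x) (g x) = - mink (f x) (dd c h g x)" for h
    by (simp add: eq_neg_iff_add_eq_0)
  then show "mink (d_z c f x) (g x) = - mink (f x) (d_z c g x)"
    "mink (d_zbar c f x) (g x) = - mink (f x) (d_zbar c g x)"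
    by (simp_all add: d_z_def d_zbar_def mink_simps algebra_simps)
qed

end

locale surface_patch = chart_patch c W
  for c :: "'m::{t2_space, second_countable_topology} chart" and W +
  fixes A :: "'m chart set" and L :: "'m \<Rightarrow> (real ^ 'n::finite option) set"
    and S :: "'m \<Rightarrow> (complex ^ 'n option) set" and \<sigma> :: "'m \<Rightarrow> real ^ 'n option"
  assumes atlas: "oriented_surface A" and hol: "hol_chart A L c"
    and sigma_smooth: "smooth_map A W \<sigma>" and sigma_lift: "\<And>y. y \<in> W \<Longrightarrow> \<sigma> y \<in> L y \<and> \<sigma> y \<noteq> 0"
    and null_line: "null_line_subbundle A L" and immersed: "immersed A L"
    and csc: "central_sphere_congruence A L S"
begin

definition "s = cplx_vec \<circ> \<sigma>"
definition "z = d_z c s"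
definition "b = d_zbar c s"
definition "e = d_z c b"

lemma c_max_atlas: "c \<in> max_atlas A"
  using hol by (simp add: hol_chart_def)

lemma local_lift: "y \<in> W \<Longrightarrow> local_lift A L y \<sigma>"
  unfolding local_lift_def using openW sigma_smooth sigma_lift by blast

lemma sigma_csmooth: "csmooth c W \<sigma>"
  by (rule smooth_map_csmooth_max_atlas[OF atlas c_max_atlas openW sigma_smooth])

lemma s_smooth: "csmooth c W s"
  unfolding s_def comp_def by (rule csmooth_bounded_linear[OF bounded_linear_cplx_vec chart openW sigma_csmooth])

lemma z_smooth: "csmooth c W z" and b_smooth: "csmooth c W b" and e_smooth: "csmooth c W e"
  unfolding e_def z_def b_def by (intro d_z_smooth s_smooth)+

lemma dd_s: "y \<in> W \<Longrightarrow> dd c h s y = cplx_vec (dd c h \<sigma> y)"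
  unfolding s_def comp_def by (rule dd_bounded_linear[OF bounded_linear_cplx_vec sigma_csmooth _ in_chart])

lemma sigma_null: "y \<in> W \<Longrightarrow> mink (\<sigma> y) (\<sigma> y) = 0"
proof -
  assume y: "y \<in> W"
  from null_line obtain l where "mink l l = 0" "L y = span {l}"
    unfolding null_line_subbundle_def by blast
  then show ?thesis
    using sigma_lift[OF y] by (auto simp: span_singleton scalar_mult_eq_scaleR[symmetric] mink_simps)
qed

lemma L_eq: "y \<in> W \<Longrightarrow> L y = span {\<sigma> y}"
proof -
  assume y: "y \<in> W"
  from null_line obtain l where l: "L y = span {l}"
    unfolding null_line_subbundle_def by blast
  then obtain k where k: "\<sigma> y = k *\<^sub>R l" using sigma_lift[OF y] by (auto simp: span_singleton)
  then have "k \<noteq> 0" using sigma_lift[OF y] by auto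
  then have "j *\<^sub>R l = (j / k) *\<^sub>R (k *\<^sub>R l)" for j by simp
  then have "range (\<lambda>j. j *\<^sub>R l) \<subseteq> range (\<lambda>j. j *\<^sub>R (k *\<^sub>R l))" by (blast intro: range_eqI)
  then show ?thesis unfolding l k span_singleton by auto
qed

text \<open>\<open>immersed\<close> speaks of the charts of \<open>A\<close>; the invertible
  differential of the transition to such a chart carries the condition over to
  \<open>c\<close>.\<close>

lemma dd_sigma_notin:
  assumes "y \<in> W" "h \<noteq> 0"
  shows "dd c h \<sigma> y \<notin> L y"
proof -
  obtain a where a: "a \<in> A" "y \<in> fst a" using atlas_cover[OF atlas] by blast
  have am: "a \<in> max_atlas A" by (rule atlas_subset_max_atlas[OF atlas a(1)])
  let ?D = "\<lambda>h. dd c h (snd a) y"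
  have lin: "linear ?D"
    by (rule dd_linear[OF max_atlas_coord_csmooth[OF atlas c_max_atlas am] a(2) in_chart[OF assms(1)]])
  have "?D h \<noteq> 0"
  proof
    assume "?D h = 0"
    then have 0: "Re h *\<^sub>R ?D 1 + Im h *\<^sub>R ?D \<i> = 0" using linear_complex_expand[OF lin, of h] by simp
    \<comment> \<open>Cramer's rule for the two columns of the differential, whose determinant is
      positive.\<close>
    have "Re h * jac ?D = 0" "Im h * jac ?D = 0"
      using arg_cong[OF 0, of Re] arg_cong[OF 0, of Im] unfolding jac_def by (simp, algebra)+
    then show False
      using max_atlas_jac_pos[OF atlas c_max_atlas am in_chart[OF assms(1)] a(2)] assms(2)
      by (auto simp: complex_eq_iff)
  qed
  moreover have "dd c h \<sigma> y = dd a (?D h) \<sigma> y"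
    by (rule dd_chain_max_atlas[OF atlas c_max_atlas am openW sigma_smooth assms(1) in_chart[OF assms(1)] a(2)])
  ultimately show ?thesis
    using immersed a local_lift[OF assms(1)] unfolding immersed_def by metis
qed

lemma frame_at:
  assumes y: "y \<in> W"
  shows "frame (s y) (z y) (b y) (e y)"
    and "mink (z y) (b y) = of_real (mink (dd c 1 \<sigma> y) (dd c 1 \<sigma> y) / 2)"
proof -
  have ss: "mink (s y) (s y) = 0" if "y \<in> W" for y
    using sigma_null[OF that] by (simp add: s_def mink_cplx_vec)
  have szb: "mink (s y) (z y) = 0" "mink (s y) (b y) = 0" if "y \<in> W" for y
    using d_z_mink_const[OF s_smooth s_smooth that ss] by (simp_all add: z_def b_def mink_commute[of _ "s y"])
  have conf: "mink (dd c 1 \<sigma> y) (dd c 1 \<sigma> y) = mink (dd c \<i> \<sigma> y) (dd c \<i> \<sigma> y)"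
    "mink (dd c 1 \<sigma> y) (dd c \<i> \<sigma> y) = 0"
    using hol in_chart[OF y] local_lift[OF y] unfolding hol_chart_def by blast+
  have zz: "mink (z y) (z y) = 0" "mink (b y) (b y) = 0"
    using conf by (simp_all add: z_def b_def d_z_def d_zbar_def dd_s[OF y] mink_simps mink_cplx_vec mink_commute[of "dd c \<i> \<sigma> y" "dd c 1 \<sigma> y"])
  show zb: "mink (z y) (b y) = of_real (mink (dd c 1 \<sigma> y) (dd c 1 \<sigma> y) / 2)"
    using conf by (simp add: z_def b_def d_z_def d_zbar_def dd_s[OF y] mink_simps mink_cplx_vec mink_commute[of "dd c \<i> \<sigma> y" "dd c 1 \<sigma> y"])
  have "mink (\<sigma> y) (dd c 1 \<sigma> y) = 0"
  proof -
    have "mink (s y) (z y + b y) = 0" using szb[OF y] by (simp add: mink_simps)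
    moreover have "z y + b y = dd c 1 s y" by (simp add: z_def b_def d_z_def d_zbar_def vec_eq_iff algebra_simps)
    moreover have "s y = cplx_vec (\<sigma> y)" by (simp add: s_def)
    ultimately show ?thesis by (simp add: dd_s[OF y] mink_cplx_vec)
  qed
  \<comment> \<open>Otherwise the derivative would be null and orthogonal to \<sigma>, hence a
    multiple of it, against immersedness.\<close>
  then have "mink (dd c 1 \<sigma> y) (dd c 1 \<sigma> y) \<noteq> 0"
    using null_orthogonal_collinear[OF sigma_null[OF y], of "dd c 1 \<sigma> y"] sigma_lift[OF y]
      dd_sigma_notin[OF y, of 1] L_eq[OF y] by (auto simp: span_singleton)
  then have zb0: "mink (z y) (b y) \<noteq> 0" unfolding zb of_real_eq_0_iff by simp
  have "mink (s y) (e y) = - mink (z y) (b y)"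
    using d_z_mink_const(1)[OF s_smooth b_smooth y szb(2)] by (simp add: z_def e_def)
  with ss[OF y] szb[OF y] zz zb0 show "frame (s y) (z y) (b y) (e y)"
    by unfold_locales
qed

lemma S_eq: "y \<in> W \<Longrightarrow> S y = vec.span {s y, z y, b y, e y}"
  using csc[unfolded central_sphere_congruence_def Let_def, rule_format, of c y \<sigma>] hol in_chart[of y] local_lift[of y]
  unfolding s_def z_def b_def e_def by (simp only: simp_thms)

definition "P y = frame_proj (s y) (z y) (b y) (e y)"

lemma P_proj: "y \<in> W \<Longrightarrow> is_proj (S y) (P y)"
  unfolding P_def S_eq by (rule frame.Pr_is_proj[OF frame_at(1)])

lemma polar_smooth: "csmooth c W (\<lambda>y. polar (s y) (z y) (b y) (e y))"
proof -
  have i: "csmooth c W (\<lambda>y. inverse (mink (z y) (b y)))"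
    using csmooth_inverse[OF chart openW smooth_mink[OF z_smooth b_smooth]] frame.zb[OF frame_at(1)] by blast
  have h: "csmooth c W f \<Longrightarrow> csmooth c W (\<lambda>y. f y / 2)" for f :: "'m \<Rightarrow> complex"
    using csmooth_bounded_linear[OF bounded_linear_divide chart openW] .
  show ?thesis
    unfolding polar_def Let_def
    by (intro csmooth_add[OF chart openW] csmooth_diff[OF chart openW] smooth_scale smooth_times h smooth_mink i
        s_smooth z_smooth b_smooth e_smooth)
qed

lemma P_smooth: "csmooth c W P"
proof -
  have i: "csmooth c W (\<lambda>y. inverse (mink (z y) (b y)))"
    using csmooth_inverse[OF chart openW smooth_mink[OF z_smooth b_smooth]] frame.zb[OF frame_at(1)] by blast
  show ?thesis
    unfolding P_def[abs_def] frame_proj_def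
    by (intro csmooth_add[OF chart openW] csmooth_diff[OF chart openW] smooth_cscale2 smooth_outer i polar_smooth
        s_smooth z_smooth b_smooth)
qed

sublocale splitting c W S P
  by unfold_locales (use chart openW W_sub P_smooth P_proj in auto)

lemma P_frame: "y \<in> W \<Longrightarrow> P y *v s y = s y" "y \<in> W \<Longrightarrow> P y *v z y = z y"
  "y \<in> W \<Longrightarrow> P y *v b y = b y" "y \<in> W \<Longrightarrow> P y *v e y = e y"
  unfolding P_def using frame.Pr_frame[OF frame_at(1)] by auto

end


section \<open>Closed forms with values in the wedge product are coclosed\<close>

lemma skew_bracket: "skew X \<Longrightarrow> skew Y \<Longrightarrow> skew (lie_bracket X Y)"
  unfolding skew_def lie_bracket_def
  by (simp add: matrix_vector_mult_diff_rdistrib matrix_vector_mul_assoc[symmetric] mink_simps)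

lemma skew_diff: "skew X \<Longrightarrow> skew Y \<Longrightarrow> skew (X - Y)"
  and skew_add: "skew X \<Longrightarrow> skew Y \<Longrightarrow> skew (X + Y)"
  and skew_cscale: "skew X \<Longrightarrow> skew (cscale k X)"
  unfolding skew_def
  by (simp_all add: matrix_vector_mult_diff_rdistrib matrix_vector_mult_add_rdistrib cscale_vec mink_simps)

context splitting
begin

lemma D_endo_cscale:
  assumes "csmooth c W B" "x \<in> W"
  shows "D_endo S c h (\<lambda>y. cscale k (B y)) x = cscale k (D_endo S c h B x)"
  unfolding D_endo_eq[OF smooth_cscale[OF assms(1)] assms(2)] D_endo_eq[OF assms] d_cscale[OF assms assms(2)]
  by (simp add: lie_bracket_def vec_eq_iff matrix_ring_simps) (simp add: algebra_simps)

lemma D_endo_add: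
  assumes "csmooth c W B" "csmooth c W B'" "x \<in> W"
  shows "D_endo S c h (\<lambda>y. B y + B' y) x = D_endo S c h B x + D_endo S c h B' x"
  using D_endo_linear_combination[OF assms, of h 1 1] by simp

lemmas smooth_mink = csmooth_bilinear[OF bounded_bilinear_mink chart openW]
lemmas d_mink = dd_bilinear[OF bounded_bilinear_mink chart _ _ _ in_chart]

lemma skew_N_form:
  assumes "x \<in> W"
  shows "skew (N_form S c x h)"
proof -
  have sym: "mink (P y *v v) w = mink v (P y *v w)" if "y \<in> W" for y v w
    using P_proj[OF that] unfolding is_proj_def by blast
  have dsym: "mink (dd c h P x *v v) w = mink v (dd c h P x *v w)" for v w
  proof -
    have c: "csmooth c W (\<lambda>y. P y *v v)" for v by (intro smooth_intros)
    have "dd c h (\<lambda>y. mink (P y *v v) w) x = dd c h (\<lambda>y. mink v (P y *v w)) x"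
      by (rule d_cong[OF assms assms smooth_mink[OF c csmooth_const]]) (rule sym)
    then show ?thesis
      by (simp add: d_mink[OF c csmooth_const assms assms] d_mink[OF csmooth_const c assms assms]
          d_mult_vec[OF P_smooth csmooth_const assms assms])
  qed
  show ?thesis
    unfolding N_form_eq[OF assms] lie_bracket_def skew_def
    by (simp add: matrix_vector_mult_diff_rdistrib matrix_vector_mul_assoc[symmetric] mink_simps sym[OF assms] dsym)
qed

lemma skew_D_endo:
  assumes "csmooth c W B" "\<And>y. y \<in> W \<Longrightarrow> skew (B y)" "x \<in> W"
  shows "skew (D_endo S c h B x)"
proof -
  have c: "csmooth c W (\<lambda>y. B y *v v)" for v by (intro smooth_intros assms)
  have "mink (dd c h B x *v v) w = - mink v (dd c h B x *v w)" for v w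
  proof -
    have "dd c h (\<lambda>y. mink (B y *v v) w) x = dd c h (\<lambda>y. - mink v (B y *v w)) x"
      by (rule d_cong[OF assms(3,3) smooth_mink[OF c csmooth_const]]) (use assms(2) in \<open>simp add: skew_def\<close>)
    then show ?thesis
      by (simp add: d_minus[OF smooth_mink[OF csmooth_const c] assms(3,3)] d_mink[OF c csmooth_const assms(3,3)]
          d_mink[OF csmooth_const c assms(3,3)] d_mult_vec[OF assms(1) csmooth_const assms(3,3)])
  qed
  then have "skew (dd c h B x)" by (simp add: skew_def)
  then show ?thesis
    unfolding D_endo_eq[OF assms(1,3)] using skew_N_form assms(2,3) by (intro skew_diff skew_bracket)
qed

lemma D_conn_section:
  assumes "csmooth c W \<xi>" "x \<in> W" "\<And>y. y \<in> W \<Longrightarrow> P y *v \<xi> y = \<xi> y"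
  shows "D_conn S c h \<xi> x = P x *v dd c h \<xi> x"
proof -
  have "dd c h (\<lambda>y. orth_proj (S y) *v \<xi> y) x = dd c h \<xi> x"
    by (rule d_cong[OF assms(2,2,1), symmetric]) (simp add: orth_proj_eq[OF P_proj] assms(3))
  moreover have "dd c h (\<lambda>y. orth_proj (perp (S y)) *v \<xi> y) x = 0"
    using d_cong[OF assms(2,2) csmooth_const, of 0 "\<lambda>y. orth_proj (perp (S y)) *v \<xi> y" h]
    by (simp add: orth_proj_perp[OF P_proj] assms(3) matrix_vector_mult_diff_rdistrib)
  ultimately show ?thesis
    by (simp add: D_conn_def orth_proj_eq[OF P_proj[OF assms(2)]])
qed

lemma D_conn_perp_section:
  assumes "csmooth c W \<xi>" "x \<in> W" "\<And>y. y \<in> W \<Longrightarrow> P y *v \<xi> y = 0"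
  shows "D_conn S c h \<xi> x = (mat 1 - P x) *v dd c h \<xi> x"
proof -
  have "dd c h (\<lambda>y. orth_proj (perp (S y)) *v \<xi> y) x = dd c h \<xi> x"
    by (rule d_cong[OF assms(2,2,1), symmetric])
       (simp add: orth_proj_perp[OF P_proj] assms(3) matrix_vector_mult_diff_rdistrib)
  moreover have "dd c h (\<lambda>y. orth_proj (S y) *v \<xi> y) x = 0"
    using d_cong[OF assms(2,2) csmooth_const, of 0 "\<lambda>y. orth_proj (S y) *v \<xi> y" h]
    by (simp add: orth_proj_eq[OF P_proj] assms(3))
  ultimately show ?thesis
    by (simp add: D_conn_def orth_proj_perp[OF P_proj[OF assms(2)]])
qed

text \<open>Covariant derivatives along the complex fields d/dz and d/dzbar, obtained from the
  directions 1 and \<i> by complex linearity.\<close>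

definition "Dz B x = cscale (1 / 2) (D_endo S c 1 B x - cscale \<i> (D_endo S c \<i> B x))"
definition "Db B x = cscale (1 / 2) (D_endo S c 1 B x + cscale \<i> (D_endo S c \<i> B x))"

lemma skew_Dz_Db:
  assumes "csmooth c W B" "\<And>y. y \<in> W \<Longrightarrow> skew (B y)" "x \<in> W"
  shows "skew (Dz B x)" "skew (Db B x)"
  unfolding Dz_def Db_def by (auto intro!: skew_cscale skew_add skew_diff skew_D_endo assms)

lemma Dz_Db_vec_section:
  assumes "csmooth c W B" "csmooth c W \<xi>" "x \<in> W" "\<And>y. y \<in> W \<Longrightarrow> P y *v \<xi> y = \<xi> y"
    "\<And>y. y \<in> W \<Longrightarrow> P y *v (B y *v \<xi> y) = B y *v \<xi> y"
  shows "Dz B x *v \<xi> x = P x *v d_z c (\<lambda>y. B y *v \<xi> y) x - B x *v (P x *v d_z c \<xi> x)"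
    "Db B x *v \<xi> x = P x *v d_zbar c (\<lambda>y. B y *v \<xi> y) x - B x *v (P x *v d_zbar c \<xi> x)"
proof -
  have "D_endo S c h B x *v \<xi> x = P x *v dd c h (\<lambda>y. B y *v \<xi> y) x - B x *v (P x *v dd c h \<xi> x)" for h
  proof -
    have "D_conn S c h \<xi> x = P x *v dd c h \<xi> x"
      by (rule D_conn_section[OF assms(2,3)]) (rule assms(4))
    moreover have "D_conn S c h (\<lambda>y. B y *v \<xi> y) x = P x *v dd c h (\<lambda>y. B y *v \<xi> y) x"
      by (rule D_conn_section[OF smooth_mult_vec[OF assms(1,2)] assms(3)]) (rule assms(5))
    ultimately show ?thesis unfolding D_endo_vec[OF assms(1-3)] by simp
  qed
  then show "Dz B x *v \<xi> x = P x *v d_z c (\<lambda>y. B y *v \<xi> y) x - B x *v (P x *v d_z c \<xi> x)"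
    "Db B x *v \<xi> x = P x *v d_zbar c (\<lambda>y. B y *v \<xi> y) x - B x *v (P x *v d_zbar c \<xi> x)"
    by (simp_all add: Dz_def Db_def d_z_def d_zbar_def cscale_vec matrix_vector_mult_diff_rdistrib
        matrix_vector_mult_add_rdistrib matrix_vector_mult_diff_distrib matrix_vector_right_distrib matrix_vec_scale)
qed

text \<open>D preserves sections of the complement of S, so if B kills the complement then its
  derivative does so too.\<close>

lemma Dz_Db_perp:
  assumes "csmooth c W B" "\<And>y w. y \<in> W \<Longrightarrow> B y *v (w - P y *v w) = 0" "x \<in> W"
  shows "Dz B x *v (u - P x *v u) = 0" "Db B x *v (u - P x *v u) = 0"
proof -
  define \<xi> where "\<xi> y = u - P y *v u" for y
  have s: "csmooth c W \<xi>" unfolding \<xi>_def by (intro smooth_intros)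
  have P0: "P y *v \<xi> y = 0" if "y \<in> W" for y
    using P_idem[OF that] by (simp add: \<xi>_def matrix_vector_mult_diff_distrib matrix_vector_mul_assoc)
  have "D_conn S c h (\<lambda>y. B y *v \<xi> y) x = 0" for h
  proof -
    have Bs: "csmooth c W (\<lambda>y. B y *v \<xi> y)" by (intro smooth_intros assms s)
    have B0: "B y *v \<xi> y = 0" if "y \<in> W" for y using assms(2)[OF that] by (simp add: \<xi>_def)
    have "D_conn S c h (\<lambda>y. B y *v \<xi> y) x = P x *v dd c h (\<lambda>y. B y *v \<xi> y) x"
      by (rule D_conn_section[OF Bs assms(3)]) (simp add: B0)
    moreover have "dd c h (\<lambda>y. B y *v \<xi> y) x = dd c h (\<lambda>_. 0) x"
      by (rule d_cong[OF assms(3,3) Bs B0])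
    ultimately show ?thesis by simp
  qed
  moreover have "B x *v D_conn S c h \<xi> x = 0" for h
  proof -
    have "D_conn S c h \<xi> x = (mat 1 - P x) *v dd c h \<xi> x"
      by (rule D_conn_perp_section[OF s assms(3)]) (rule P0)
    then show ?thesis
      using assms(2)[OF assms(3), of "dd c h \<xi> x"] by (simp add: matrix_vector_mult_diff_rdistrib)
  qed
  ultimately have "D_endo S c h B x *v \<xi> x = 0" for h
    unfolding D_endo_vec[OF assms(1) s assms(3)] by simp
  then show "Dz B x *v (u - P x *v u) = 0" "Db B x *v (u - P x *v u) = 0"
    by (simp_all add: Dz_def Db_def cscale_vec matrix_vector_mult_diff_rdistrib matrix_vector_mult_add_rdistrib \<xi>_def[symmetric])
qed

end

section \<open>Skew endomorphisms and wedges evaluated on the frame\<close>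

context frame
begin

text \<open>Only the \<open>e\<close>-component of a vector is seen, so every \<open>F u\<close> is
  a multiple of \<open>F e\<close>. Skewness gives (F e, e) = 0, and then (F e, v) = - (e, F v)
  vanishes for all v.\<close>

lemma skew_eq_0:
  assumes F: "skew F" "F *v s = 0" "F *v z = 0" "F *v b = 0" "\<And>u. F *v (u - Pr *v u) = 0"
  shows "F = 0"
proof -
  obtain p q r where t: "t = e + p *s b + q *s z + r *s s" using t_expand by blast
  have Fu: "F *v u = (- inverse g * mink u s) *s (F *v e)" for u
  proof -
    have "F *v u = F *v (Pr *v u)"
      using F(5)[of u] by (simp add: matrix_vector_mult_diff_distrib)
    also have "\<dots> = (- inverse g * mink u s) *s (F *v t)"
      unfolding Pr_vec matrix_vec_scale matrix_vector_mult_diff_distrib matrix_vector_right_distrib F(2-4)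
      by (simp add: vec_eq_iff)
    finally show ?thesis
      by (simp add: t matrix_vector_right_distrib matrix_vec_scale F(2-4))
  qed
  have "mink (F *v e) e = 0"
  proof -
    have "mink (F *v e) e = - mink e (F *v e)" using F(1) by (simp add: skew_def)
    then show ?thesis by (simp add: mink_commute)
  qed
  then have "mink (F *v e) v = 0" for v
  proof -
    have "mink (F *v e) v = - mink e (F *v v)" using F(1) by (simp add: skew_def)
    also have "\<dots> = inverse g * mink v s * mink (F *v e) e"
      by (subst Fu) (simp add: mink_simps mink_commute[of e "F *v e"])
    finally show ?thesis using \<open>mink (F *v e) e = 0\<close> by simp
  qed
  then have "F *v e = 0" by (rule mink_nondegenerate)
  with Fu show ?thesis by (intro matrix_eqI) simp
qed

text \<open>For the last two clauses: a zero product with z removes the b-component of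
  \<open>a\<close>, and conversely, so that the wedge reduces to a multiple of s \<and> z,
  respectively of s \<and> b.\<close>

lemma wedge_frame:
  assumes "a \<in> vec.span {s, z, b}"
  shows "wedge s a *v s = 0" "wedge s a *v z = (- mink z a) *s s" "wedge s a *v b = (- mink b a) *s s"
    "wedge s a *v (u - Pr *v u) = 0" "Pr *v (wedge s a *v u) = wedge s a *v u" "mink s a = 0"
    "mink z a = 0 \<Longrightarrow> mink u s = 0 \<Longrightarrow> mink u z = 0 \<Longrightarrow> wedge s a *v u = 0"
    "mink b a = 0 \<Longrightarrow> mink u s = 0 \<Longrightarrow> mink u b = 0 \<Longrightarrow> wedge s a *v u = 0"
proof -
  have "\<exists>p q r. a = p *s s + q *s z + r *s b"
    using assms by (auto simp: vec.span_insert vec.span_empty algebra_simps)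
  then obtain p q r where a: "a = p *s s + q *s z + r *s b" by blast
  show sa: "mink s a = 0" unfolding a by (simp add: mink_simps gram_table)
  then show "wedge s a *v s = 0" "wedge s a *v z = (- mink z a) *s s" "wedge s a *v b = (- mink b a) *s s"
    by (simp_all add: wedge_vec gram_table vec_eq_iff)
  have Pa: "Pr *v a = a"
    unfolding a by (simp only: matrix_vector_right_distrib matrix_vec_scale Pr_frame)
  have "mink (u - Pr *v u) v = mink u (v - Pr *v v)" for v
    using Pr_sym by (simp add: mink_simps)
  then show "wedge s a *v (u - Pr *v u) = 0"
    by (simp add: wedge_vec Pa Pr_frame)
  show "Pr *v (wedge s a *v u) = wedge s a *v u"
    by (simp add: wedge_vec matrix_vector_mult_diff_distrib matrix_vec_scale Pa Pr_frame)
  show "wedge s a *v u = 0" if "mink z a = 0" "mink u s = 0" "mink u z = 0"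
  proof -
    have "r = 0" using that(1) zb by (simp add: a mink_simps gram_table)
    then have "mink u a = 0" using that by (simp add: a mink_simps)
    with that show ?thesis by (simp add: wedge_vec)
  qed
  show "wedge s a *v u = 0" if "mink b a = 0" "mink u s = 0" "mink u b = 0"
  proof -
    have "q = 0" using that(1) zb by (simp add: a mink_simps gram_table)
    then have "mink u a = 0" using that by (simp add: a mink_simps)
    with that show ?thesis by (simp add: wedge_vec)
  qed
qed

end

context surface_patch
begin

lemma d_bz: "y \<in> W \<Longrightarrow> d_zbar c z y = e y"
  using d_z_commute[OF s_smooth] by (simp add: e_def z_def b_def)

text \<open>
  \<open>Bz\<close> and \<open>Bb\<close> stand for the \<open>dz\<close> and the \<open>dzbar\<close> coefficient of a form with values in
  \<open>L \<and> L\<^sup>(\<^sup>1\<^sup>)\<close>. Closedness is the equality of the mixed derivatives; pairing it with the frame shows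
  that \<open>Bz\<close> is a multiple of \<open>s \<and> b\<close> and \<open>Bb\<close> one of \<open>s \<and> z\<close>, so that the common value of the
  mixed derivatives kills three of the four frame vectors, hence vanishes, being skew.
\<close>

lemma mixed_derivatives_vanish:
  assumes smooth: "csmooth c W Bz" "csmooth c W Bb"
    and Bz: "\<And>y. y \<in> W \<Longrightarrow> \<exists>a\<in>vec.span {s y, z y, b y}. Bz y = wedge (s y) a"
    and Bb: "\<And>y. y \<in> W \<Longrightarrow> \<exists>a\<in>vec.span {s y, z y, b y}. Bb y = wedge (s y) a"
    and closed: "\<And>y. y \<in> W \<Longrightarrow> Dz Bb y = Db Bz y"
    and x: "x \<in> W"
  shows "Dz Bb x = 0"
proof -
  note fr = frame.wedge_frame[OF frame_at(1)]
  note P = P_def[symmetric]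
  have B: "B y *v s y = 0" "\<exists>k. B y *v z y = k *s s y" "\<exists>k. B y *v b y = k *s s y"
    "B y *v (u - P y *v u) = 0" "P y *v (B y *v u) = B y *v u" "skew (B y)"
    if BB: "B = Bz \<or> B = Bb" and y: "y \<in> W" for B y u
  proof -
    obtain a where a: "a\<in>vec.span {s y, z y, b y}" "B y = wedge (s y) a"
      using Bz[OF y] Bb[OF y] BB by auto
    show "B y *v s y = 0" "\<exists>k. B y *v z y = k *s s y" "\<exists>k. B y *v b y = k *s s y"
      "B y *v (u - P y *v u) = 0" "P y *v (B y *v u) = B y *v u" "skew (B y)"
      unfolding a(2) using fr(1,4,5)[OF y a(1)] fr(2)[OF y a(1)] fr(3)[OF y a(1)]
      by (simp_all only: P skew_wedge) (rule exI refl)+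
  qed
  have Bz_s: "Bz y *v s y = 0" and Bb_s: "Bb y *v s y = 0" if "y \<in> W" for y using B(1) that by auto
  have PBz: "P y *v (Bz y *v u) = Bz y *v u" and PBb: "P y *v (Bb y *v u) = Bb y *v u" if "y \<in> W" for y u
    using B(5) that by auto
  have Psym: "mink (P y *v v) w = mink v (P y *v w)" if "y \<in> W" for y v w
    using P_proj[OF that] unfolding is_proj_def by blast
  have d0: "d_z c f y = 0" "d_zbar c f y = 0" if "y \<in> W" "\<And>y. y \<in> W \<Longrightarrow> f y = 0" for f :: "'m \<Rightarrow> complex^'n option" and y
  proof -
    have "dd c h f y = 0" for h
      using d_cong[OF that(1,1) csmooth_const, of 0 f h] that(2) by simp
    then show "d_z c f y = 0" "d_zbar c f y = 0" by (simp_all add: d_z_def d_zbar_def)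
  qed
  have gram: "mink (s y) (s y) = 0" "mink (s y) (z y) = 0" "mink (z y) (s y) = 0" "mink (s y) (b y) = 0" "mink (b y) (s y) = 0"
    "mink (z y) (z y) = 0" "mink (b y) (b y) = 0" "mink (s y) (e y) = - mink (z y) (b y)" "mink (z y) (b y) \<noteq> 0"
    if "y \<in> W" for y
    using frame.gram_table[OF frame_at(1)[OF that]] frame.zb[OF frame_at(1)[OF that]] by auto
  \<comment> \<open>Evaluated on s, closedness says that Bb z = Bz b, a multiple \<open>k\<close> of
    s. Evaluated on z and paired with b, it equates the product of this vector with e to its own
    negative, so that k = 0.\<close>
  have key: "Bb y *v z y = 0" "Bz y *v b y = 0" if y: "y \<in> W" for y
  proof -
    have "Dz Bb y *v s y = - (Bb y *v z y)"
      using Dz_Db_vec_section(1)[OF smooth(2) s_smooth y P_frame(1)] Bb_s d0(1)[OF y Bb_s]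
      by (simp add: z_def[symmetric] P_frame[OF y])
    moreover have "Db Bz y *v s y = - (Bz y *v b y)"
      using Dz_Db_vec_section(2)[OF smooth(1) s_smooth y P_frame(1)] Bz_s d0(2)[OF y Bz_s]
      by (simp add: b_def[symmetric] P_frame[OF y])
    ultimately have eq: "Bb y *v z y = Bz y *v b y" using closed[OF y] by simp
    obtain k where k: "Bb y *v z y = k *s s y" using B(2) y by blast
    have Bbz: "csmooth c W (\<lambda>y. Bb y *v z y)" and Bzz: "csmooth c W (\<lambda>y. Bz y *v z y)"
      by (intro smooth_mult_vec smooth z_smooth)+
    have "mink (Dz Bb y *v z y) (b y) = mink (d_z c (\<lambda>y. Bb y *v z y) y) (b y) - mink (Bb y *v (P y *v d_z c z y)) (b y)"
      using Dz_Db_vec_section(1)[OF smooth(2) z_smooth y P_frame(2) PBb]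
      by (simp add: mink_simps Psym[OF y] P_frame[OF y])
    also have "mink (d_z c (\<lambda>y. Bb y *v z y) y) (b y) = - mink (Bb y *v z y) (e y)"
    proof -
      have "mink (Bb y *v z y) (b y) = 0" if "y \<in> W" for y
        using B(2)[of Bb y] gram[OF that] that by (auto simp: mink_simps)
      from d_z_mink_const(1)[OF Bbz b_smooth y this] show ?thesis by (simp add: e_def)
    qed
    also have "mink (Bb y *v (P y *v d_z c z y)) (b y) = 0"
    proof -
      have "mink (d_z c z y) (s y) = 0"
        using d_z_mink_const(1)[OF z_smooth s_smooth y gram(3)] gram[OF y] by (simp add: z_def)
      then have "mink (P y *v d_z c z y) (s y) = 0" by (simp add: Psym[OF y] P_frame[OF y])
      moreover obtain j where "Bb y *v b y = j *s s y" using B(3) y by blast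
      moreover have "mink (Bb y *v (P y *v d_z c z y)) (b y) = - mink (P y *v d_z c z y) (Bb y *v b y)"
        using B(6)[of Bb y] y by (simp add: skew_def)
      ultimately show ?thesis by (simp add: mink_simps)
    qed
    finally have 1: "mink (Dz Bb y *v z y) (b y) = - mink (Bb y *v z y) (e y)" by simp
    have "mink (Db Bz y *v z y) (b y) = mink (d_zbar c (\<lambda>y. Bz y *v z y) y) (b y) - mink (Bz y *v (P y *v d_zbar c z y)) (b y)"
      using Dz_Db_vec_section(2)[OF smooth(1) z_smooth y P_frame(2) PBz]
      by (simp add: mink_simps Psym[OF y] P_frame[OF y])
    also have "mink (d_zbar c (\<lambda>y. Bz y *v z y) y) (b y) = 0"
    proof -
      have "mink (Bz y *v z y) (b y) = 0" if "y \<in> W" for y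
        using B(2)[of Bz y] gram[OF that] that by (auto simp: mink_simps)
      from d_z_mink_const(2)[OF Bzz b_smooth y this]
      have "mink (d_zbar c (\<lambda>y. Bz y *v z y) y) (b y) = - mink (Bz y *v z y) (d_zbar c b y)" .
      moreover have "mink (s y) (d_zbar c b y) = 0"
        using d_z_mink_const(2)[OF s_smooth b_smooth y gram(4)] gram[OF y] by (simp add: b_def)
      ultimately show ?thesis using B(2)[of Bz y] y by (auto simp: mink_simps)
    qed
    also have "mink (Bz y *v (P y *v d_zbar c z y)) (b y) = - mink (e y) (Bz y *v b y)"
      using B(6)[of Bz y] y by (simp add: skew_def d_bz P_frame)
    finally have 2: "mink (Db Bz y *v z y) (b y) = mink (e y) (Bz y *v b y)" by simp
    have "k * mink (z y) (b y) = 0"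
      using 1 2 closed[OF y] gram[OF y] by (simp add: eq[symmetric] k mink_simps mink_commute[of "e y" "s y"])
    then have "k = 0" using gram(9)[OF y] by simp
    then show "Bb y *v z y = 0" "Bz y *v b y = 0" using eq k by simp_all
  qed
  obtain a where a: "a\<in>vec.span {s x, z x, b x}" "Bb x = wedge (s x) a" using Bb[OF x] by auto
  obtain a' where a': "a'\<in>vec.span {s x, z x, b x}" "Bz x = wedge (s x) a'" using Bz[OF x] by auto
  have s0: "s x \<noteq> 0" using gram(8,9)[OF x] by auto
  have za: "mink (z x) a = 0" using key(1)[OF x] fr(2)[OF x a(1)] s0 by (simp add: a(2))
  have ba': "mink (b x) a' = 0" using key(2)[OF x] fr(3)[OF x a'(1)] s0 by (simp add: a'(2))
  have Xs: "Dz Bb x *v s x = 0"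
    using Dz_Db_vec_section(1)[OF smooth(2) s_smooth x P_frame(1)] Bb_s d0(1)[OF x Bb_s]
    by (simp add: z_def[symmetric] P_frame[OF x] key(1)[OF x])
  have Xz: "Dz Bb x *v z x = 0"
  proof -
    have "mink (d_z c z x) (s x) = 0"
      using d_z_mink_const(1)[OF z_smooth s_smooth x gram(3)] gram[OF x] by (simp add: z_def)
    moreover have "mink (d_z c z x) (z x) = 0"
      using d_z_mink_const(1)[OF z_smooth z_smooth x gram(6)] by (simp add: mink_commute[of _ "z x"])
    ultimately have "mink (P x *v d_z c z x) (s x) = 0" "mink (P x *v d_z c z x) (z x) = 0"
      by (simp_all add: Psym[OF x] P_frame[OF x])
    \<comment> \<open>By \<open>za\<close> the form is a multiple of s \<and> z here, and the vector
      it meets is orthogonal to both s and z.\<close>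
    then have "Bb x *v (P x *v d_z c z x) = 0" unfolding a(2) by (rule fr(7)[OF x a(1) za])
    then show ?thesis
      using Dz_Db_vec_section(1)[OF smooth(2) z_smooth x P_frame(2) PBb] d0(1)[OF x key(1)] by simp
  qed
  \<comment> \<open>For b it is the other side of the closedness equation that is computed, since
    \<open>Bz\<close> is the coefficient that kills b.\<close>
  have Xb: "Db Bz x *v b x = 0"
  proof -
    have "mink (d_zbar c b x) (s x) = 0"
      using d_z_mink_const(2)[OF b_smooth s_smooth x gram(5)] gram[OF x] by (simp add: b_def)
    moreover have "mink (d_zbar c b x) (b x) = 0"
      using d_z_mink_const(2)[OF b_smooth b_smooth x gram(7)] by (simp add: mink_commute[of _ "b x"])
    ultimately have "mink (P x *v d_zbar c b x) (s x) = 0" "mink (P x *v d_zbar c b x) (b x) = 0"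
      by (simp_all add: Psym[OF x] P_frame[OF x])
    then have "Bz x *v (P x *v d_zbar c b x) = 0" unfolding a'(2) by (rule fr(8)[OF x a'(1) ba'])
    then show ?thesis
      using Dz_Db_vec_section(2)[OF smooth(1) b_smooth x P_frame(3) PBz] d0(2)[OF x key(2)] by simp
  qed
  have Xp: "Dz Bb x *v (u - P x *v u) = 0" for u
    using Dz_Db_perp(1)[OF smooth(2) _ x] B(4) by blast
  show ?thesis
  proof (rule frame.skew_eq_0[OF frame_at(1)[OF x]])
    show "skew (Dz Bb x)" by (rule skew_Dz_Db[OF smooth(2) _ x]) (use B(6) in blast)
  qed (use Xs Xz Xb Xp closed[OF x] in \<open>auto simp: P\<close>)
qed

lemma part_L_wedge_L1:
  assumes "in_L_wedge_L1 A L q" "y \<in> W"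
  shows "\<exists>a\<in>vec.span {s y, z y, b y}. cscale k (q c y h) + cscale j (q c y h') = wedge (s y) a"
proof -
  have "\<exists>a\<in>vec.span {s y, z y, b y}. q c y h = wedge (s y) a" for h
    using assms(1)[unfolded in_L_wedge_L1_def Let_def, rule_format, of c y \<sigma> h] hol in_chart[of y] local_lift[of y] assms(2)
    unfolding s_def z_def b_def by (simp only: simp_thms)
  then obtain a a' where a: "a\<in>vec.span {s y, z y, b y}" "a'\<in>vec.span {s y, z y, b y}"
    "q c y h = wedge (s y) a" "q c y h' = wedge (s y) a'" by meson
  then have "cscale k (q c y h) + cscale j (q c y h') = wedge (s y) (k *s a + j *s a')"
    by (simp add: wedge_add_right wedge_scale_right)
  moreover have "k *s a + j *s a' \<in> vec.span {s y, z y, b y}"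
    using a by (intro vec.span_add vec.span_scale)
  ultimately show ?thesis by blast
qed

text \<open>For a closed q the mixed derivative \<open>Dz Bb\<close> is a quarter of the divergence
  \<open>F\<close>. This \<open>F\<close> is the value of d^D *q on the directions 1 and \<i>, which
  determines the 2-form.\<close>

lemma coclosed:
  assumes q: "in_L_wedge_L1 A L q" and smooth: "\<And>h. csmooth c W (\<lambda>y. q c y h)"
    and lin: "\<And>y. y \<in> W \<Longrightarrow> linear (q c y)"
    and closed: "\<And>y h k. y \<in> W \<Longrightarrow> ext_D S q c y h k = 0"
    and x: "x \<in> W"
  shows "ext_D S (hodge q) c x h k = 0"
proof -
  \<comment> \<open>\<open>Bz\<close> and \<open>Bb\<close> are the values of q on d/dz and
    d/dzbar.\<close>
  define Bz where "Bz y = cscale (1 / 2) (q c y 1) + cscale (- \<i> / 2) (q c y \<i>)" for y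
  define Bb where "Bb y = cscale (1 / 2) (q c y 1) + cscale (\<i> / 2) (q c y \<i>)" for y
  have D: "D_endo S c h Bz y = cscale (1 / 2) (D_endo S c h (\<lambda>y. q c y 1) y) + cscale (- \<i> / 2) (D_endo S c h (\<lambda>y. q c y \<i>) y)"
    "D_endo S c h Bb y = cscale (1 / 2) (D_endo S c h (\<lambda>y. q c y 1) y) + cscale (\<i> / 2) (D_endo S c h (\<lambda>y. q c y \<i>) y)"
    if "y \<in> W" for y h
    unfolding Bz_def[abs_def] Bb_def[abs_def]
      D_endo_add[OF smooth_cscale[OF smooth] smooth_cscale[OF smooth] that] D_endo_cscale[OF smooth that]
    by rule+
  define F where "F y = D_endo S c 1 (\<lambda>y. q c y 1) y + D_endo S c \<i> (\<lambda>y. q c y \<i>) y" for y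
  have "D_endo S c 1 (\<lambda>y. q c y \<i>) y = D_endo S c \<i> (\<lambda>y. q c y 1) y" if "y \<in> W" for y
    using closed[OF that, of 1 \<i>] by (simp add: ext_D_def)
  then have DD: "Dz Bb y = cscale (1 / 4) (F y)" "Db Bz y = cscale (1 / 4) (F y)" if "y \<in> W" for y
    using that unfolding Dz_def Db_def D[OF that] F_def by (simp_all add: vec_eq_iff field_simps)
  have "Dz Bb x = 0"
  proof (rule mixed_derivatives_vanish[OF _ _ _ _ _ x])
    show "csmooth c W Bz" "csmooth c W Bb"
      unfolding Bz_def[abs_def] Bb_def[abs_def] by (intro smooth_add smooth_cscale smooth)+
  qed (use DD part_L_wedge_L1[OF q] in \<open>auto simp: Bz_def Bb_def\<close>)
  then have F0: "F x = 0" using DD(1)[OF x] by (simp add: vec_eq_iff)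
  have hq: "D_endo S c h (\<lambda>y. hodge q c y k) x =
      Im k *\<^sub>R D_endo S c h (\<lambda>y. q c y 1) x - Re k *\<^sub>R D_endo S c h (\<lambda>y. q c y \<i>) x" for h k
  proof -
    have "D_endo S c h (\<lambda>y. Im k *\<^sub>R q c y 1 + (- Re k) *\<^sub>R q c y \<i>) x = D_endo S c h (\<lambda>y. hodge q c y k) x"
    proof (rule D_endo_cong[OF smooth_add[OF smooth_scaleR[OF smooth] smooth_scaleR[OF smooth]] _ x])
      show "Im k *\<^sub>R q c y 1 + (- Re k) *\<^sub>R q c y \<i> = hodge q c y k" if "y \<in> W" for y
        using linear_complex_expand[OF lin[OF that], of "\<i> * k"] by (simp add: hodge_eq)
    qed
    then show ?thesis using D_endo_linear_combination[OF smooth smooth x, of h "Im k" 1 "- Re k" \<i>] by simp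
  qed
  have e: "D_endo S c h (\<lambda>y. q c y k) x = Re h *\<^sub>R D_endo S c 1 (\<lambda>y. q c y k) x + Im h *\<^sub>R D_endo S c \<i> (\<lambda>y. q c y k) x" for h k
    by (rule linear_complex_expand[OF D_endo_linear[OF smooth x]])
  have "D_endo S c \<i> (\<lambda>y. q c y \<i>) x = - D_endo S c 1 (\<lambda>y. q c y 1) x"
    using F0 by (simp add: F_def eq_neg_iff_add_eq_0 add.commute)
  then show ?thesis
    unfolding ext_D_def hq e[of h] e[of k] by (simp add: algebra_simps)
qed

end


section \<open>The spectral deformation near a point\<close>

lemma cspan_image:
  fixes F :: "complex^'k::finite^'k"
  shows "(\<lambda>w. F *v w) ` vec.span T = vec.span ((\<lambda>w. F *v w) ` T)"
  by (rule vec.span_image[symmetric])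

text \<open>On isometries inversion is the restriction of this linear map, so the inverse gauge
  inherits smoothness from the gauge.\<close>

lemma transpose_bounded_linear:
  "bounded_linear (\<lambda>M :: 'a::{field,real_algebra_1,euclidean_space}^'n::finite option^'n option. gram ** transpose M ** gram)"
  unfolding linear_conv_bounded_linear[symmetric]
proof (rule linearI)
  have t: "transpose (M + N) = transpose M + transpose N" "transpose (r *\<^sub>R M) = r *\<^sub>R transpose M"
    for M N :: "'a^'n option^'n option" and r
    by (simp_all add: transpose_def vec_eq_iff)
  show "gram ** transpose (M + N) ** gram = gram ** transpose M ** gram + gram ** transpose N ** gram"
    "gram ** transpose (r *\<^sub>R M) ** gram = r *\<^sub>R (gram ** transpose M ** gram)"
    for M N :: "'a^'n option^'n option" and r
    unfolding t by (simp_all add: matrix_add_left matrix_add_ldistrib matrix_scaleR_left matrix_scaleR_right)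
qed

lemma smooth_map_bounded_linear:
  assumes "oriented_surface A" "open W" "bounded_linear T" "smooth_map A W f"
  shows "smooth_map A W (\<lambda>x. T (f x))"
  unfolding smooth_map_csmooth
proof
  fix a assume a: "a \<in> A"
  have "is_chart a" using a atlas_subset_max_atlas[OF assms(1)] max_atlas_is_chart by blast
  then show "csmooth a W (\<lambda>x. T (f x))"
    using assms(4) a unfolding smooth_map_csmooth by (intro csmooth_bounded_linear[OF assms(3) _ assms(2)]) blast+
qed

lemma smooth_map_bilinear:
  assumes "oriented_surface A" "open W" "bounded_bilinear B" "smooth_map A W f" "smooth_map A W g"
  shows "smooth_map A W (\<lambda>x. B (f x) (g x))"
  unfolding smooth_map_csmooth
proof
  fix a assume a: "a \<in> A"
  have "is_chart a" using a atlas_subset_max_atlas[OF assms(1)] max_atlas_is_chart by blast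
  then show "csmooth a W (\<lambda>x. B (f x) (g x))"
    using assms(4,5) a unfolding smooth_map_csmooth by (intro csmooth_bilinear[OF assms(3) _ assms(2)]) blast+
qed

lemma smooth_map_subset: "smooth_map A W f \<Longrightarrow> V \<subseteq> W \<Longrightarrow> smooth_map A V f"
  unfolding smooth_map_csmooth by (auto intro: csmooth_subset)

text \<open>Both products send w to - (w, s) (a, a') s. Hence all values of q, and those of q_\<mu>
  and E, commute at a point.\<close>

lemma wedge_bracket_zero:
  assumes "mink s s = 0" "mink s a = 0" "mink s a' = 0"
  shows "lie_bracket (wedge s a) (wedge s a') = 0"
proof (rule matrix_eqI)
  fix w
  have "mink a s = 0" "mink a' s = 0" using assms(2,3) mink_commute[of a s] mink_commute[of a' s] by simp_all
  then show "lie_bracket (wedge s a) (wedge s a') *v w = 0 *v w"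
    using assms mink_commute[of a' a]
    by (simp add: lie_bracket_def matrix_vector_mult_diff_rdistrib matrix_vector_mul_assoc[symmetric]
        wedge_vec mink_simps)
qed

section \<open>The data of the theorem, globally and near a point\<close>

locale spectral_data =
  fixes A :: "'m::{t2_space, second_countable_topology} chart set"
    and L :: "'m \<Rightarrow> (real ^ 'n::finite option) set" and S :: "'m \<Rightarrow> (complex ^ 'n option) set"
    and q :: "('m, 'n option) endo_form" and \<mu> :: complex and \<phi> :: "'m \<Rightarrow> real ^ 'n option ^ 'n option"
  assumes atlas: "oriented_surface A" and willmore: "constrained_willmore A L S q"
    and mu: "cmod \<mu> = 1" and iso: "spectral_iso A L S q \<mu> \<phi>"
begin

abbreviation "F y \<equiv> cplx_mat (\<phi> y)"
abbreviation "G y \<equiv> matrix_inv (cplx_mat (\<phi> y))"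
abbreviation "L\<phi> \<equiv> spectral_deformation \<phi> L"
abbreviation "S\<phi> \<equiv> spectral_sphere \<phi> S"
abbreviation "q\<phi> \<equiv> Ad_form \<phi> (q_spectral \<mu> q)"

definition "K c y h = cscale (1 / \<mu>) (part10 (N_form S) c y h) + cscale \<mu> (part01 (N_form S) c y h) - N_form S c y h"
definition "E c y h = q_spectral \<mu> q c y h - q c y h"

lemma surface: "real_surface A L" and csc: "central_sphere_congruence A L S"
  and one_form_q: "one_form A L q" and real_form_q: "real_form A L q" and q_L_wedge_L1: "in_L_wedge_L1 A L q"
  using willmore by (auto simp: constrained_willmore_def)

lemma null_line: "null_line_subbundle A L" and immersed: "immersed A L"
  and hol_charts: "\<exists>c. hol_chart A L c \<and> x \<in> fst c"
  using surface by (auto simp: real_surface_def)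

lemma phi_isometric: "isometric (\<phi> y)"
  using iso by (auto simp: spectral_iso_def isometric_def)

lemma phi_smooth: "smooth_map A UNIV \<phi>"
  using iso by (auto simp: spectral_iso_def)

lemma F_isometric: "isometric (F y)"
  by (rule isometric_cplx_mat[OF phi_isometric])

lemma F_smooth: "smooth_map A UNIV F"
  by (rule smooth_map_bounded_linear[OF atlas open_UNIV bounded_linear_cplx_mat phi_smooth])

lemma G_smooth: "smooth_map A UNIV G"
  unfolding isometric_inverse(3)[OF F_isometric]
  by (rule smooth_map_bounded_linear[OF atlas open_UNIV transpose_bounded_linear F_smooth])

lemma phi_inv_smooth: "smooth_map A UNIV (\<lambda>y. matrix_inv (\<phi> y))"
  unfolding isometric_inverse(3)[OF phi_isometric]
  by (rule smooth_map_bounded_linear[OF atlas open_UNIV transpose_bounded_linear phi_smooth])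

lemma FG: "F y ** G y = mat 1" and GF: "G y ** F y = mat 1"
  using isometric_inverse[OF F_isometric, of y] by simp_all

lemma phi_inv: "\<phi> y ** matrix_inv (\<phi> y) = mat 1" "matrix_inv (\<phi> y) ** \<phi> y = mat 1"
  using isometric_inverse[OF phi_isometric, of y] by simp_all

lemma phi_inv_vec [simp]: "\<phi> y *v (matrix_inv (\<phi> y) *v w) = w" "matrix_inv (\<phi> y) *v (\<phi> y *v w) = w"
  by (simp_all add: matrix_vector_mul_assoc phi_inv)

lemma max_atlas_csmooth: "c \<in> max_atlas A \<Longrightarrow> smooth_map A UNIV f \<Longrightarrow> csmooth c W f"
  using smooth_map_csmooth_max_atlas[OF atlas _ open_UNIV] by (blast intro: csmooth_subset)

lemma hol_max_atlas: "hol_chart A L c \<Longrightarrow> c \<in> max_atlas A"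
  by (simp add: hol_chart_def)

lemma patch:
  assumes "hol_chart A L c" "x \<in> fst c" "local_lift A L x \<sigma>"
  obtains W where "x \<in> W" "surface_patch c W A L S \<sigma>"
proof -
  obtain W where W: "open W" "x \<in> W" "smooth_map A W \<sigma>" "\<And>y. y \<in> W \<Longrightarrow> \<sigma> y \<in> L y \<and> \<sigma> y \<noteq> 0"
    using assms(3) unfolding local_lift_def by blast
  have c: "is_chart c" using assms(1) hol_max_atlas max_atlas_is_chart by blast
  have "surface_patch c (W \<inter> fst c) A L S \<sigma>"
    using c W assms(1) atlas null_line immersed csc smooth_map_subset[OF W(3), of "W \<inter> fst c"]
    by unfold_locales (auto simp: is_chart_def)
  with W(2) assms(2) that show ?thesis by blast
qed

end

locale spectral_patch = surface_patch c W A L S \<sigma> + spectral_data A L S q \<mu> \<phi>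
  for c :: "'m::{t2_space, second_countable_topology} chart" and W A
    and L :: "'m \<Rightarrow> (real ^ 'n::finite option) set" and S \<sigma> q \<mu> \<phi>
begin

lemma q_smooth: "csmooth c W (\<lambda>y. q c y h)"
proof -
  have "smooth_map A (fst c) (\<lambda>y. q c y h)" using one_form_q hol unfolding one_form_def by blast
  then have "csmooth c (fst c) (\<lambda>y. q c y h)"
    using smooth_map_csmooth_max_atlas[OF atlas c_max_atlas] chart by (auto simp: is_chart_def)
  then show ?thesis using W_sub by (auto intro: csmooth_subset)
qed

lemma q_linear: "x \<in> W \<Longrightarrow> linear (q c x)"
  using one_form_q hol in_chart unfolding one_form_def by blast

lemma q_wedge: "x \<in> W \<Longrightarrow> \<exists>a\<in>vec.span {s x, z x, b x}. q c x h = wedge (s x) a"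
  using part_L_wedge_L1[OF q_L_wedge_L1, of x 1 h 0 h] by (simp add: cscale_def vec_eq_iff)

lemma q_spectral_wedge: "x \<in> W \<Longrightarrow> \<exists>a\<in>vec.span {s x, z x, b x}. q_spectral \<mu> q c x h = wedge (s x) a"
proof -
  assume x: "x \<in> W"
  have "q_spectral \<mu> q c x h = cscale (of_real (Re (\<mu>\<^sup>2))) (q c x h) + cscale (- of_real (Im (\<mu>\<^sup>2))) (q c x (\<i> * h))"
    unfolding q_spectral_combination[OF mu] by (simp add: vec_eq_iff complex_eq_iff)
  then show ?thesis using part_L_wedge_L1[OF q_L_wedge_L1 x] by metis
qed

lemma E_wedge: "x \<in> W \<Longrightarrow> \<exists>a\<in>vec.span {s x, z x, b x}. E c x h = wedge (s x) a"
proof -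
  assume x: "x \<in> W"
  obtain a a' where a: "a \<in> vec.span {s x, z x, b x}" "a' \<in> vec.span {s x, z x, b x}"
    "q_spectral \<mu> q c x h = wedge (s x) a" "q c x h = wedge (s x) a'"
    using q_wedge[OF x] q_spectral_wedge[OF x] by metis
  have "E c x h = wedge (s x) (a - a')"
    by (rule matrix_eqI)
       (simp add: E_def a wedge_vec matrix_vector_mult_diff_rdistrib mink_simps vec_eq_iff algebra_simps)
  then show ?thesis using a vec.span_diff by blast
qed

lemma q_comm: "x \<in> W \<Longrightarrow> lie_bracket (q c x h) (q c x k) = 0"
proof -
  assume x: "x \<in> W"
  obtain a a' where a: "a \<in> vec.span {s x, z x, b x}" "a' \<in> vec.span {s x, z x, b x}"
    "q c x h = wedge (s x) a" "q c x k = wedge (s x) a'"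
    using q_wedge[OF x] by metis
  then show ?thesis
    using wedge_bracket_zero[OF frame.ss[OF frame_at(1)[OF x]]] frame.wedge_frame(6)[OF frame_at(1)[OF x]] by simp
qed

lemma E_vec:
  assumes "x \<in> W"
  shows "E c x h *v s x = 0" "\<exists>k. E c x h *v b x = k *s s x" "E c x h *v (u - P x *v u) = 0"
    "P x *v (E c x h *v u) = E c x h *v u"
proof -
  obtain a where a: "a\<in>vec.span {s x, z x, b x}" "E c x h = wedge (s x) a" using E_wedge[OF assms] by blast
  note fr = frame.wedge_frame[OF frame_at(1)[OF assms] a(1)]
  show "E c x h *v s x = 0" "E c x h *v (u - P x *v u) = 0" "P x *v (E c x h *v u) = E c x h *v u"
    unfolding a(2) P_def by (rule fr)+
  show "\<exists>k. E c x h *v b x = k *s s x" unfolding a(2) by (rule exI) (rule fr)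
qed

lemma K_alt: "K c x h = (Re \<mu> - 1) *\<^sub>R N_form S c x h - Im \<mu> *\<^sub>R N_form S c x (\<i> * h)"
  unfolding K_def spectral_combination[OF mu] by (simp add: algebra_simps)

lemma N_form_vec_section:
  assumes "csmooth c W \<xi>" "x \<in> W" "\<And>y. y \<in> W \<Longrightarrow> P y *v \<xi> y = \<xi> y"
  shows "N_form S c x h *v \<xi> x = dd c h \<xi> x - P x *v dd c h \<xi> x"
proof -
  have "D_conn S c h \<xi> x = P x *v dd c h \<xi> x"
    by (rule D_conn_section[OF assms(1,2)]) (rule assms(3))
  then show ?thesis using D_conn_eq[OF assms(1,2), of h] by (simp add: algebra_simps)
qed

lemma d_lambda_const:
  assumes "x \<in> W"
  shows "d_lambda S q \<mu> c h (\<lambda>_. w) x = (K c x h + E c x h) *v w"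
proof -
  have "q c x h *v w = part10 q c x h *v w + part01 q c x h *v w"
    by (simp add: matrix_vector_mult_add_rdistrib[symmetric] part_sum)
  then show ?thesis
    unfolding d_lambda_def D_conn_eq[OF csmooth_const assms] E_def K_def q_spectral_def
    by (simp add: matrix_vector_mult_diff_rdistrib matrix_vector_mult_add_rdistrib cscale_vec)
qed

text \<open>The intertwining property is evaluated on constant real sections, where it involves no
  derivative of the section; real vectors determine a complex matrix.\<close>

lemma dF:
  assumes x: "x \<in> W"
  shows "dd c h F x = F x ** (K c x h + E c x h)"
proof (rule cplx_mat_eqI)
  fix w :: "real^'n option"
  have ps: "csmooth c W \<phi>" by (rule max_atlas_csmooth[OF c_max_atlas phi_smooth])
  have "smooth_map A UNIV (\<lambda>_. w)" by (simp add: smooth_map_csmooth csmooth_const)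
  then have "cplx_mat (\<phi> x) *v d_lambda S q \<mu> c h (cplx_vec \<circ> (\<lambda>_. w)) x = cplx_vec (dd c h (\<lambda>y. \<phi> y *v w) x)"
    using iso hol in_chart[OF x] unfolding spectral_iso_def by blast
  also have "dd c h (\<lambda>y. \<phi> y *v w) x = dd c h \<phi> x *v w"
    using dd_bilinear[OF bounded_bilinear_matrix_vector_mult chart ps csmooth_const x in_chart[OF x]] by simp
  also have "cplx_vec (dd c h \<phi> x *v w) = dd c h F x *v cplx_vec w"
    by (simp add: dd_bounded_linear[OF bounded_linear_cplx_mat ps x in_chart[OF x]] cplx_mat_vec)
  finally show "dd c h F x *v cplx_vec w = (F x ** (K c x h + E c x h)) *v cplx_vec w"
    by (simp add: comp_def d_lambda_const[OF x] matrix_vector_mul_assoc)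
qed

sublocale spectral c W S P F G "K c" "E c" q \<mu>
proof (intro spectral.intro deformation.intro spectral_axioms.intro deformation_axioms.intro splitting_axioms)
  show "csmooth c W F" "csmooth c W G"
    by (rule max_atlas_csmooth[OF c_max_atlas F_smooth], rule max_atlas_csmooth[OF c_max_atlas G_smooth])
  fix x h assume x: "x \<in> W"
  show "K c x h = K c x h ** P x + P x ** K c x h"
    unfolding K_alt
    by (subst (1) N_form_offdiag[OF x], subst (2) N_form_offdiag[OF x])
       (simp add: matrix_ring_simps scaleR_add_right scaleR_diff_right)
  show "E c x h ** P x = P x ** E c x h"
    by (rule matrix_eqI)
       (use E_vec(3,4)[OF x] in \<open>simp add: matrix_vector_mul_assoc[symmetric] matrix_vector_mult_diff_distrib\<close>)
  show "linear (q c x)" by (rule q_linear[OF x])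
qed (use F_isometric FG dF mu q_smooth q_comm in \<open>simp_all add: K_def E_def\<close>)

lemma dd_s_frame:
  assumes "x \<in> W"
  shows "dd c h s x = h *s z x + cnj h *s b x"
  by (subst linear_complex_expand[OF d_linear[OF s_smooth assms assms], of h])
     (simp add: z_def b_def d_z_def d_zbar_def vec_eq_iff complex_eq_iff field_simps)

text \<open>On a section of S, N gives the normal part of the derivative, and the first derivatives
  of s stay in S.\<close>

lemma N_form_s:
  assumes "x \<in> W"
  shows "N_form S c x h *v s x = 0"
proof -
  have "N_form S c x h *v s x = dd c h s x - P x *v dd c h s x"
    by (rule N_form_vec_section[OF s_smooth assms]) (rule P_frame)
  then show ?thesis
    by (simp add: dd_s_frame[OF assms] matrix_vector_right_distrib matrix_vec_scale P_frame[OF assms])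
qed

lemma dd_F_s:
  assumes "x \<in> W"
  shows "dd c h (\<lambda>y. F y *v s y) x = F x *v dd c h s x"
proof -
  have "(K c x h + E c x h) *v s x = 0"
    by (simp add: K_alt matrix_vector_mult_add_rdistrib matrix_vector_mult_diff_rdistrib matrix_vec_scaleR
        N_form_s[OF assms] E_vec(1)[OF assms])
  then show ?thesis
    unfolding d_mult_vec[OF F_smooth s_smooth assms assms] dF[OF assms]
    by (simp add: matrix_vector_mul_assoc[symmetric])
qed

lemma dd_phi_sigma:
  assumes "x \<in> W"
  shows "dd c h (\<lambda>y. \<phi> y *v \<sigma> y) x = \<phi> x *v dd c h \<sigma> x"
proof -
  have ps: "csmooth c W \<phi>" by (rule max_atlas_csmooth[OF c_max_atlas phi_smooth])
  have "csmooth c W (\<lambda>y. \<phi> y *v \<sigma> y)"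
    by (rule csmooth_bilinear[OF bounded_bilinear_matrix_vector_mult chart openW ps sigma_csmooth])
  from dd_bounded_linear[OF bounded_linear_cplx_vec this assms in_chart[OF assms], of h]
  have "cplx_vec (dd c h (\<lambda>y. \<phi> y *v \<sigma> y) x) = dd c h (\<lambda>y. F y *v s y) x"
    by (simp add: s_def cplx_mat_vec)
  also have "\<dots> = cplx_vec (\<phi> x *v dd c h \<sigma> x)"
    by (simp add: dd_F_s[OF assms] dd_s[OF assms] cplx_mat_vec)
  finally show ?thesis by simp
qed

definition "s' = cplx_vec \<circ> (\<lambda>y. \<phi> y *v \<sigma> y)"

lemma s'_eq: "s' y = F y *v s y"
  by (simp add: s'_def s_def cplx_mat_vec)

lemma s'_smooth: "csmooth c W s'"
  unfolding s'_eq[abs_def] by (intro smooth_mult_vec F_smooth s_smooth)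

lemma d_s':
  assumes "x \<in> W"
  shows "d_z c s' x = F x *v z x" "d_zbar c s' x = F x *v b x"
  unfolding s'_eq[abs_def] d_z_def d_zbar_def dd_F_s[OF assms] z_def b_def
  by (simp_all add: matrix_vec_scale matrix_vector_right_distrib matrix_vector_mult_diff_distrib)

text \<open>On d/dz, N sends b to the normal part of \<sigma>_zzbar, which is zero, and K on d/dz is
  a multiple of N there. What remains is E b, a multiple of s, harmless for the span.\<close>

lemma d_z_d_zbar_s':
  assumes x: "x \<in> W"
  shows "\<exists>k. d_z c (d_zbar c s') x = F x *v (e x + k *s s x)"
proof -
  have "csmooth c W (\<lambda>y. F y *v b y)" by (intro smooth_mult_vec F_smooth b_smooth)
  then have "dd c h (d_zbar c s') x = dd c h (\<lambda>y. F y *v b y) x" for h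
    by (rule d_cong[OF x x, symmetric]) (simp add: d_s')
  then have 1: "dd c h (d_zbar c s') x = F x *v (dd c h b x + K c x h *v b x + E c x h *v b x)" for h
    unfolding d_mult_vec[OF F_smooth b_smooth x x] dF[OF x]
    by (simp add: matrix_vector_mul_assoc[symmetric] matrix_vector_right_distrib matrix_vector_mult_add_rdistrib)
  have N: "N_form S c x h *v b x = dd c h b x - P x *v dd c h b x" for h
    by (rule N_form_vec_section[OF b_smooth x]) (rule P_frame)
  have "N_form S c x 1 *v b x - \<i> *s (N_form S c x \<i> *v b x) = 2 *s (e x - P x *v e x)"
    unfolding N e_def d_z_def
    by (simp add: matrix_vec_scale matrix_vector_mult_diff_distrib)
  then have N1: "N_form S c x 1 *v b x = \<i> *s (N_form S c x \<i> *v b x)"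
    by (simp add: P_frame[OF x])
  have Nm: "N_form S c x (- 1) = - N_form S c x 1"
    using linear_neg[OF N_form_linear[OF x], of 1] .
  have K: "K c x 1 *v b x - \<i> *s (K c x \<i> *v b x) = 0"
  proof -
    define n1 ni where "n1 = N_form S c x 1 *v b x" and "ni = N_form S c x \<i> *v b x"
    have K: "K c x 1 *v b x = (Re \<mu> - 1) *\<^sub>R n1 - Im \<mu> *\<^sub>R ni" "K c x \<i> *v b x = (Re \<mu> - 1) *\<^sub>R ni + Im \<mu> *\<^sub>R n1"
      by (simp_all add: K_alt n1_def ni_def matrix_vector_mult_diff_rdistrib matrix_vector_mult_add_rdistrib
          matrix_vec_scaleR Nm)
    have n: "n1 = \<i> *s ni" unfolding n1_def ni_def by (rule N1)
    show ?thesis unfolding K n by (simp add: vec_eq_iff complex_eq_iff algebra_simps)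
  qed
  obtain k1 k2 where E: "E c x 1 *v b x = k1 *s s x" "E c x \<i> *v b x = k2 *s s x"
    using E_vec(2)[OF x] by metis
  have "d_z c (d_zbar c s') x = F x *v ((1 / 2) *s ((dd c 1 b x + K c x 1 *v b x + E c x 1 *v b x)
     - \<i> *s (dd c \<i> b x + K c x \<i> *v b x + E c x \<i> *v b x)))"
    unfolding d_z_def 1 by (simp add: matrix_vec_scale matrix_vector_mult_diff_distrib matrix_vector_right_distrib)
  also have "(1 / 2) *s ((dd c 1 b x + K c x 1 *v b x + E c x 1 *v b x)
     - \<i> *s (dd c \<i> b x + K c x \<i> *v b x + E c x \<i> *v b x)) =
     e x + (1 / 2) *s (K c x 1 *v b x - \<i> *s (K c x \<i> *v b x)) + ((k1 - \<i> * k2) / 2) *s s x"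
    unfolding E e_def d_z_def by (simp add: vec_eq_iff algebra_simps diff_divide_distrib)
  finally show ?thesis unfolding K by (intro exI[of _ "(k1 - \<i> * k2) / 2"]) simp
qed

lemma spectral_sphere_at:
  assumes x: "x \<in> W"
  shows "S\<phi> x = vec.span {s' x, d_z c s' x, d_zbar c s' x, d_z c (d_zbar c s') x}"
proof -
  obtain k where k: "d_z c (d_zbar c s') x = F x *v (e x + k *s s x)" using d_z_d_zbar_s'[OF x] by blast
  have "vec.span {s x, z x, b x, e x} = vec.span {s x, z x, b x, e x + k *s s x}"
  proof (rule antisym; rule vec.span_minimal)
    let ?T = "vec.span {s x, z x, b x, e x + k *s s x}"
    have "e x + k *s s x - k *s s x \<in> ?T" by (intro vec.span_diff vec.span_scale vec.span_base) auto
    then show "{s x, z x, b x, e x} \<subseteq> ?T" by (auto intro: vec.span_base)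
    show "{s x, z x, b x, e x + k *s s x} \<subseteq> vec.span {s x, z x, b x, e x}"
      by (auto intro!: vec.span_add vec.span_scale intro: vec.span_base)
  qed simp_all
  then show ?thesis
    unfolding spectral_sphere_def S_eq[OF x] d_s'[OF x] s'_eq k by (simp add: cspan_image)
qed

end


section \<open>The spectral deformation\<close>

lemma smooth_map_add:
  assumes "oriented_surface A" "open W" "smooth_map A W f" "smooth_map A W g"
  shows "smooth_map A W (\<lambda>x. f x + g x)"
  unfolding smooth_map_csmooth
proof
  fix a assume a: "a \<in> A"
  have "is_chart a" using a atlas_subset_max_atlas[OF assms(1)] max_atlas_is_chart by blast
  then show "csmooth a W (\<lambda>x. f x + g x)"
    using assms(3,4) a unfolding smooth_map_csmooth by (intro csmooth_add[OF _ assms(2)]) blast+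
qed

text \<open>Lagrange's identity makes the determinant equal to the common squared length of the
  columns; then the defect (a - d)^2 + (b + c)^2 of the Cauchy-Riemann equations vanishes.\<close>

lemma similarity_complex_linear:
  assumes "linear D" "jac D > 0" "(cmod (D 1))\<^sup>2 = (cmod (D \<i>))\<^sup>2" "Re (D 1 * cnj (D \<i>)) = 0"
  shows "D (\<i> * h) = \<i> * D h"
proof -
  obtain a b c d where D1: "D 1 = Complex a b" and Di: "D \<i> = Complex c d" by (metis complex.exhaust)
  have n: "a * a + b * b = c * c + d * d" "a * c + b * d = 0" "a * d - b * c > 0"
    using assms(2,4) assms(3)[unfolded cmod_power2] by (simp_all add: D1 Di jac_def power2_eq_square)
  have "(a * d - b * c)\<^sup>2 = (a * a + b * b) * (c * c + d * d) - (a * c + b * d)\<^sup>2"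
    by (simp add: power2_eq_square algebra_simps)
  then have "(a * d - b * c)\<^sup>2 = (a * a + b * b)\<^sup>2" using n by (simp add: power2_eq_square)
  then have e: "a * d - b * c = a * a + b * b"
    using n(3) by (smt (verit) power2_eq_iff zero_le_square)
  have "(a - d)\<^sup>2 + (b + c)\<^sup>2 = (a * a + b * b) + (c * c + d * d) - 2 * (a * d - b * c)"
    by (simp add: power2_eq_square algebra_simps)
  then have "(a - d)\<^sup>2 + (b + c)\<^sup>2 = 0" using e n(1) by simp
  then have "a = d" "c = - b" by (simp_all add: sum_power2_eq_zero_iff)
  then have "D \<i> = \<i> * D 1" by (simp add: D1 Di complex_eq_iff)
  then show ?thesis
    using linear_complex_expand[OF assms(1), of h] linear_complex_expand[OF assms(1), of "\<i> * h"]
    by (simp add: complex_eq_iff algebra_simps)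
qed

section \<open>Reality of the central sphere congruence\<close>

context surface_patch
begin

lemma cnj_frame:
  assumes y: "y \<in> W"
  shows "cnj_vec (s y) = s y" "cnj_vec (z y) = b y" "cnj_vec (b y) = z y" "cnj_vec (e y) = e y"
proof -
  show "cnj_vec (s y) = s y" by (simp add: s_def)
  have zb: "cnj_vec (b y) = z y" if "y \<in> W" for y
    by (simp add: z_def b_def d_z_def d_zbar_def dd_s[OF that])
  then show 1: "cnj_vec (b y) = z y" using y .
  then show "cnj_vec (z y) = b y" by (metis cnj_vec_simps(1))
  have "cnj_vec (dd c h b y) = dd c h z y" for h
  proof -
    have "dd c h (\<lambda>y. cnj_vec (b y)) y = cnj_vec (dd c h b y)"
      by (rule dd_bounded_linear[OF bounded_linear_cnj_vec b_smooth y in_chart[OF y]])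
    moreover have "dd c h z y = dd c h (\<lambda>y. cnj_vec (b y)) y"
      by (rule d_cong[OF y y z_smooth]) (simp add: zb)
    ultimately show ?thesis by simp
  qed
  then have "cnj_vec (e y) = d_zbar c z y" by (simp add: e_def d_z_def d_zbar_def)
  then show "cnj_vec (e y) = e y" by (simp add: d_bz y)
qed

lemma cnj_S:
  assumes y: "y \<in> W" and "w \<in> S y"
  shows "cnj_vec w \<in> S y"
  using assms(2) unfolding S_eq[OF y]
proof (induction rule: vec.span_induct_alt)
  case base
  show ?case by (simp add: vec.span_zero)
next
  case (step k u w)
  then have "cnj_vec u \<in> {s y, z y, b y, e y}" using cnj_frame[OF y] by auto
  with step show ?case by (auto intro: vec.span_add vec.span_scale vec.span_base)
qed

text \<open>S is closed under conjugation, hence so is its complement. This separates the middle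
  coefficient of a Laurent section from the outer two.\<close>

lemma P_cnj_perp:
  assumes y: "y \<in> W" and "w \<in> perp (S y)"
  shows "P y *v cnj_vec w = 0"
proof -
  have "mink u (cnj_vec w) = 0" if "u \<in> S y" for u
  proof -
    have "mink (cnj_vec u) w = 0" using cnj_S[OF y that] assms(2) by (simp add: perp_def)
    then show ?thesis using mink_cnj_vec[of "cnj_vec u" w] by simp
  qed
  then have "cnj_vec w \<in> perp (S y)" by (simp add: perp_def)
  then show ?thesis using is_proj_perp_iff[OF P_proj[OF y]] by blast
qed

end

section \<open>The deformed equations near a point, and pullbacks of constant vectors\<close>

context spectral_patch
begin

lemma spectral_sphere_eq: "S\<phi> = S'"
  by (simp add: fun_eq_iff spectral_sphere_def)

lemma Ad_form_eq: "q\<phi> = q'"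
  by (intro ext) (simp add: Ad_form_def q'_def)

lemma willmore_spectral:
  assumes x: "x \<in> W"
  shows "ext_D S\<phi> q\<phi> c x h k = 0"
    "ext_D S\<phi> (hodge (N_form S\<phi>)) c x h k =
      2 *\<^sub>R wedge_bracket q\<phi> (hodge (N_form S\<phi>)) c x h k"
proof -
  have cl: "ext_D S q c y h k = 0"
    "ext_D S (hodge (N_form S)) c y h k = 2 *\<^sub>R wedge_bracket q (hodge (N_form S)) c y h k" if "y \<in> W" for y h k
    using willmore hol in_chart[OF that] unfolding constrained_willmore_def by blast+
  have co: "ext_D S (hodge q) c x h k = 0"
    by (rule coclosed[OF q_L_wedge_L1 q_smooth q_linear cl(1) x])
  show "ext_D S\<phi> q\<phi> c x h k = 0"
    unfolding spectral_sphere_eq Ad_form_eq by (rule ext_D_deformed_q[OF x cl(1)[OF x] co])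
  show "ext_D S\<phi> (hodge (N_form S\<phi>)) c x h k =
      2 *\<^sub>R wedge_bracket q\<phi> (hodge (N_form S\<phi>)) c x h k"
    unfolding spectral_sphere_eq Ad_form_eq by (rule ext_D_deformed_N[OF x cl(2)[OF x]])
qed

lemma d_lambda_spectral:
  assumes "csmooth c W \<xi>" "x \<in> W"
  shows "d_lambda S\<phi> q\<phi> lam c h (\<lambda>y. F y *v \<xi> y) x =
    F x *v d_lambda S q (\<mu> * lam) c h \<xi> x"
  unfolding spectral_sphere_eq Ad_form_eq by (rule d_lambda_deformed[OF assms])

lemma L_wedge_L1_spectral:
  assumes x: "x \<in> W"
  shows "\<exists>a\<in>vec.span {s' x, d_z c s' x, d_zbar c s' x}. q\<phi> c x h = wedge (s' x) a"
proof -
  obtain a where a: "a \<in> vec.span {s x, z x, b x}" "q_spectral \<mu> q c x h = wedge (s x) a"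
    using q_spectral_wedge[OF x] by blast
  have "F x *v a \<in> (\<lambda>w. F x *v w) ` vec.span {s x, z x, b x}" using a(1) by blast
  then have "F x *v a \<in> vec.span {s' x, d_z c s' x, d_zbar c s' x}"
    by (simp add: cspan_image s'_eq d_s'[OF x])
  moreover have "q\<phi> c x h = wedge (s' x) (F x *v a)"
    unfolding Ad_form_eq q'_def a(2) s'_eq by (rule wedge_conj[OF F_isometric FG]) (rule x)+
  ultimately show ?thesis by blast
qed

text \<open>The pullback is a parallel section orthogonal to the central sphere congruence. So \<open>q\<close> annihilates
  it, and so do, by their types, the two parts of \<open>\<N>\<close> separately.\<close>

lemma constant_pullback:
  assumes x: "x \<in> W" and w: "\<And>y. y \<in> W \<Longrightarrow> mink w (\<phi> y *v \<sigma> y) = 0"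
  shows "dd c h (\<lambda>y. G y *v cplx_vec w) x = 0"
proof -
  define \<xi> where "\<xi> y = G y *v cplx_vec w" for y
  have Gs: "csmooth c W G" by (rule G_smooth)
  have \<xi>s: "csmooth c W \<xi>" unfolding \<xi>_def by (intro smooth_mult_vec Gs csmooth_const)
  have \<xi>m: "mink (\<xi> y) u = mink (cplx_vec w) (F y *v u)" for y u
  proof -
    have "F y *v \<xi> y = cplx_vec w" unfolding \<xi>_def by (simp add: matrix_vector_mul_assoc spectral_data.FG[OF spectral_data_axioms])
    moreover have "mink (F y *v \<xi> y) (F y *v u) = mink (\<xi> y) u"
      using spectral_data.F_isometric[OF spectral_data_axioms] by (simp add: isometric_def)
    ultimately show ?thesis by simp
  qed
  have w0: "mink (cplx_vec w) (s' y) = 0" if "y \<in> W" for y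
    using w[OF that] by (simp add: s'_def mink_cplx_vec)
  have wz: "mink (cplx_vec w) (d_z c s' y) = 0" and wb: "mink (cplx_vec w) (d_zbar c s' y) = 0" if "y \<in> W" for y
  proof -
    have "d_z c (\<lambda>_. cplx_vec w) y = 0" "d_zbar c (\<lambda>_. cplx_vec w) y = 0" by (simp_all add: d_z_def d_zbar_def)
    then show "mink (cplx_vec w) (d_z c s' y) = 0" "mink (cplx_vec w) (d_zbar c s' y) = 0"
      using d_z_mink_const[OF csmooth_const s'_smooth that w0] by simp_all
  qed
  have we: "mink (cplx_vec w) (d_z c (d_zbar c s') y) = 0" if "y \<in> W" for y
  proof -
    have "d_z c (\<lambda>_. cplx_vec w) y = 0" by (simp add: d_z_def)
    then show ?thesis
      using d_z_mink_const(1)[OF csmooth_const d_z_smooth(2)[OF s'_smooth] that wb] by simp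
  qed
  \<comment> \<open>Differentiating (w, \<phi>\<sigma>) = 0 up to the mixed second derivative gives
    orthogonality of \<open>w\<close> to the moved frame, hence of its pullback to S.\<close>
  have P\<xi>: "P y *v \<xi> y = 0" if y: "y \<in> W" for y
  proof -
    have 1: "mink (\<xi> y) (s y) = 0" "mink (\<xi> y) (z y) = 0" "mink (\<xi> y) (b y) = 0"
      using w0[OF y] wz[OF y] wb[OF y] by (simp_all add: \<xi>m s'_eq d_s'[OF y])
    obtain k where "d_z c (d_zbar c s') y = F y *v (e y + k *s s y)" using d_z_d_zbar_s'[OF y] by blast
    then have "mink (\<xi> y) (e y + k *s s y) = 0" using we[OF y] by (simp add: \<xi>m)
    then have 2: "mink (\<xi> y) (e y) = 0" using 1 by (simp add: mink_simps)
    have "mink u (\<xi> y) = 0" if "u \<in> S y" for u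
      using that unfolding S_eq[OF y]
    proof (induction rule: vec.span_induct_alt)
      case (step k u v)
      then have "mink u (\<xi> y) = 0" using 1 2 by (auto simp: mink_commute[of _ "\<xi> y"])
      with step show ?case by (simp add: mink_simps)
    qed simp
    then have "\<xi> y \<in> perp (S y)" by (simp add: perp_def)
    then show ?thesis using is_proj_perp_iff[OF P_proj[OF y]] by blast
  qed
  have d\<xi>: "dd c h \<xi> x = - (K c x h *v \<xi> x)" for h
  proof -
    have "dd c h \<xi> x = - ((K c x h + E c x h) *v \<xi> x)"
      unfolding \<xi>_def d_mult_vec[OF Gs csmooth_const x x] dG[OF x]
      by (simp add: matrix_vec_minus_left matrix_vector_mul_assoc)
    then show ?thesis
      using E_vec(3)[OF x, of h "\<xi> x"] by (simp add: P\<xi>[OF x] matrix_vector_mult_add_rdistrib)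
  qed
  have PN: "P x *v (N_form S c x h *v \<xi> x) = N_form S c x h *v \<xi> x" for h
    by (subst (2) N_form_offdiag[OF x])
       (simp add: matrix_vector_mult_add_rdistrib matrix_vector_mul_assoc[symmetric] P\<xi>[OF x])
  \<comment> \<open>The derivative is - K \<xi>, which lies in S, whereas D \<xi> is its normal
    part; so D \<xi> = 0 and the derivative is N \<xi>.\<close>
  have dN: "dd c h \<xi> x = N_form S c x h *v \<xi> x" for h
  proof -
    have "D_conn S c h \<xi> x = (mat 1 - P x) *v dd c h \<xi> x"
      by (rule D_conn_perp_section[OF \<xi>s x]) (rule P\<xi>)
    moreover have "P x *v dd c h \<xi> x = dd c h \<xi> x"
      unfolding d\<xi> K_alt
      by (simp add: matrix_vec_minus_right matrix_vector_mult_diff_rdistrib matrix_vec_scaleR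
          matrix_vector_mult_diff_distrib bounded_bilinear.scaleR_right[OF bounded_bilinear_matrix_vector_mult] PN)
    ultimately have "D_conn S c h \<xi> x = 0" by (simp add: matrix_vector_mult_diff_rdistrib)
    then show ?thesis using D_conn_eq[OF \<xi>s x, of h] by simp
  qed
  let ?n = "\<lambda>h. N_form S c x h *v \<xi> x"
  \<comment> \<open>Equating N \<xi> with - K \<xi> gives N_\<mu> \<xi> = 0. On the directions h and
    \<i> h this is a linear system whose matrix is a rotation, of determinant (Re \<mu>)^2 + (Im
    \<mu>)^2 = 1.\<close>
  have rel: "Re \<mu> *\<^sub>R ?n h = Im \<mu> *\<^sub>R ?n (\<i> * h)" for h
    using d\<xi>[of h] unfolding dN K_alt
    by (simp add: matrix_vector_mult_diff_rdistrib matrix_vec_scaleR scaleR_left_diff_distrib)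
  have "N_form S c x (\<i> * (\<i> * h)) = - N_form S c x h"
    using linear_neg[OF N_form_linear[OF x], of h] by (simp add: mult.assoc[symmetric])
  then have rel': "Re \<mu> *\<^sub>R ?n (\<i> * h) = - (Im \<mu> *\<^sub>R ?n h)"
    using rel[of "\<i> * h"] by (simp add: matrix_vec_minus_left)
  have "((Re \<mu>)\<^sup>2 + (Im \<mu>)\<^sup>2) *\<^sub>R ?n h = Re \<mu> *\<^sub>R (Re \<mu> *\<^sub>R ?n h) + Im \<mu> *\<^sub>R (Im \<mu> *\<^sub>R ?n h)"
    by (simp add: power2_eq_square scaleR_add_left)
  also have "\<dots> = Im \<mu> *\<^sub>R (Re \<mu> *\<^sub>R ?n (\<i> * h)) + Im \<mu> *\<^sub>R (Im \<mu> *\<^sub>R ?n h)"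
    unfolding rel[of h] by (simp add: mult.commute)
  also have "\<dots> = 0" unfolding rel' by simp
  finally show ?thesis using dN[of h] by (simp add: mu_circle \<xi>_def[abs_def])
qed

end

lemma locally_constant_imp_constant:
  fixes f :: "'m::{t2_space, second_countable_topology} \<Rightarrow> 'b::real_normed_vector"
  assumes conn: "connected (UNIV :: 'm set)"
    and loc: "\<And>x. \<exists>c W. is_chart c \<and> open W \<and> x \<in> W \<and> W \<subseteq> fst c \<and> csmooth c W f \<and> (\<forall>y\<in>W. \<forall>h. dd c h f y = 0)"
  shows "f x = f y"
proof (rule connected_local_const[OF conn UNIV_I UNIV_I], intro ballI)
  fix x :: 'm
  obtain c W where c: "is_chart c" "open W" "x \<in> W" "W \<subseteq> fst c" "csmooth c W f"
    and d: "\<And>y h. y \<in> W \<Longrightarrow> dd c h f y = 0" using loc[of x] by metis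
  let ?f = "f \<circ> chart_inv c"
  have "open (snd c ` (W \<inter> fst c))" by (rule open_chart_image[OF c(1,2)])
  moreover have "W \<inter> fst c = W" using c by auto
  ultimately obtain r where r: "r > 0" "ball (snd c x) r \<subseteq> snd c ` W"
    using c(3) by (metis openE imageI)
  have "(?f has_derivative (\<lambda>h. 0)) (at u within ball (snd c x) r)" if u: "u \<in> ball (snd c x) r" for u
  proof -
    obtain y where y: "y \<in> W" "u = snd c y" using u r by blast
    then have "?f differentiable (at u)"
      using csmooth_differentiable[OF c(5) y(1)] c(4) by blast
    moreover have "frechet_derivative ?f (at u) = (\<lambda>h. 0)"
      using d[OF y(1)] by (simp add: dd_def y(2) fun_eq_iff)
    ultimately show ?thesis by (metis frechet_derivative_works has_derivative_at_withinI)
  qed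
  from has_derivative_zero_constant[OF convex_ball this]
  obtain k where k: "\<And>u. u \<in> ball (snd c x) r \<Longrightarrow> ?f u = k" by blast
  have cont: "continuous_on (fst c) (snd c)" using c(1) by (simp add: is_chart_def homeomorphism_def)
  have "open (snd c -` ball (snd c x) r \<inter> fst c)"
    using cont c(1) by (simp add: is_chart_def continuous_on_open_vimage)
  then have "open (snd c -` ball (snd c x) r \<inter> fst c)" .
  moreover have "x \<in> snd c -` ball (snd c x) r \<inter> fst c" using c r by auto
  moreover have "f y = k" if "y \<in> snd c -` ball (snd c x) r \<inter> fst c" for y
    using k[of "snd c y"] that by (simp add: chart_inv_snd[OF c(1)])
  ultimately show "eventually (\<lambda>b. f x = f b) (at x within UNIV)"
    unfolding eventually_at_topological by metis
qed

section \<open>Global properties of the deformed surface\<close>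

context spectral_data
begin

lemma spectral_patch:
  assumes "hol_chart A L c" "x \<in> fst c" "local_lift A L x \<sigma>"
  obtains W where "x \<in> W" "spectral_patch c W A L S \<sigma> q \<mu> \<phi>"
  using patch[OF assms] spectral_patch.intro[OF _ spectral_data_axioms] by metis

lemma lift_exists: "\<exists>\<sigma>. local_lift A L x \<sigma>"
  using null_line by (simp add: null_line_subbundle_def)

lemma local_lift_deform:
  assumes "local_lift A L x \<sigma>"
  shows "local_lift A L\<phi> x (\<lambda>y. \<phi> y *v \<sigma> y)"
proof -
  obtain W where W: "open W" "x \<in> W" "smooth_map A W \<sigma>" "\<And>y. y \<in> W \<Longrightarrow> \<sigma> y \<in> L y \<and> \<sigma> y \<noteq> 0"
    using assms unfolding local_lift_def by blast
  have "smooth_map A W (\<lambda>y. \<phi> y *v \<sigma> y)"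
    by (rule smooth_map_bilinear[OF atlas W(1) bounded_bilinear_matrix_vector_mult smooth_map_subset[OF phi_smooth] W(3)]) simp
  moreover have "\<phi> y *v \<sigma> y \<noteq> 0" if "y \<in> W" for y
    using W(4)[OF that] phi_inv_vec(2)[of y "\<sigma> y"] by force
  ultimately show ?thesis
    unfolding local_lift_def spectral_deformation_def using W by blast
qed

lemma local_lift_deformE:
  assumes "local_lift A L\<phi> x \<sigma>'"
  obtains \<sigma> where "local_lift A L x \<sigma>" "\<sigma>' = (\<lambda>y. \<phi> y *v \<sigma> y)"
proof
  obtain W where W: "open W" "x \<in> W" "smooth_map A W \<sigma>'"
    "\<And>y. y \<in> W \<Longrightarrow> \<sigma>' y \<in> L\<phi> y \<and> \<sigma>' y \<noteq> 0"
    using assms unfolding local_lift_def by blast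
  have "smooth_map A W (\<lambda>y. matrix_inv (\<phi> y) *v \<sigma>' y)"
    by (rule smooth_map_bilinear[OF atlas W(1) bounded_bilinear_matrix_vector_mult smooth_map_subset[OF phi_inv_smooth] W(3)]) simp
  moreover have "matrix_inv (\<phi> y) *v \<sigma>' y \<in> L y" "matrix_inv (\<phi> y) *v \<sigma>' y \<noteq> 0" if "y \<in> W" for y
    using W(4)[OF that] phi_inv_vec(1)[of y "\<sigma>' y"] by (auto simp: spectral_deformation_def)
  ultimately show "local_lift A L x (\<lambda>y. matrix_inv (\<phi> y) *v \<sigma>' y)"
    unfolding local_lift_def using W by blast
qed simp

text \<open>The chart need not be holomorphic, because immersedness ranges over \<open>A\<close>.
  The identity is known in a holomorphic chart, and the chain rule transfers both sides.\<close>

lemma dd_deform: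
  assumes c: "c \<in> max_atlas A" "x \<in> fst c" and lift: "local_lift A L x \<sigma>"
  shows "dd c h (\<lambda>y. \<phi> y *v \<sigma> y) x = \<phi> x *v dd c h \<sigma> x"
proof -
  obtain W where W: "open W" "x \<in> W" "smooth_map A W \<sigma>"
    using lift unfolding local_lift_def by blast
  have sm: "smooth_map A W (\<lambda>y. \<phi> y *v \<sigma> y)"
    by (rule smooth_map_bilinear[OF atlas W(1) bounded_bilinear_matrix_vector_mult smooth_map_subset[OF phi_smooth] W(3)]) simp
  obtain d where d: "hol_chart A L d" "x \<in> fst d" using hol_charts by blast
  obtain V where V: "x \<in> V" "spectral_patch d V A L S \<sigma> q \<mu> \<phi>" using spectral_patch[OF d lift] .
  let ?k = "dd c h (snd d) x"
  have "dd c h (\<lambda>y. \<phi> y *v \<sigma> y) x = dd d ?k (\<lambda>y. \<phi> y *v \<sigma> y) x"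
    by (rule dd_chain_max_atlas[OF atlas c(1) hol_max_atlas[OF d(1)] W(1) sm W(2) c(2) d(2)])
  also have "\<dots> = \<phi> x *v dd d ?k \<sigma> x" by (rule spectral_patch.dd_phi_sigma[OF V(2,1)])
  also have "dd d ?k \<sigma> x = dd c h \<sigma> x"
    by (rule dd_chain_max_atlas[OF atlas c(1) hol_max_atlas[OF d(1)] W(1,3,2) c(2) d(2), symmetric])
  finally show ?thesis .
qed

text \<open>First derivatives of lifts are moved by an isometry, so the conformality conditions
  agree. Rewriting with this equivalence turns every chart quantifier for the deformed surface into
  one for the original.\<close>

lemma hol_chart_deform: "hol_chart A L\<phi> c \<longleftrightarrow> hol_chart A L c"
proof -
  have m: "mink (\<phi> x *v u) (\<phi> x *v w) = mink u w" for x u w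
    using phi_isometric by (simp add: isometric_def)
  have "(\<forall>\<sigma>'. local_lift A L\<phi> x \<sigma>' \<longrightarrow>
        mink (dd c 1 \<sigma>' x) (dd c 1 \<sigma>' x) = mink (dd c \<i> \<sigma>' x) (dd c \<i> \<sigma>' x) \<and>
        mink (dd c 1 \<sigma>' x) (dd c \<i> \<sigma>' x) = 0) \<longleftrightarrow>
     (\<forall>\<sigma>. local_lift A L x \<sigma> \<longrightarrow>
        mink (dd c 1 \<sigma> x) (dd c 1 \<sigma> x) = mink (dd c \<i> \<sigma> x) (dd c \<i> \<sigma> x) \<and>
        mink (dd c 1 \<sigma> x) (dd c \<i> \<sigma> x) = 0)" (is "?l \<longleftrightarrow> ?r") if c: "c \<in> max_atlas A" "x \<in> fst c" for x
  proof
    assume l: ?l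
    show ?r
    proof (intro allI impI)
      fix \<sigma> assume s: "local_lift A L x \<sigma>"
      from l[rule_format, OF local_lift_deform[OF s]]
      show "mink (dd c 1 \<sigma> x) (dd c 1 \<sigma> x) = mink (dd c \<i> \<sigma> x) (dd c \<i> \<sigma> x) \<and>
        mink (dd c 1 \<sigma> x) (dd c \<i> \<sigma> x) = 0"
        unfolding dd_deform[OF c s] m .
    qed
  next
    assume r: ?r
    show ?l
    proof (intro allI impI)
      fix \<sigma>' assume "local_lift A L\<phi> x \<sigma>'"
      then obtain \<sigma> where s: "local_lift A L x \<sigma>" "\<sigma>' = (\<lambda>y. \<phi> y *v \<sigma> y)" by (rule local_lift_deformE)
      show "mink (dd c 1 \<sigma>' x) (dd c 1 \<sigma>' x) = mink (dd c \<i> \<sigma>' x) (dd c \<i> \<sigma>' x) \<and>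
        mink (dd c 1 \<sigma>' x) (dd c \<i> \<sigma>' x) = 0"
        unfolding s(2) dd_deform[OF c s(1)] m using r s(1) by blast
    qed
  qed
  then show ?thesis unfolding hol_chart_def by blast
qed

text \<open>q_\<mu> involves q on \<open>\<i> * h\<close>, so its expressions in two charts agree
  only if the differential of the transition commutes with \<i>. It does, as both charts are
  conformal for one metric and equally oriented.\<close>

lemma hol_transition:
  assumes "hol_chart A L c" "hol_chart A L c'" "x \<in> fst c" "x \<in> fst c'"
  shows "dd c (\<i> * h) (snd c') x = \<i> * dd c h (snd c') x"
proof -
  obtain \<sigma> where lift: "local_lift A L x \<sigma>" using lift_exists by blast
  obtain W where W: "open W" "x \<in> W" "smooth_map A W \<sigma>"
    using lift unfolding local_lift_def by blast
  obtain V where V: "x \<in> V" "surface_patch c' V A L S \<sigma>" using patch[OF assms(2,4) lift] .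
  note m = hol_max_atlas[OF assms(1)] hol_max_atlas[OF assms(2)]
  define D where "D h = dd c h (snd c') x" for h
  \<comment> \<open>The conformal factor of the metric of \<sigma> in \<open>c'\<close>; dividing by
    it makes the differential \<open>D\<close> conformal for the Euclidean metric.\<close>
  define r where "r = mink (dd c' 1 \<sigma> x) (dd c' 1 \<sigma> x)"
  have r: "r \<noteq> 0"
    using frame.zb[OF surface_patch.frame_at(1)[OF V(2,1)]] surface_patch.frame_at(2)[OF V(2,1)]
    by (auto simp: r_def)
  have lin: "linear D"
    unfolding D_def by (rule dd_linear[OF max_atlas_coord_csmooth[OF atlas m] assms(4,3)])
  have conf': "mink (dd c' \<i> \<sigma> x) (dd c' \<i> \<sigma> x) = r" "mink (dd c' 1 \<sigma> x) (dd c' \<i> \<sigma> x) = 0"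
    using assms(2,4) lift unfolding hol_chart_def r_def by metis+
  have l': "linear (\<lambda>h. dd c' h \<sigma> x)"
    by (rule dd_linear[OF smooth_map_csmooth_max_atlas[OF atlas m(2) W(1,3)] W(2) assms(4)])
  have met: "mink (dd c h \<sigma> x) (dd c k \<sigma> x) = r * Re (D h * cnj (D k))" for h k
  proof -
    have "dd c h \<sigma> x = Re (D h) *\<^sub>R dd c' 1 \<sigma> x + Im (D h) *\<^sub>R dd c' \<i> \<sigma> x" for h
      using dd_chain_max_atlas[OF atlas m W(1,3,2) assms(3,4), of h] linear_complex_expand[OF l', of "D h"]
      by (simp add: D_def)
    then show ?thesis
      using conf' by (simp add: scalar_mult_eq_scaleR[symmetric] mink_simps r_def[symmetric]
          mink_commute[of "dd c' \<i> \<sigma> x" "dd c' 1 \<sigma> x"] algebra_simps)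
  qed
  have "mink (dd c 1 \<sigma> x) (dd c 1 \<sigma> x) = mink (dd c \<i> \<sigma> x) (dd c \<i> \<sigma> x)" "mink (dd c 1 \<sigma> x) (dd c \<i> \<sigma> x) = 0"
    using assms(1,3) lift unfolding hol_chart_def by metis+
  then have "Re (D 1 * cnj (D 1)) = Re (D \<i> * cnj (D \<i>))" "Re (D 1 * cnj (D \<i>)) = 0"
    unfolding met using r by simp_all
  then have "(cmod (D 1))\<^sup>2 = (cmod (D \<i>))\<^sup>2" "Re (D 1 * cnj (D \<i>)) = 0"
    unfolding cmod_power2 by (simp_all add: power2_eq_square)
  moreover have "jac D > 0" unfolding D_def by (rule max_atlas_jac_pos[OF atlas m assms(3,4)])
  ultimately show ?thesis using similarity_complex_linear[OF lin] by (simp add: D_def)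
qed

lemma null_line_deform: "null_line_subbundle A L\<phi>"
  unfolding null_line_subbundle_def
proof (intro allI conjI)
  fix x
  obtain l where l: "l \<noteq> 0" "mink l l = 0" "L x = span {l}"
    using null_line unfolding null_line_subbundle_def by blast
  have "\<phi> x *v l \<noteq> 0" using l(1) phi_inv_vec(2)[of x l] by force
  moreover have "mink (\<phi> x *v l) (\<phi> x *v l) = 0" using l(2) phi_isometric by (simp add: isometric_def)
  moreover have "L\<phi> x = span {\<phi> x *v l}"
    unfolding spectral_deformation_def l(3) span_singleton image_image by (simp add: matrix_vector_mult_scaleR)
  ultimately show "\<exists>l. l \<noteq> 0 \<and> mink l l = 0 \<and> L\<phi> x = span {l}" by blast
  show "\<exists>\<sigma>. local_lift A L\<phi> x \<sigma>" using lift_exists local_lift_deform by blast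
qed

lemma immersed_deform: "immersed A L\<phi>"
  unfolding immersed_def
proof (intro ballI allI impI, elim conjE)
  fix c x \<sigma>' and h :: complex
  assume c: "c \<in> A" "x \<in> fst c" and h: "h \<noteq> 0" and "local_lift A L\<phi> x \<sigma>'"
  then obtain \<sigma> where s: "local_lift A L x \<sigma>" "\<sigma>' = (\<lambda>y. \<phi> y *v \<sigma> y)" by (metis local_lift_deformE)
  have "dd c h \<sigma> x \<notin> L x" using immersed c h s(1) unfolding immersed_def by blast
  moreover have "dd c h \<sigma>' x = \<phi> x *v dd c h \<sigma> x"
    unfolding s(2) by (rule dd_deform[OF atlas_subset_max_atlas[OF atlas c(1)] c(2) s(1)])
  ultimately show "dd c h \<sigma>' x \<notin> L\<phi> x"
    unfolding spectral_deformation_def by (metis imageE phi_inv_vec(2))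
qed

lemma not_in_proper_subsphere_deform: "\<not> in_proper_subsphere L\<phi>"
proof
  assume "in_proper_subsphere L\<phi>"
  then obtain V t where V: "subspace V" "V \<noteq> UNIV" "t \<in> V" "mink t t < 0" "\<And>x. L\<phi> x \<subseteq> V"
    unfolding in_proper_subsphere_def by blast
  have "dim V < DIM(real ^ 'n option)"
    using V(1,2) by (metis dim_eq_full dim_subset_UNIV le_neq_implies_less span_eq_iff)
  then obtain u where u: "u \<noteq> 0" "\<And>v. v \<in> span V \<Longrightarrow> orthogonal u v" using orthogonal_to_subspace_exists by blast
  \<comment> \<open>\<open>gram\<close> converts Euclidean orthogonality to \<open>V\<close> into
    orthogonality for the indefinite form.\<close>
  define w where "w = gram *v u"
  have gg: "gram *v (gram *v u) = u" by (simp add: matrix_vector_mul_assoc gram_gram)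
  have w0: "w \<noteq> 0" using gg u(1) by (auto simp: w_def)
  have wV: "mink w v = 0" if "v \<in> V" for v
  proof -
    have "mink v w = v \<bullet> u" by (simp add: mink_gram w_def gg inner_vec_def)
    then show ?thesis using u(2)[OF span_base[OF that]] by (simp add: orthogonal_def inner_commute mink_commute)
  qed
  define \<xi> where "\<xi> y = matrix_inv (\<phi> y) *v w" for y
  have \<xi>m: "mink (\<xi> y) v = mink w (\<phi> y *v v)" for y v
    using phi_isometric[of y] unfolding isometric_def \<xi>_def by (metis phi_inv_vec(1))
  have c\<xi>: "cplx_vec (\<xi> y) = G y *v cplx_vec w" for y
  proof -
    have "F y *v cplx_vec (\<xi> y) = cplx_vec w" by (simp add: \<xi>_def cplx_mat_vec)
    then have "(G y ** F y) *v cplx_vec (\<xi> y) = G y *v cplx_vec w" by (simp add: matrix_vector_mul_assoc[symmetric])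
    then show ?thesis by (simp add: GF)
  qed
  have const: "cplx_vec (\<xi> x) = cplx_vec (\<xi> y)" for x y
  proof (rule locally_constant_imp_constant[of "\<lambda>y. cplx_vec (\<xi> y)"])
    show "connected (UNIV :: 'm set)" using atlas by (simp add: oriented_surface_def)
    fix x
    obtain c where c: "hol_chart A L c" "x \<in> fst c" using hol_charts by blast
    obtain \<sigma> where lift: "local_lift A L x \<sigma>" using lift_exists by blast
    obtain W where W: "x \<in> W" "spectral_patch c W A L S \<sigma> q \<mu> \<phi>" using spectral_patch[OF c lift] .
    interpret sp: spectral_patch c W A L S \<sigma> q \<mu> \<phi> by (rule W(2))
    have o: "mink w (\<phi> y *v \<sigma> y) = 0" if "y \<in> W" for y
      using V(5)[of y] sp.sigma_lift[OF that] by (intro wV) (auto simp: spectral_deformation_def)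
    have "csmooth c W (\<lambda>y. cplx_vec (\<xi> y))"
      unfolding c\<xi> by (intro sp.smooth_mult_vec csmooth_const max_atlas_csmooth[OF hol_max_atlas[OF c(1)] G_smooth])
    moreover have "dd c h (\<lambda>y. cplx_vec (\<xi> y)) y = 0" if "y \<in> W" for y h
      unfolding c\<xi> by (rule sp.constant_pullback[OF that o])
    ultimately show "\<exists>c W. is_chart c \<and> open W \<and> x \<in> W \<and> W \<subseteq> fst c \<and> csmooth c W (\<lambda>y. cplx_vec (\<xi> y)) \<and>
        (\<forall>y\<in>W. \<forall>h. dd c h (\<lambda>y. cplx_vec (\<xi> y)) y = 0)"
      using sp.chart sp.openW sp.W_sub W(1) by blast
  qed
  fix x0 :: 'm
  define w' where "w' = \<xi> x0"
  have \<xi>c: "\<xi> x = w'" for x using const[of x x0] by (simp add: w'_def)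
  have "in_proper_subsphere L"
    unfolding in_proper_subsphere_def
  \<comment> \<open>The hyperplane orthogonal to the constant pullback. It is Lorentzian because it
    contains the pullback of the timelike vector \<open>t\<close> at \<open>x0\<close>.\<close>
  proof (intro exI[of _ "{v. mink w' v = 0}"] conjI allI bexI)
    show "subspace {v. mink w' v = 0}"
      by (auto simp: subspace_def mink_simps scalar_mult_eq_scaleR[symmetric])
    have "w' \<noteq> 0"
    proof
      assume "w' = 0"
      then have "\<phi> x0 *v (matrix_inv (\<phi> x0) *v w) = 0" by (simp only: w'_def \<xi>_def matrix_vector_mult_0_right)
      then show False using w0 by simp
    qed
    then show "{v. mink w' v = 0} \<noteq> UNIV" using mink_nondegenerate[of w'] by blast
    show "matrix_inv (\<phi> x0) *v t \<in> {v. mink w' v = 0}"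
      using wV[OF V(3)] by (simp add: w'_def \<xi>m)
    show "mink (matrix_inv (\<phi> x0) *v t) (matrix_inv (\<phi> x0) *v t) < 0"
      using V(4) phi_isometric[of x0] unfolding isometric_def by (metis phi_inv_vec(1))
    show "L x \<subseteq> {v. mink w' v = 0}" for x
    proof
      fix v assume "v \<in> L x"
      then have "mink w (\<phi> x *v v) = 0" using V(5)[of x] by (intro wV) (auto simp: spectral_deformation_def)
      then show "v \<in> {v. mink w' v = 0}" using \<xi>m[of x v] by (simp add: \<xi>c)
    qed
  qed
  then show False using surface by (simp add: real_surface_def)
qed

lemma real_surface_deform: "real_surface A L\<phi>"
  unfolding real_surface_def hol_chart_deform
  using null_line_deform immersed_deform not_in_proper_subsphere_deform hol_charts by blast

lemma csc_deform: "central_sphere_congruence A L\<phi> S\<phi>"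
  unfolding central_sphere_congruence_def hol_chart_deform Let_def
proof (intro allI impI, elim conjE)
  fix c x \<sigma>' assume c: "hol_chart A L c" "x \<in> fst c" and "local_lift A L\<phi> x \<sigma>'"
  then obtain \<sigma> where s: "local_lift A L x \<sigma>" "\<sigma>' = (\<lambda>y. \<phi> y *v \<sigma> y)" by (metis local_lift_deformE)
  obtain W where W: "x \<in> W" "spectral_patch c W A L S \<sigma> q \<mu> \<phi>" using spectral_patch[OF c s(1)] .
  interpret sp: spectral_patch c W A L S \<sigma> q \<mu> \<phi> by (rule W(2))
  show "S\<phi> x = vec.span {(cplx_vec \<circ> \<sigma>') x, d_z c (cplx_vec \<circ> \<sigma>') x,
      d_zbar c (cplx_vec \<circ> \<sigma>') x, d_z c (d_zbar c (cplx_vec \<circ> \<sigma>')) x}"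
    using sp.spectral_sphere_at[OF W(1)] unfolding s(2) sp.s'_def .
qed

lemma L_wedge_L1_deform: "in_L_wedge_L1 A L\<phi> q\<phi>"
  unfolding in_L_wedge_L1_def hol_chart_deform Let_def
proof (intro allI impI, elim conjE)
  fix c x \<sigma>' and h :: complex
  assume c: "hol_chart A L c" "x \<in> fst c" and "local_lift A L\<phi> x \<sigma>'"
  then obtain \<sigma> where s: "local_lift A L x \<sigma>" "\<sigma>' = (\<lambda>y. \<phi> y *v \<sigma> y)" by (metis local_lift_deformE)
  obtain W where W: "x \<in> W" "spectral_patch c W A L S \<sigma> q \<mu> \<phi>" using spectral_patch[OF c s(1)] .
  interpret sp: spectral_patch c W A L S \<sigma> q \<mu> \<phi> by (rule W(2))
  show "\<exists>a\<in>vec.span {(cplx_vec \<circ> \<sigma>') x, d_z c (cplx_vec \<circ> \<sigma>') x, d_zbar c (cplx_vec \<circ> \<sigma>') x}.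
      q\<phi> c x h = wedge ((cplx_vec \<circ> \<sigma>') x) a"
    using sp.L_wedge_L1_spectral[OF W(1)] unfolding s(2) sp.s'_def .
qed

lemma G_cplx: "G y = cplx_mat (matrix_inv (\<phi> y))"
proof -
  have "F y ** cplx_mat (matrix_inv (\<phi> y)) = mat 1"
    by (simp add: cplx_mat_mult[symmetric] phi_inv cplx_mat_one)
  then show ?thesis using matrix_mul_assoc[of "G y" "F y" "cplx_mat (matrix_inv (\<phi> y))"] GF by simp
qed

lemma real_form_deform: "real_form A L\<phi> q\<phi>"
  unfolding real_form_def hol_chart_deform
proof (intro allI impI ballI)
  fix c x h assume c: "hol_chart A L c" "x \<in> fst c"
  have "map_matrix cnj (q c x h) = q c x h" for h
    using real_form_q c unfolding real_form_def by blast
  moreover have "map_matrix cnj (r *\<^sub>R M - r' *\<^sub>R M') = r *\<^sub>R map_matrix cnj M - r' *\<^sub>R map_matrix cnj M'"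
    for r r' and M M' :: "complex^'n option^'n option"
    by (simp add: vec_eq_iff)
  ultimately show "map_matrix cnj (q\<phi> c x h) = q\<phi> c x h"
    unfolding Ad_form_def G_cplx q_spectral_combination[OF mu] by (simp add: map_matrix_cnj_mult)
qed

lemma one_form_deform: "one_form A L\<phi> q\<phi>"
  unfolding one_form_def hol_chart_deform
proof (intro allI impI conjI ballI)
  fix c x assume c: "hol_chart A L c" "x \<in> fst c"
  have "linear (q c x)" using one_form_q c unfolding one_form_def by blast
  then interpret l: linear "q c x" .
  show "linear (q\<phi> c x)"
    unfolding Ad_form_def q_spectral_combination[OF mu]
  proof (rule linearI)
    fix h k and r :: real
    show "F x ** (Re (\<mu>\<^sup>2) *\<^sub>R q c x (h + k) - Im (\<mu>\<^sup>2) *\<^sub>R q c x (\<i> * (h + k))) ** G x =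
        F x ** (Re (\<mu>\<^sup>2) *\<^sub>R q c x h - Im (\<mu>\<^sup>2) *\<^sub>R q c x (\<i> * h)) ** G x +
        F x ** (Re (\<mu>\<^sup>2) *\<^sub>R q c x k - Im (\<mu>\<^sup>2) *\<^sub>R q c x (\<i> * k)) ** G x"
      unfolding distrib_left l.add by (simp add: matrix_ring_simps scaleR_add_right)
    show "F x ** (Re (\<mu>\<^sup>2) *\<^sub>R q c x (r *\<^sub>R h) - Im (\<mu>\<^sup>2) *\<^sub>R q c x (\<i> * (r *\<^sub>R h))) ** G x =
        r *\<^sub>R (F x ** (Re (\<mu>\<^sup>2) *\<^sub>R q c x h - Im (\<mu>\<^sup>2) *\<^sub>R q c x (\<i> * h)) ** G x)"
      unfolding mult_scaleR_right l.scale
      by (simp add: matrix_ring_simps scaleR_diff_right mult.commute)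
  qed
next
  fix c h assume c: "hol_chart A L c"
  have o: "open (fst c)" using max_atlas_is_chart[OF hol_max_atlas[OF c]] by (simp add: is_chart_def)
  have qs: "smooth_map A (fst c) (\<lambda>x. q c x h)" for h using one_form_q c unfolding one_form_def by blast
  have "smooth_map A (fst c) (\<lambda>x. Re (\<mu>\<^sup>2) *\<^sub>R q c x h + (- Im (\<mu>\<^sup>2)) *\<^sub>R q c x (\<i> * h))"
    by (intro smooth_map_add[OF atlas o] smooth_map_bounded_linear[OF atlas o bounded_linear_scaleR_right] qs)
  then show "smooth_map A (fst c) (\<lambda>x. q\<phi> c x h)"
    unfolding Ad_form_def q_spectral_combination[OF mu]
    by (intro smooth_map_bilinear[OF atlas o bounded_bilinear_matrix_mult] smooth_map_subset[OF F_smooth]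
        smooth_map_subset[OF G_smooth]) simp_all
next
  fix c c' x h assume c: "hol_chart A L c \<and> hol_chart A L c'" "x \<in> fst c \<inter> fst c'"
  have t: "q c x h = q c' x (dd c h (snd c') x)" for h
    using one_form_q c unfolding one_form_def by blast
  have "dd c (\<i> * h) (snd c') x = \<i> * dd c h (snd c') x" using hol_transition c by blast
  then show "q\<phi> c x h = q\<phi> c' x (dd c h (snd c') x)"
    unfolding Ad_form_def q_spectral_combination[OF mu] t[of h] t[of "\<i> * h"] by simp
qed

theorem constrained_willmore_deform:
  "constrained_willmore A L\<phi> S\<phi> q\<phi>"
  unfolding constrained_willmore_def hol_chart_deform
proof (intro conjI real_surface_deform csc_deform one_form_deform real_form_deform L_wedge_L1_deform allI impI ballI)
  fix c x h k assume c: "hol_chart A L c" "x \<in> fst c"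
  obtain \<sigma> where lift: "local_lift A L x \<sigma>" using lift_exists by blast
  obtain W where W: "x \<in> W" "spectral_patch c W A L S \<sigma> q \<mu> \<phi>" using spectral_patch[OF c lift] .
  show "ext_D S\<phi> q\<phi> c x h k = 0"
    "ext_D S\<phi> (hodge (N_form S\<phi>)) c x h k =
      2 *\<^sub>R wedge_bracket q\<phi> (hodge (N_form S\<phi>)) c x h k"
    by (rule spectral_patch.willmore_spectral[OF W(2,1)])+
qed

text \<open>Substituting \<mu> \<lambda> multiplies the outer coefficients by 1 / \<mu> and \<mu>,
  which are conjugate on the unit circle, so the real shape is kept. The value at 1 becomes \<phi>
  p(\<mu>), and \<open>nontrivial\<close> lists its components in S and in the complement.\<close>

lemma laurent_section_deform:
  assumes p: "laurent_section A S v v0 p"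
    and nontrivial: "(\<exists>x. v0 x \<noteq> 0) \<or> (\<exists>x. cnj \<mu> *s v x + \<mu> *s cnj_vec (v x) \<noteq> 0)"
  shows "laurent_section A S\<phi> (\<lambda>x. F x *v ((1 / \<mu>) *s v x)) (\<lambda>x. F x *v v0 x)
    (\<lambda>lam x. F x *v p (\<mu> * lam) x)"
  unfolding laurent_section_def
proof (intro conjI allI impI)
  have v0: "smooth_map A UNIV v0" "\<And>x. v0 x \<in> S x" "\<And>x. cnj_vec (v0 x) = v0 x"
    and v: "smooth_map A UNIV v" "\<And>x. v x \<in> perp (S x)"
    and pe: "\<And>lam x. lam \<noteq> 0 \<Longrightarrow> p lam x = (1 / lam) *s v x + v0 x + lam *s cnj_vec (v x)"
    using p by (auto simp: laurent_section_def)
  have sF: "smooth_map A UNIV (\<lambda>x. F x *v f x)" if "smooth_map A UNIV f" for f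
    by (rule smooth_map_bilinear[OF atlas open_UNIV bounded_bilinear_matrix_vector_mult F_smooth that])
  have mu0: "\<mu> \<noteq> 0" using mu by auto
  have inv: "1 / \<mu> = cnj \<mu>" using spectral_coefficients(1)[OF mu] by (simp add: complex_eq_iff)
  have cF: "cnj_vec (F x *v w) = F x *v cnj_vec w" for x w by (simp add: cnj_mat_vec)
  show "smooth_map A UNIV (\<lambda>x. F x *v v0 x)" by (rule sF[OF v0(1)])
  show "F x *v v0 x \<in> S\<phi> x" for x using v0(2) by (simp add: spectral_sphere_def)
  show "cnj_vec (F x *v v0 x) = F x *v v0 x" for x by (simp add: cF v0(3))
  show "smooth_map A UNIV (\<lambda>x. F x *v ((1 / \<mu>) *s v x))"
    by (intro sF smooth_map_bounded_linear[OF atlas open_UNIV _ v(1)]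
        bounded_bilinear.bounded_linear_right[OF bounded_bilinear_vector_scalar_mult])
  show "F x *v ((1 / \<mu>) *s v x) \<in> perp (S\<phi> x)" for x
    using v(2)[of x] F_isometric[of x]
    by (auto simp: perp_def spectral_sphere_def isometric_def mink_simps)
  show "F x *v p (\<mu> * lam) x = (1 / lam) *s (F x *v ((1 / \<mu>) *s v x)) + F x *v v0 x +
      lam *s cnj_vec (F x *v ((1 / \<mu>) *s v x))" if "lam \<noteq> 0" for lam x
    using that mu0 by (simp add: pe cF inv matrix_vector_right_distrib matrix_vec_scale)
       (simp add: vec_eq_iff inv[symmetric])
  show "\<exists>x. F x *v p (\<mu> * 1) x \<noteq> 0"
  proof (rule ccontr)
    assume "\<not> ?thesis"
    then have F0: "F x *v p \<mu> x = 0" for x by simp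
    have p0: "(1 / \<mu>) *s v x + v0 x + \<mu> *s cnj_vec (v x) = 0" for x
    proof -
      have "G x *v (F x *v p \<mu> x) = 0" unfolding F0 by simp
      then show ?thesis by (simp add: matrix_vector_mul_assoc GF pe[OF mu0])
    qed
    \<comment> \<open>Projection onto S isolates \<open>v0\<close>, after which the vanishing sum
      reduces to its component in the complement.\<close>
    have v00: "v0 x = 0" for x
    proof -
      obtain c where c: "hol_chart A L c" "x \<in> fst c" using hol_charts by blast
      obtain \<sigma> where lift: "local_lift A L x \<sigma>" using lift_exists by blast
      obtain W where W: "x \<in> W" "surface_patch c W A L S \<sigma>" using patch[OF c lift] .
      interpret sp: surface_patch c W A L S \<sigma> by (rule W(2))
      have "sp.P x *v v x = 0" "sp.P x *v cnj_vec (v x) = 0" "sp.P x *v v0 x = v0 x"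
        using v(2) v0(2) sp.P_cnj_perp[OF W(1)] is_proj_perp_iff[OF sp.P_proj[OF W(1)]]
          is_proj_mem_iff[OF sp.P_proj[OF W(1)]] by blast+
      then show ?thesis
        using arg_cong[OF p0[of x], of "\<lambda>w. sp.P x *v w"]
        by (simp add: matrix_vector_right_distrib matrix_vec_scale)
    qed
    then have "cnj \<mu> *s v x + \<mu> *s cnj_vec (v x) = 0" for x using p0[of x] by (simp add: inv)
    with v00 nontrivial show False by blast
  qed
qed

text \<open>\<open>p\<close> is known only through its values, so smoothness of
  \<open>p (\<mu> * lam)\<close> is first read off from the coefficients; the conjugation identity
  then applies.\<close>

lemma d_lambda_deform_zero:
  assumes p: "laurent_section A S v v0 p" and c: "hol_chart A L c" "x \<in> fst c" and "lam \<noteq> 0"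
    and 0: "d_lambda S q (\<mu> * lam) c h (p (\<mu> * lam)) x = 0"
  shows "d_lambda S\<phi> q\<phi> lam c h (\<lambda>y. F y *v p (\<mu> * lam) y) x = 0"
proof -
  obtain \<sigma> where lift: "local_lift A L x \<sigma>" using lift_exists by blast
  obtain W where W: "x \<in> W" "spectral_patch c W A L S \<sigma> q \<mu> \<phi>" using spectral_patch[OF c lift] .
  interpret sp: spectral_patch c W A L S \<sigma> q \<mu> \<phi> by (rule W(2))
  have nz: "\<mu> * lam \<noteq> 0" using mu assms(4) by auto
  have sm: "smooth_map A UNIV v0" "smooth_map A UNIV v" using p by (auto simp: laurent_section_def)
  have "p (\<mu> * lam) = (\<lambda>x. (1 / (\<mu> * lam)) *s v x + v0 x + (\<mu> * lam) *s cnj_vec (v x))"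
    using p nz unfolding laurent_section_def by blast
  moreover have "smooth_map A UNIV (\<lambda>x. (1 / (\<mu> * lam)) *s v x + v0 x + (\<mu> * lam) *s cnj_vec (v x))"
    by (intro smooth_map_add[OF atlas open_UNIV] sm
        smooth_map_bounded_linear[OF atlas open_UNIV sp.bounded_linear_scale]
        smooth_map_bounded_linear[OF atlas open_UNIV bounded_linear_cnj_vec])
  ultimately have "csmooth c W (p (\<mu> * lam))"
    using max_atlas_csmooth[OF hol_max_atlas[OF c(1)]] by metis
  then show ?thesis using sp.d_lambda_spectral[OF _ W(1)] 0 by simp
qed

end

theorem theorem7p6:
  fixes n :: nat
    and A :: "'m::{t2_space, second_countable_topology} chart set"
    and L :: "'m \<Rightarrow> (real ^ 'n::finite option) set"
    and S :: "'m \<Rightarrow> (complex ^ 'n option) set"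
    and q :: "('m, 'n option) endo_form"
    and v v0 :: "'m \<Rightarrow> complex ^ 'n option"
    and p :: "complex \<Rightarrow> 'm \<Rightarrow> complex ^ 'n option"
    and \<mu> :: complex
    and \<phi> :: "'m \<Rightarrow> real ^ 'n option ^ 'n option"
  assumes "n \<ge> 3" and "CARD('n) = n + 1"
    and "oriented_surface A"
    and "constrained_willmore A L S q"
    and "laurent_section A S v v0 p"
    and "cmod \<mu> = 1"
    and "spectral_iso A L S q \<mu> \<phi>"
    and "(\<exists>x. v0 x \<noteq> 0) \<or> (\<exists>x. cnj \<mu> *s v x + \<mu> *s cnj_vec (v x) \<noteq> 0)"
    and "conserved_quantity A L S q p"
  shows "conserved_quantity A (spectral_deformation \<phi> L) (spectral_sphere \<phi> S)
           (Ad_form \<phi> (q_spectral \<mu> q)) (\<lambda>lam x. cplx_mat (\<phi> x) *v p (\<mu> * lam) x)"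
proof -
  interpret spectral_data A L S q \<mu> \<phi>
    using assms by unfold_locales
  have cons: "d_lambda S q lam c h (p lam) x = 0" if "lam \<noteq> 0" "hol_chart A L c" "x \<in> fst c" for lam c h x
    using assms(9) that unfolding conserved_quantity_def by blast
  have "\<mu> \<noteq> 0" using mu by auto
  then have "d_lambda (spectral_sphere \<phi> S) (Ad_form \<phi> (q_spectral \<mu> q)) lam c h (\<lambda>y. F y *v p (\<mu> * lam) y) x = 0"
    if "lam \<noteq> 0" "hol_chart A L c" "x \<in> fst c" for lam c h x
    using that by (intro d_lambda_deform_zero[OF assms(5)] cons) auto
  then show ?thesis
    unfolding conserved_quantity_def hol_chart_deform
    using constrained_willmore_deform laurent_section_deform[OF assms(5,8)] by blast
qed

end
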